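(* Let $(\Gamma\rightrightarrows M,\mathcal J)$ be a Glanon groupoid, and write $\mathcal J=\begin{pmatrix}N&\pi^\sharp\\ \omega^\flat&-N^*\end{pmatrix}$ with respect to $T\Gamma\oplus T^*\Gamma$, where $\pi$ is the Poisson bivector field on $\Gamma$ determined by $\mathcal J$. Then $(\Gamma\rightrightarrows M,\pi)$ is a Poisson groupoid.
   Context: For a manifold $N$ put $\mathsf P_N=TN\oplus T^*N$, with pairing $\langle X+\alpha,Y+\beta\rangle_N=\alpha(Y)+\beta(X)$ and Dorfman bracket $[\![X+\alpha,Y+\beta]\!]=[X,Y]+\mathcal L_X\beta-\mathbf i_Y d\alpha$. A generalized complex structure on $N$ is a vector bundle endomorphism $\mathcal J$ of $\mathsf P_N$ over the identity, orthogonal for the pairing, with $\mathcal J^2=-\mathrm{Id}$, whose $+i$-eigenbundle in $\mathsf P_N\otimes\mathbb C$ is closed under the bracket. Every generalized complex structure has the displayed block form with $\pi$ a bivector field, $\omega$ a 2-form, $N$ a $(1,1)$-tensor, and $\pi$ is automatically a Poisson bivector field. For a Lie groupoid $\Gamma\rightrightarrows M$ (source $\mathsf s$, target $\mathsf t$, inversion $\mathsf i$, $gh$ defined if $\mathsf s(g)=\mathsf t(h)$) with Lie algebroid $A=\ker T\mathsf s|_M$, $a^r(g)=TR_ga(\mathsf t(g))$ and $a^l(g)=-T(L_g\circ\mathsf i)a(\mathsf s(g))$, let $T\Gamma\rightrightarrows TM$ be the tangent groupoid and $T^*\Gamma\rightrightarrows A^*$ the cotangent groupoid: $\hat{\mathsf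 s}(\alpha_g)(a(\mathsf s(g)))=\alpha_g(a^l(g))$, $\hat{\mathsf t}(\alpha_g)(a(\mathsf t(g)))=\alpha_g(a^r(g))$, $(\alpha_g\star\alpha_h)(v_g\star v_h)=\alpha_g(v_g)+\alpha_h(v_h)$. Then $\mathsf P_\Gamma=T\Gamma\times_\Gamma T^*\Gamma\rightrightarrows TM\oplus A^*$ is a Lie groupoid. A Glanon groupoid is a Lie groupoid $\Gamma$ with a generalized complex structure $\mathcal J:\mathsf P_\Gamma\to\mathsf P_\Gamma$ that is a Lie groupoid morphism (over some map of $TM\oplus A^*$). A Poisson groupoid is a Lie groupoid with a Poisson structure $\pi$ on $\Gamma$ such that the graph of the multiplication is coisotropic in $\Gamma\times\Gamma\times\bar\Gamma$, $\bar\Gamma$ being $\Gamma$ with $-\pi$. *)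

theory Defs
  imports "HOL-Analysis.Analysis" "HOL-Library.Function_Algebras"
begin

section \<open>Linear algebra on function spaces\<close>

text \<open>Tangent vectors, covectors and smooth functions are all represented as functions, and added
  and scaled pointwise.\<close>

instantiation "fun" :: (type, real_vector) real_vector
begin
definition scaleR_fun :: "real \<Rightarrow> ('a \<Rightarrow> 'b) \<Rightarrow> 'a \<Rightarrow> 'b" where
  "scaleR_fun c f = (\<lambda>x. c *\<^sub>R f x)"
instance
  by standard (auto simp: scaleR_fun_def plus_fun_def fun_eq_iff algebra_simps)
end

definition linear_on :: "'a::real_vector set \<Rightarrow> ('a \<Rightarrow> 'b::real_vector) \<Rightarrow> bool" where
  "linear_on V F \<longleftrightarrow>
     (\<forall>u\<in>V. \<forall>v\<in>V. F (u + v) = F u + F v) \<and> (\<forall>c. \<forall>u\<in>V. F (c *\<^sub>R u) = c *\<^sub>R F u)"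

text \<open>Functionals vanish outside their domain, so that equality of functionals is equality on
  \<open>V\<close>.\<close>

definition dual :: "'a::real_vector set \<Rightarrow> ('a \<Rightarrow> real) set" where
  "dual V = {\<alpha>. linear_on V \<alpha> \<and> (\<forall>v. v \<notin> V \<longrightarrow> \<alpha> v = 0)}"

definition on_space :: "'a set \<Rightarrow> ('a \<Rightarrow> real) \<Rightarrow> 'a \<Rightarrow> real" where
  "on_space V \<alpha> = (\<lambda>v. if v \<in> V then \<alpha> v else 0)"


section \<open>Smooth manifolds and smooth functions\<close>

text \<open>Differentiability of order \<open>k\<close> on an open subset of a finite-dimensional space, by
  iterated directional derivatives.\<close>

primrec Ck_on :: "nat \<Rightarrow> 'e::real_normed_vector set \<Rightarrow> ('e \<Rightarrow> 'f::real_normed_vector) \<Rightarrow> bool" where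
  "Ck_on 0 S f \<longleftrightarrow> continuous_on S f"
| "Ck_on (Suc k) S f \<longleftrightarrow>
     (\<forall>x\<in>S. f differentiable (at x)) \<and> (\<forall>v. Ck_on k S (\<lambda>x. frechet_derivative f (at x) v))"

definition smooth_on :: "'e::real_normed_vector set \<Rightarrow> ('e \<Rightarrow> 'f::real_normed_vector) \<Rightarrow> bool" where
  "smooth_on S f \<longleftrightarrow> (\<forall>k. Ck_on k S f)"

record ('a, 'e) manifold =
  mtop :: "'a topology"
  atlas :: "('a set \<times> ('a \<Rightarrow> 'e)) set"

abbreviation points :: "('a, 'e, 'z) manifold_scheme \<Rightarrow> 'a set" where
  "points M \<equiv> topspace (mtop M)"

text \<open>The model space is any finite-dimensional space; unlike \<open>euclidean_space\<close> this includes
  dimension 0, which is needed for Lie groups, i.e. Lie groupoids over a point.  The atlas need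
  not be maximal.\<close>

definition smooth_manifold :: "('a, 'e::real_normed_vector) manifold \<Rightarrow> bool" where
  "smooth_manifold M \<longleftrightarrow>
     (\<exists>B::'e set. finite B \<and> span B = UNIV) \<and>
     Hausdorff_space (mtop M) \<and> second_countable (mtop M) \<and>
     \<Union> (fst ` atlas M) = points M \<and>
     (\<forall>(U, \<phi>) \<in> atlas M. openin (mtop M) U \<and> open (\<phi> ` U) \<and>
        homeomorphic_map (subtopology (mtop M) U) (top_of_set (\<phi> ` U)) \<phi>) \<and>
     (\<forall>(U, \<phi>) \<in> atlas M. \<forall>(V, \<psi>) \<in> atlas M. smooth_on (\<phi> ` (U \<inter> V)) (\<psi> \<circ> inv_into U \<phi>))"

definition prod_manifold ::
    "('a, 'e) manifold \<Rightarrow> ('b, 'f) manifold \<Rightarrow> ('a \<times> 'b, 'e \<times> 'f) manifold" where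
  "prod_manifold M N =
     \<lparr>mtop = prod_topology (mtop M) (mtop N),
      atlas = {(U \<times> V, map_prod \<phi> \<psi>) | U \<phi> V \<psi>. (U, \<phi>) \<in> atlas M \<and> (V, \<psi>) \<in> atlas N}\<rparr>"

text \<open>Values of functions outside the manifold are irrelevant.\<close>

definition smooth_fun :: "('a, 'e::real_normed_vector) manifold \<Rightarrow> ('a \<Rightarrow> real) set" where
  "smooth_fun M = {f. \<forall>(U, \<phi>) \<in> atlas M. smooth_on (\<phi> ` U) (f \<circ> inv_into U \<phi>)}"

text \<open>Smooth functions on a subset: those that locally extend to the ambient manifold.  For an
  embedded submanifold these are the functions smooth in its submanifold structure.\<close>

definition smooth_fun_on :: "('a, 'e::real_normed_vector) manifold \<Rightarrow> 'a set \<Rightarrow> ('a \<Rightarrow> real) set" where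
  "smooth_fun_on M S =
     {f. \<forall>p\<in>S. \<exists>W g. openin (mtop M) W \<and> p \<in> W \<and> g \<in> smooth_fun M \<and> (\<forall>q\<in>S \<inter> W. f q = g q)}"

text \<open>Smoothness of maps is tested by pulling back smooth functions; by Hausdorffness and bump
  functions this is smoothness in charts.\<close>

definition smooth_map_on ::
    "('a, 'e::real_normed_vector) manifold \<Rightarrow> 'a set \<Rightarrow> ('b, 'f::real_normed_vector) manifold
     \<Rightarrow> ('a \<Rightarrow> 'b) \<Rightarrow> bool" where
  "smooth_map_on M S N F \<longleftrightarrow>
     F ` S \<subseteq> points N \<and> (\<forall>h\<in>smooth_fun N. h \<circ> F \<in> smooth_fun_on M S)"

abbreviation smooth_map ::
    "('a, 'e::real_normed_vector) manifold \<Rightarrow> ('b, 'f::real_normed_vector) manifold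
     \<Rightarrow> ('a \<Rightarrow> 'b) \<Rightarrow> bool" where
  "smooth_map M N F \<equiv> smooth_map_on M (points M) N F"


section \<open>Tangent and cotangent vectors\<close>

type_synonym 'a tvec = "('a \<Rightarrow> real) \<Rightarrow> real"
type_synonym 'a covec = "'a tvec \<Rightarrow> real"

definition derivations :: "('a \<Rightarrow> real) set \<Rightarrow> 'a \<Rightarrow> 'a tvec set" where
  "derivations C p =
     {v \<in> dual C. \<forall>f\<in>C. \<forall>g\<in>C. v (\<lambda>x. f x * g x) = f p * v g + g p * v f}"

definition tangent_space :: "('a, 'e::real_normed_vector) manifold \<Rightarrow> 'a \<Rightarrow> 'a tvec set" where
  "tangent_space M p = derivations (smooth_fun M) p"

definition cotangent_space :: "('a, 'e::real_normed_vector) manifold \<Rightarrow> 'a \<Rightarrow> 'a covec set" where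
  "cotangent_space M p = dual (tangent_space M p)"

definition differential :: "('a, 'e::real_normed_vector) manifold \<Rightarrow> ('a \<Rightarrow> real) \<Rightarrow> 'a \<Rightarrow> 'a covec" where
  "differential M f p = on_space (tangent_space M p) (\<lambda>v. v f)"

text \<open>The tangent map of \<open>F\<close>, a map into \<open>N\<close>.  The domain is not mentioned: it is the manifold
  or submanifold on whose smooth functions the derivation \<open>v\<close> acts.\<close>

definition push :: "('b, 'f::real_normed_vector) manifold \<Rightarrow> ('a \<Rightarrow> 'b) \<Rightarrow> 'a tvec \<Rightarrow> 'b tvec" where
  "push N F v = on_space (smooth_fun N) (\<lambda>h. v (h \<circ> F))"

text \<open>For an embedded submanifold \<open>S\<close> of \<open>M\<close>, tangent vectors of \<open>S\<close> are derivations of its own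
  smooth functions; the image of \<open>T\<^sub>pS\<close> in \<open>T\<^sub>pM\<close> under the tangent map of the inclusion is
  \<open>sub_tangent M S p\<close>.\<close>

definition sub_tangent :: "('a, 'e::real_normed_vector) manifold \<Rightarrow> 'a set \<Rightarrow> 'a \<Rightarrow> 'a tvec set" where
  "sub_tangent M S p = push M (\<lambda>x. x) ` derivations (smooth_fun_on M S) p"

definition as_sub_tangent ::
    "('a, 'e::real_normed_vector) manifold \<Rightarrow> 'a set \<Rightarrow> 'a \<Rightarrow> 'a tvec \<Rightarrow> 'a tvec" where
  "as_sub_tangent M S p v =
     (THE \<delta>. \<delta> \<in> derivations (smooth_fun_on M S) p \<and> push M (\<lambda>x. x) \<delta> = v)"

definition submersion ::
    "('a, 'e::real_normed_vector) manifold \<Rightarrow> ('b, 'f::real_normed_vector) manifold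
     \<Rightarrow> ('a \<Rightarrow> 'b) \<Rightarrow> bool" where
  "submersion M N F \<longleftrightarrow> smooth_map M N F \<and>
     (\<forall>p\<in>points M. push N F ` tangent_space M p = tangent_space N (F p))"


section \<open>Tensor fields, brackets and the generalized tangent bundle\<close>

definition vector_field :: "('a, 'e::real_normed_vector) manifold \<Rightarrow> ('a \<Rightarrow> 'a tvec) \<Rightarrow> bool" where
  "vector_field M X \<longleftrightarrow> (\<forall>p\<in>points M. X p \<in> tangent_space M p) \<and>
     (\<forall>f\<in>smooth_fun M. (\<lambda>p. X p f) \<in> smooth_fun M)"

definition one_form :: "('a, 'e::real_normed_vector) manifold \<Rightarrow> ('a \<Rightarrow> 'a covec) \<Rightarrow> bool" where
  "one_form M \<alpha> \<longleftrightarrow> (\<forall>p\<in>points M. \<alpha> p \<in> cotangent_space M p) \<and>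
     (\<forall>X. vector_field M X \<longrightarrow> (\<lambda>p. \<alpha> p (X p)) \<in> smooth_fun M)"

definition alternating_on :: "'a::real_vector set \<Rightarrow> ('a \<Rightarrow> 'a \<Rightarrow> real) \<Rightarrow> bool" where
  "alternating_on V b \<longleftrightarrow> (\<forall>u\<in>V. linear_on V (b u)) \<and> (\<forall>u\<in>V. \<forall>v\<in>V. b v u = - b u v)"

definition two_form ::
    "('a, 'e::real_normed_vector) manifold \<Rightarrow> ('a \<Rightarrow> 'a tvec \<Rightarrow> 'a tvec \<Rightarrow> real) \<Rightarrow> bool" where
  "two_form M \<omega> \<longleftrightarrow> (\<forall>p\<in>points M. alternating_on (tangent_space M p) (\<omega> p)) \<and>
     (\<forall>X Y. vector_field M X \<and> vector_field M Y \<longrightarrow> (\<lambda>p. \<omega> p (X p) (Y p)) \<in> smooth_fun M)"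

definition bivector_field ::
    "('a, 'e::real_normed_vector) manifold \<Rightarrow> ('a \<Rightarrow> 'a covec \<Rightarrow> 'a covec \<Rightarrow> real) \<Rightarrow> bool" where
  "bivector_field M \<pi> \<longleftrightarrow> (\<forall>p\<in>points M. alternating_on (cotangent_space M p) (\<pi> p)) \<and>
     (\<forall>\<alpha> \<beta>. one_form M \<alpha> \<and> one_form M \<beta> \<longrightarrow> (\<lambda>p. \<pi> p (\<alpha> p) (\<beta> p)) \<in> smooth_fun M)"

definition tensor11_field ::
    "('a, 'e::real_normed_vector) manifold \<Rightarrow> ('a \<Rightarrow> 'a tvec \<Rightarrow> 'a tvec) \<Rightarrow> bool" where
  "tensor11_field M N \<longleftrightarrow>
     (\<forall>p\<in>points M. linear_on (tangent_space M p) (N p) \<and>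
        N p ` tangent_space M p \<subseteq> tangent_space M p) \<and>
     (\<forall>X. vector_field M X \<longrightarrow> vector_field M (\<lambda>p. N p (X p)))"

text \<open>Sign conventions: \<open>\<beta>(\<pi>\<^sup>\<sharp>\<alpha>) = \<pi>(\<alpha>, \<beta>)\<close> and \<open>(\<omega>\<^sup>\<flat>X)(Y) = \<omega>(X, Y)\<close>.  As a derivation,
  \<open>\<pi>\<^sup>\<sharp>\<alpha>\<close> maps \<open>f\<close> to \<open>\<pi>(\<alpha>, df)\<close>.\<close>

definition sharp ::
    "('a, 'e::real_normed_vector) manifold \<Rightarrow> ('a \<Rightarrow> 'a covec \<Rightarrow> 'a covec \<Rightarrow> real)
     \<Rightarrow> 'a \<Rightarrow> 'a covec \<Rightarrow> 'a tvec" where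
  "sharp M \<pi> p \<alpha> = on_space (smooth_fun M) (\<lambda>f. \<pi> p \<alpha> (differential M f p))"

definition flat ::
    "('a, 'e::real_normed_vector) manifold \<Rightarrow> ('a \<Rightarrow> 'a tvec \<Rightarrow> 'a tvec \<Rightarrow> real)
     \<Rightarrow> 'a \<Rightarrow> 'a tvec \<Rightarrow> 'a covec" where
  "flat M \<omega> p X = on_space (tangent_space M p) (\<omega> p X)"

definition transpose_tensor ::
    "('a, 'e::real_normed_vector) manifold \<Rightarrow> ('a \<Rightarrow> 'a tvec \<Rightarrow> 'a tvec)
     \<Rightarrow> 'a \<Rightarrow> 'a covec \<Rightarrow> 'a covec" where
  "transpose_tensor M N p \<alpha> = on_space (tangent_space M p) (\<lambda>X. \<alpha> (N p X))"

definition lie_bracket :: "('a \<Rightarrow> 'a tvec) \<Rightarrow> ('a \<Rightarrow> 'a tvec) \<Rightarrow> 'a \<Rightarrow> 'a tvec" where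
  "lie_bracket X Y p = (\<lambda>f. X p (\<lambda>q. Y q f) - Y p (\<lambda>q. X q f))"

text \<open>The formulas for \<open>\<L>\<^sub>X\<beta>\<close> and \<open>d\<alpha>\<close> below are evaluated on vector fields extending the
  given tangent vectors; they do not depend on the extension.\<close>

definition extend :: "('a, 'e::real_normed_vector) manifold \<Rightarrow> 'a \<Rightarrow> 'a tvec \<Rightarrow> 'a \<Rightarrow> 'a tvec" where
  "extend M p v = (SOME X. vector_field M X \<and> X p = v)"

definition lie_deriv ::
    "('a, 'e::real_normed_vector) manifold \<Rightarrow> ('a \<Rightarrow> 'a tvec) \<Rightarrow> ('a \<Rightarrow> 'a covec)
     \<Rightarrow> 'a \<Rightarrow> 'a covec" where
  "lie_deriv M X \<beta> p = on_space (tangent_space M p) (\<lambda>v.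
     let Z = extend M p v in X p (\<lambda>q. \<beta> q (Z q)) - \<beta> p (lie_bracket X Z p))"

definition ext_deriv ::
    "('a, 'e::real_normed_vector) manifold \<Rightarrow> ('a \<Rightarrow> 'a covec) \<Rightarrow> 'a \<Rightarrow> 'a tvec \<Rightarrow> 'a tvec \<Rightarrow> real" where
  "ext_deriv M \<alpha> p u v =
     (let U = extend M p u; V = extend M p v
      in u (\<lambda>q. \<alpha> q (V q)) - v (\<lambda>q. \<alpha> q (U q)) - \<alpha> p (lie_bracket U V p))"

type_synonym 'a gvec = "'a tvec \<times> 'a covec"

definition P_space :: "('a, 'e::real_normed_vector) manifold \<Rightarrow> 'a \<Rightarrow> 'a gvec set" where
  "P_space M p = tangent_space M p \<times> cotangent_space M p"

definition P_section :: "('a, 'e::real_normed_vector) manifold \<Rightarrow> ('a \<Rightarrow> 'a gvec) \<Rightarrow> bool" where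
  "P_section M e \<longleftrightarrow> vector_field M (\<lambda>p. fst (e p)) \<and> one_form M (\<lambda>p. snd (e p))"

definition pairing :: "'a gvec \<Rightarrow> 'a gvec \<Rightarrow> real" where
  "pairing u v = snd u (fst v) + snd v (fst u)"

definition dorfman ::
    "('a, 'e::real_normed_vector) manifold \<Rightarrow> ('a \<Rightarrow> 'a gvec) \<Rightarrow> ('a \<Rightarrow> 'a gvec) \<Rightarrow> 'a \<Rightarrow> 'a gvec" where
  "dorfman M e e' =
     (let X = (\<lambda>p. fst (e p)); \<alpha> = (\<lambda>p. snd (e p)); Y = (\<lambda>p. fst (e' p)); \<beta> = (\<lambda>p. snd (e' p))
      in (\<lambda>p. (lie_bracket X Y p,
               lie_deriv M X \<beta> p - on_space (tangent_space M p) (ext_deriv M \<alpha> p (Y p)))))"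


section \<open>Generalized complex structures\<close>

text \<open>The pair \<open>(a, b)\<close> stands for the section \<open>a + i b\<close> of the complexified bundle; the bracket
  is extended complex-bilinearly, and \<open>J(a + i b) = i (a + i b)\<close> means \<open>J a = - b\<close>, \<open>J b = a\<close>.\<close>

definition dorfman_complex ::
    "('a, 'e::real_normed_vector) manifold \<Rightarrow> ('a \<Rightarrow> 'a gvec) \<times> ('a \<Rightarrow> 'a gvec)
     \<Rightarrow> ('a \<Rightarrow> 'a gvec) \<times> ('a \<Rightarrow> 'a gvec) \<Rightarrow> ('a \<Rightarrow> 'a gvec) \<times> ('a \<Rightarrow> 'a gvec)" where
  "dorfman_complex M s t =
     ((\<lambda>p. dorfman M (fst s) (fst t) p - dorfman M (snd s) (snd t) p),
      (\<lambda>p. dorfman M (fst s) (snd t) p + dorfman M (snd s) (fst t) p))"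

definition eigen_section ::
    "('a, 'e::real_normed_vector) manifold \<Rightarrow> ('a \<Rightarrow> 'a gvec \<Rightarrow> 'a gvec)
     \<Rightarrow> ('a \<Rightarrow> 'a gvec) \<times> ('a \<Rightarrow> 'a gvec) \<Rightarrow> bool" where
  "eigen_section M J s \<longleftrightarrow> P_section M (fst s) \<and> P_section M (snd s) \<and>
     (\<forall>p\<in>points M. J p (fst s p) = - snd s p \<and> J p (snd s p) = fst s p)"

definition generalized_complex_structure ::
    "('a, 'e::real_normed_vector) manifold \<Rightarrow> ('a \<Rightarrow> 'a gvec \<Rightarrow> 'a gvec) \<Rightarrow> bool" where
  "generalized_complex_structure M J \<longleftrightarrow>
     (\<forall>p\<in>points M. linear_on (P_space M p) (J p) \<and> J p ` P_space M p \<subseteq> P_space M p) \<and>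
     (\<forall>e. P_section M e \<longrightarrow> P_section M (\<lambda>p. J p (e p))) \<and>
     (\<forall>p\<in>points M. \<forall>u\<in>P_space M p. \<forall>v\<in>P_space M p. pairing (J p u) (J p v) = pairing u v) \<and>
     (\<forall>p\<in>points M. \<forall>u\<in>P_space M p. J p (J p u) = - u) \<and>
     (\<forall>s t. eigen_section M J s \<and> eigen_section M J t \<longrightarrow> eigen_section M J (dorfman_complex M s t))"

definition block_form ::
    "('a, 'e::real_normed_vector) manifold \<Rightarrow> ('a \<Rightarrow> 'a gvec \<Rightarrow> 'a gvec)
     \<Rightarrow> ('a \<Rightarrow> 'a tvec \<Rightarrow> 'a tvec) \<Rightarrow> ('a \<Rightarrow> 'a covec \<Rightarrow> 'a covec \<Rightarrow> real)
     \<Rightarrow> ('a \<Rightarrow> 'a tvec \<Rightarrow> 'a tvec \<Rightarrow> real) \<Rightarrow> bool" where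
  "block_form M J N \<pi> \<omega> \<longleftrightarrow>
     (\<forall>p\<in>points M. \<forall>X\<in>tangent_space M p. \<forall>\<alpha>\<in>cotangent_space M p.
        J p (X, \<alpha>) = (N p X + sharp M \<pi> p \<alpha>, flat M \<omega> p X - transpose_tensor M N p \<alpha>))"


section \<open>Poisson manifolds and coisotropic submanifolds\<close>

definition poisson_bracket ::
    "('a, 'e::real_normed_vector) manifold \<Rightarrow> ('a \<Rightarrow> 'a covec \<Rightarrow> 'a covec \<Rightarrow> real)
     \<Rightarrow> ('a \<Rightarrow> real) \<Rightarrow> ('a \<Rightarrow> real) \<Rightarrow> 'a \<Rightarrow> real" where
  "poisson_bracket M \<pi> f g p = \<pi> p (differential M f p) (differential M g p)"

definition poisson_structure ::
    "('a, 'e::real_normed_vector) manifold \<Rightarrow> ('a \<Rightarrow> 'a covec \<Rightarrow> 'a covec \<Rightarrow> real) \<Rightarrow> bool" where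
  "poisson_structure M \<pi> \<longleftrightarrow> bivector_field M \<pi> \<and>
     (\<forall>f\<in>smooth_fun M. \<forall>g\<in>smooth_fun M. \<forall>h\<in>smooth_fun M. \<forall>p\<in>points M.
        poisson_bracket M \<pi> f (poisson_bracket M \<pi> g h) p +
        poisson_bracket M \<pi> g (poisson_bracket M \<pi> h f) p +
        poisson_bracket M \<pi> h (poisson_bracket M \<pi> f g) p = 0)"

text \<open>The product bivector field on \<open>M \<times> N\<close>; the components of a covector at \<open>(p, q)\<close> are its
  pullbacks along \<open>x \<mapsto> (x, q)\<close> and \<open>y \<mapsto> (p, y)\<close>.\<close>

definition covec_fst ::
    "('a, 'e::real_normed_vector) manifold \<Rightarrow> ('b, 'f::real_normed_vector) manifold
     \<Rightarrow> 'a \<times> 'b \<Rightarrow> ('a \<times> 'b) covec \<Rightarrow> 'a covec" where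
  "covec_fst M N = (\<lambda>(p, q) \<xi>. on_space (tangent_space M p)
     (\<lambda>v. \<xi> (push (prod_manifold M N) (\<lambda>x. (x, q)) v)))"

definition covec_snd ::
    "('a, 'e::real_normed_vector) manifold \<Rightarrow> ('b, 'f::real_normed_vector) manifold
     \<Rightarrow> 'a \<times> 'b \<Rightarrow> ('a \<times> 'b) covec \<Rightarrow> 'b covec" where
  "covec_snd M N = (\<lambda>(p, q) \<xi>. on_space (tangent_space N q)
     (\<lambda>v. \<xi> (push (prod_manifold M N) (\<lambda>y. (p, y)) v)))"

definition prod_bivector ::
    "('a, 'e::real_normed_vector) manifold \<Rightarrow> ('b, 'f::real_normed_vector) manifold
     \<Rightarrow> ('a \<Rightarrow> 'a covec \<Rightarrow> 'a covec \<Rightarrow> real) \<Rightarrow> ('b \<Rightarrow> 'b covec \<Rightarrow> 'b covec \<Rightarrow> real)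
     \<Rightarrow> 'a \<times> 'b \<Rightarrow> ('a \<times> 'b) covec \<Rightarrow> ('a \<times> 'b) covec \<Rightarrow> real" where
  "prod_bivector M N \<pi> \<sigma> r \<xi> \<eta> =
     \<pi> (fst r) (covec_fst M N r \<xi>) (covec_fst M N r \<eta>) +
     \<sigma> (snd r) (covec_snd M N r \<xi>) (covec_snd M N r \<eta>)"

definition coisotropic ::
    "('a, 'e::real_normed_vector) manifold \<Rightarrow> ('a \<Rightarrow> 'a covec \<Rightarrow> 'a covec \<Rightarrow> real)
     \<Rightarrow> 'a set \<Rightarrow> bool" where
  "coisotropic M \<pi> S \<longleftrightarrow> S \<subseteq> points M \<and>
     (\<forall>p\<in>S. \<forall>\<xi>\<in>cotangent_space M p.
        (\<forall>v\<in>sub_tangent M S p. \<xi> v = 0) \<longrightarrow> sharp M \<pi> p \<xi> \<in> sub_tangent M S p)"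


section \<open>Lie groupoids\<close>

record ('g, 'm) groupoid =
  arr :: "'g set"
  obj :: "'m set"
  src :: "'g \<Rightarrow> 'm"
  tgt :: "'g \<Rightarrow> 'm"
  mul :: "'g \<Rightarrow> 'g \<Rightarrow> 'g"
  idt :: "'m \<Rightarrow> 'g"
  ivt :: "'g \<Rightarrow> 'g"

definition composable :: "('g, 'm, 'z) groupoid_scheme \<Rightarrow> ('g \<times> 'g) set" where
  "composable G = {(g, h). g \<in> arr G \<and> h \<in> arr G \<and> src G g = tgt G h}"

definition is_groupoid :: "('g, 'm, 'z) groupoid_scheme \<Rightarrow> bool" where
  "is_groupoid G \<longleftrightarrow>
     (\<forall>g\<in>arr G. src G g \<in> obj G \<and> tgt G g \<in> obj G) \<and>
     (\<forall>(g, h)\<in>composable G. mul G g h \<in> arr G \<and>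
        src G (mul G g h) = src G h \<and> tgt G (mul G g h) = tgt G g) \<and>
     (\<forall>g h k. (g, h) \<in> composable G \<and> (h, k) \<in> composable G \<longrightarrow>
        mul G (mul G g h) k = mul G g (mul G h k)) \<and>
     (\<forall>x\<in>obj G. idt G x \<in> arr G \<and> src G (idt G x) = x \<and> tgt G (idt G x) = x) \<and>
     (\<forall>g\<in>arr G. mul G g (idt G (src G g)) = g \<and> mul G (idt G (tgt G g)) g = g) \<and>
     (\<forall>g\<in>arr G. ivt G g \<in> arr G \<and> src G (ivt G g) = tgt G g \<and> tgt G (ivt G g) = src G g \<and>
        mul G g (ivt G g) = idt G (tgt G g) \<and> mul G (ivt G g) g = idt G (src G g))"

text \<open>Compatibility with identities and inverses follows.\<close>

definition groupoid_morphism ::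
    "('g, 'm, 'y) groupoid_scheme \<Rightarrow> ('h, 'n, 'z) groupoid_scheme
     \<Rightarrow> ('g \<Rightarrow> 'h) \<Rightarrow> ('m \<Rightarrow> 'n) \<Rightarrow> bool" where
  "groupoid_morphism G H F f \<longleftrightarrow>
     F ` arr G \<subseteq> arr H \<and> f ` obj G \<subseteq> obj H \<and>
     (\<forall>g\<in>arr G. src H (F g) = f (src G g) \<and> tgt H (F g) = f (tgt G g)) \<and>
     (\<forall>(g, h)\<in>composable G. F (mul G g h) = mul H (F g) (F h))"

record ('g, 'm, 'e, 'f) lie_groupoid = "('g, 'm) groupoid" +
  arr_mfd :: "('g, 'e) manifold"
  obj_mfd :: "('m, 'f) manifold"

definition is_lie_groupoid ::
    "('g, 'm, 'e::real_normed_vector, 'f::real_normed_vector) lie_groupoid \<Rightarrow> bool" where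
  "is_lie_groupoid G \<longleftrightarrow>
     is_groupoid G \<and>
     smooth_manifold (arr_mfd G) \<and> points (arr_mfd G) = arr G \<and>
     smooth_manifold (obj_mfd G) \<and> points (obj_mfd G) = obj G \<and>
     submersion (arr_mfd G) (obj_mfd G) (src G) \<and>
     submersion (arr_mfd G) (obj_mfd G) (tgt G) \<and>
     smooth_map_on (prod_manifold (arr_mfd G) (arr_mfd G)) (composable G) (arr_mfd G)
       (\<lambda>(g, h). mul G g h) \<and>
     smooth_map (obj_mfd G) (arr_mfd G) (idt G) \<and>
     smooth_map (arr_mfd G) (arr_mfd G) (ivt G)"

definition Tsrc ::
    "('g, 'm, 'e::real_normed_vector, 'f::real_normed_vector) lie_groupoid \<Rightarrow> 'g tvec \<Rightarrow> 'm tvec" where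
  "Tsrc G = push (obj_mfd G) (src G)"

definition Ttgt ::
    "('g, 'm, 'e::real_normed_vector, 'f::real_normed_vector) lie_groupoid \<Rightarrow> 'g tvec \<Rightarrow> 'm tvec" where
  "Ttgt G = push (obj_mfd G) (tgt G)"

text \<open>\<open>v\<^sub>g \<star> v\<^sub>h\<close> is the image, under the tangent map of the multiplication, of the tangent vector
  \<open>\<delta>\<close> of the submanifold of composable pairs whose components are \<open>v\<^sub>g\<close> and \<open>v\<^sub>h\<close>.\<close>

definition Tmul ::
    "('g, 'm, 'e::real_normed_vector, 'f::real_normed_vector) lie_groupoid
     \<Rightarrow> 'g \<Rightarrow> 'g tvec \<Rightarrow> 'g \<Rightarrow> 'g tvec \<Rightarrow> 'g tvec" where
  "Tmul G g v h w = push (arr_mfd G) (\<lambda>(a, b). mul G a b)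
     (THE \<delta>. \<delta> \<in> derivations (smooth_fun_on (prod_manifold (arr_mfd G) (arr_mfd G)) (composable G)) (g, h)
        \<and> push (arr_mfd G) fst \<delta> = v \<and> push (arr_mfd G) snd \<delta> = w)"

text \<open>Elements of total spaces of bundles carry their base point.\<close>

definition tangent_groupoid ::
    "('g, 'm, 'e::real_normed_vector, 'f::real_normed_vector) lie_groupoid
     \<Rightarrow> ('g \<times> 'g tvec, 'm \<times> 'm tvec) groupoid" where
  "tangent_groupoid G =
     \<lparr>arr = (SIGMA g:arr G. tangent_space (arr_mfd G) g),
      obj = (SIGMA x:obj G. tangent_space (obj_mfd G) x),
      src = (\<lambda>(g, v). (src G g, Tsrc G v)),
      tgt = (\<lambda>(g, v). (tgt G g, Ttgt G v)),
      mul = (\<lambda>(g, v) (h, w). (mul G g h, Tmul G g v h w)),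
      idt = (\<lambda>(x, u). (idt G x, push (arr_mfd G) (idt G) u)),
      ivt = (\<lambda>(g, v). (ivt G g, push (arr_mfd G) (ivt G) v))\<rparr>"

text \<open>The fibre of the Lie algebroid \<open>A = ker Ts|\<^sub>M\<close> at \<open>x\<close>.\<close>

definition algebroid ::
    "('g, 'm, 'e::real_normed_vector, 'f::real_normed_vector) lie_groupoid \<Rightarrow> 'm \<Rightarrow> 'g tvec set" where
  "algebroid G x = {a \<in> tangent_space (arr_mfd G) (idt G x). Tsrc G a = 0}"

definition src_fibre :: "('g, 'm, 'z) groupoid_scheme \<Rightarrow> 'm \<Rightarrow> 'g set" where
  "src_fibre G x = {k \<in> arr G. src G k = x}"

text \<open>\<open>a\<^sup>r(g)\<close> for \<open>a\<close> in the fibre of \<open>A\<close> at \<open>t(g)\<close>, and \<open>a\<^sup>l(g)\<close> for \<open>a\<close> in the fibre at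
  \<open>s(g)\<close>.  Right translation by \<open>g\<close> and \<open>L\<^sub>g \<circ> i\<close> are defined on a source fibre only.\<close>

definition right_vec ::
    "('g, 'm, 'e::real_normed_vector, 'f::real_normed_vector) lie_groupoid
     \<Rightarrow> 'g \<Rightarrow> 'g tvec \<Rightarrow> 'g tvec" where
  "right_vec G g a = push (arr_mfd G) (\<lambda>k. mul G k g)
     (as_sub_tangent (arr_mfd G) (src_fibre G (tgt G g)) (idt G (tgt G g)) a)"

definition left_vec ::
    "('g, 'm, 'e::real_normed_vector, 'f::real_normed_vector) lie_groupoid
     \<Rightarrow> 'g \<Rightarrow> 'g tvec \<Rightarrow> 'g tvec" where
  "left_vec G g a = - push (arr_mfd G) (\<lambda>k. mul G g (ivt G k))
     (as_sub_tangent (arr_mfd G) (src_fibre G (src G g)) (idt G (src G g)) a)"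

text \<open>The identity at \<open>\<xi> \<in> A*\<^sub>x\<close> is \<open>\<xi>\<close> extended by zero along \<open>T\<^sub>xM\<close>, using
  \<open>T\<Gamma>|\<^sub>M = TM \<oplus> A\<close>; the inverse of \<open>\<alpha>\<^sub>g\<close> maps \<open>v\<close> to \<open>- \<alpha>\<^sub>g(Ti v)\<close>.\<close>

definition cotangent_groupoid ::
    "('g, 'm, 'e::real_normed_vector, 'f::real_normed_vector) lie_groupoid
     \<Rightarrow> ('g \<times> 'g covec, 'm \<times> 'g covec) groupoid" where
  "cotangent_groupoid G =
     \<lparr>arr = (SIGMA g:arr G. cotangent_space (arr_mfd G) g),
      obj = (SIGMA x:obj G. dual (algebroid G x)),
      src = (\<lambda>(g, \<alpha>). (src G g, on_space (algebroid G (src G g)) (\<lambda>a. \<alpha> (left_vec G g a)))),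
      tgt = (\<lambda>(g, \<alpha>). (tgt G g, on_space (algebroid G (tgt G g)) (\<lambda>a. \<alpha> (right_vec G g a)))),
      mul = (\<lambda>(g, \<alpha>) (h, \<beta>). (mul G g h,
        THE \<gamma>. \<gamma> \<in> cotangent_space (arr_mfd G) (mul G g h) \<and>
          (\<forall>v\<in>tangent_space (arr_mfd G) g. \<forall>w\<in>tangent_space (arr_mfd G) h.
             Tsrc G v = Ttgt G w \<longrightarrow> \<gamma> (Tmul G g v h w) = \<alpha> v + \<beta> w))),
      idt = (\<lambda>(x, \<xi>). (idt G x, on_space (tangent_space (arr_mfd G) (idt G x))
        (\<lambda>v. \<xi> (v - push (arr_mfd G) (idt G) (Tsrc G v))))),
      ivt = (\<lambda>(g, \<alpha>). (ivt G g, on_space (tangent_space (arr_mfd G) (ivt G g))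
        (\<lambda>v. - \<alpha> (push (arr_mfd G) (ivt G) v))))\<rparr>"

definition fibre_pair :: "'p \<times> 'v \<Rightarrow> 'p \<times> 'w \<Rightarrow> 'p \<times> ('v \<times> 'w)" where
  "fibre_pair a b = (fst a, snd a, snd b)"

definition P_groupoid ::
    "('g, 'm, 'e::real_normed_vector, 'f::real_normed_vector) lie_groupoid
     \<Rightarrow> ('g \<times> 'g gvec, 'm \<times> ('m tvec \<times> 'g covec)) groupoid" where
  "P_groupoid G =
     (let T = tangent_groupoid G; C = cotangent_groupoid G
      in \<lparr>arr = (SIGMA g:arr G. P_space (arr_mfd G) g),
          obj = (SIGMA x:obj G. tangent_space (obj_mfd G) x \<times> dual (algebroid G x)),
          src = (\<lambda>(g, v, \<alpha>). fibre_pair (src T (g, v)) (src C (g, \<alpha>))),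
          tgt = (\<lambda>(g, v, \<alpha>). fibre_pair (tgt T (g, v)) (tgt C (g, \<alpha>))),
          mul = (\<lambda>(g, v, \<alpha>) (h, w, \<beta>). fibre_pair (mul T (g, v) (h, w)) (mul C (g, \<alpha>) (h, \<beta>))),
          idt = (\<lambda>(x, u, \<xi>). fibre_pair (idt T (x, u)) (idt C (x, \<xi>))),
          ivt = (\<lambda>(g, v, \<alpha>). fibre_pair (ivt T (g, v)) (ivt C (g, \<alpha>)))\<rparr>)"


section \<open>Glanon groupoids and Poisson groupoids\<close>

definition algebroid_section ::
    "('g, 'm, 'e::real_normed_vector, 'f::real_normed_vector) lie_groupoid
     \<Rightarrow> ('m \<Rightarrow> 'g tvec) \<Rightarrow> bool" where
  "algebroid_section G a \<longleftrightarrow> (\<forall>x\<in>obj G. a x \<in> algebroid G x) \<and>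
     (\<forall>f\<in>smooth_fun (arr_mfd G). (\<lambda>x. a x f) \<in> smooth_fun (obj_mfd G))"

text \<open>Smooth sections of \<open>TM \<oplus> A*\<close>.\<close>

definition base_section ::
    "('g, 'm, 'e::real_normed_vector, 'f::real_normed_vector) lie_groupoid
     \<Rightarrow> ('m \<Rightarrow> 'm \<times> ('m tvec \<times> 'g covec)) \<Rightarrow> bool" where
  "base_section G \<sigma> \<longleftrightarrow>
     (\<forall>x\<in>obj G. fst (\<sigma> x) = x \<and> snd (snd (\<sigma> x)) \<in> dual (algebroid G x)) \<and>
     vector_field (obj_mfd G) (\<lambda>x. fst (snd (\<sigma> x))) \<and>
     (\<forall>a. algebroid_section G a \<longrightarrow> (\<lambda>x. snd (snd (\<sigma> x)) (a x)) \<in> smooth_fun (obj_mfd G))"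

text \<open>The base map \<open>j\<close> of a groupoid morphism extending a vector bundle endomorphism over the
  identity of \<open>\<Gamma>\<close> is itself a vector bundle endomorphism of \<open>TM \<oplus> A*\<close> over the identity of \<open>M\<close>,
  so its smoothness, like that of \<open>J\<close>, is tested on smooth sections.\<close>

definition glanon_groupoid ::
    "('g, 'm, 'e::real_normed_vector, 'f::real_normed_vector) lie_groupoid
     \<Rightarrow> ('g \<Rightarrow> 'g gvec \<Rightarrow> 'g gvec) \<Rightarrow> bool" where
  "glanon_groupoid G J \<longleftrightarrow>
     is_lie_groupoid G \<and> generalized_complex_structure (arr_mfd G) J \<and>
     (\<exists>j. groupoid_morphism (P_groupoid G) (P_groupoid G) (\<lambda>(g, u). (g, J g u)) j \<and>
          (\<forall>\<sigma>. base_section G \<sigma> \<longrightarrow> base_section G (j \<circ> \<sigma>)))"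

definition mul_graph :: "('g, 'm, 'z) groupoid_scheme \<Rightarrow> ('g \<times> 'g \<times> 'g) set" where
  "mul_graph G = {(g, h, mul G g h) | g h. (g, h) \<in> composable G}"

text \<open>The third factor carries \<open>- \<pi>\<close>.\<close>

definition poisson_groupoid ::
    "('g, 'm, 'e::real_normed_vector, 'f::real_normed_vector) lie_groupoid
     \<Rightarrow> ('g \<Rightarrow> 'g covec \<Rightarrow> 'g covec \<Rightarrow> real) \<Rightarrow> bool" where
  "poisson_groupoid G \<pi> \<longleftrightarrow>
     is_lie_groupoid G \<and> poisson_structure (arr_mfd G) \<pi> \<and>
     (let M = arr_mfd G
      in coisotropic (prod_manifold M (prod_manifold M M))
           (prod_bivector M (prod_manifold M M) \<pi> (prod_bivector M M \<pi> (- \<pi>))) (mul_graph G))"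

end

theory Submission
  imports Defs
begin

text \<open>Integrability of \<open>J\<close>, applied to the sections \<open>(0, df) - i J (0, df)\<close> of the \<open>+i\<close>-eigenbundle up to
  the factor \<open>i\<close>, says that the Hamiltonian vector fields \<open>X\<^sub>f = \<pi>\<^sup>\<sharp> df\<close> satisfy \<open>[X\<^sub>f, X\<^sub>g] = X\<^bsub>{f,g}\<^esub>\<close>,
  which is the Jacobi identity.

  A covector annihilating the graph of the multiplication at \<open>(g, h, gh)\<close> is of the form
  \<open>(\<alpha>, \<beta>, - \<alpha> \<star> \<beta>)\<close> with \<open>\<alpha>\<close> and \<open>\<beta>\<close> composable in \<open>T*\<Gamma>\<close>.  Then \<open>(0, \<alpha>)\<close> and \<open>(0, \<beta>)\<close> are composable
  in \<open>P\<^sub>\<Gamma>\<close>, and the tangent part of \<open>J ((0, \<alpha>) \<star> (0, \<beta>)) = J (0, \<alpha>) \<star> J (0, \<beta>)\<close> is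
  \<open>\<pi>\<^sup>\<sharp>(\<alpha> \<star> \<beta>) = \<pi>\<^sup>\<sharp>\<alpha> \<star> \<pi>\<^sup>\<sharp>\<beta>\<close>, so that \<open>(\<pi>\<^sup>\<sharp>\<alpha>, \<pi>\<^sup>\<sharp>\<beta>, \<pi>\<^sup>\<sharp>(\<alpha> \<star> \<beta>))\<close> is tangent to the graph.

  Tangent vectors are derivations.  By Hadamard's lemma every derivation is the velocity of a curve, and
  by the implicit function theorem two vectors with \<open>Ts v = Tt w\<close> are the velocities of curves \<open>a\<close>, \<open>b\<close>
  with \<open>s(a(t)) = t(b(t))\<close>.  Since only first derivatives at \<open>0\<close> matter, the curves are only required to
  be differentiable there.\<close>

section \<open>Calculus of iterated directional derivatives\<close>

text \<open>The definitions obtain \<open>Tmul\<close>, \<open>as_sub_tangent\<close> and the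
  product of covectors by \<open>THE\<close>, and vectors tangent to a subset are derivations of
  functions that extend only locally, so every use of them calls for existence and uniqueness.
  Curves supply existence: a curve of composable pairs has a velocity on the set of composable pairs
  itself, and products, translations and the graph are reached by applying the structure maps
  pointwise. Uniqueness comes from locality of derivations. No submanifold charts are constructed.

  The product of covectors is determined because every vector at \<open>gh\<close> is a product of
  vectors at \<open>g\<close> and \<open>h\<close>: cancel with an inverse on the tangent level.
  Composability of \<alpha> and \<beta> is read off from the curves
  \<open>(g c(t)^(-1), c(t) h, gh)\<close> in the graph, whose last component does not move.

  The model spaces are inner product spaces with the Heine-Borel property: the inner product gives
  coordinates, and compactness of closed balls gives the uniform estimates and the fixed point in
  the implicit function argument.\<close>

abbreviation dirderiv :: "('e::real_normed_vector \<Rightarrow> 'f::real_normed_vector) \<Rightarrow> 'e \<Rightarrow> 'e \<Rightarrow> 'f" where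
  "dirderiv f v x \<equiv> frechet_derivative f (at x) v"

lemma Ck_on_Suc_has_derivative:
  assumes "Ck_on (Suc k) S f" "x \<in> S"
  shows "(f has_derivative frechet_derivative f (at x)) (at x)"
  using assms by (simp add: frechet_derivative_works)

lemma Ck_on_cong:
  assumes S: "open S" and eq: "\<And>x. x \<in> S \<Longrightarrow> f x = g x" and f: "Ck_on k S f"
  shows "Ck_on k S g"
  using eq f
proof (induction k arbitrary: f g)
  case 0
  then show ?case by (simp cong: continuous_on_cong)
next
  case (Suc k)
  have der: "(g has_derivative frechet_derivative f (at x)) (at x)" if "x \<in> S" for x
    using has_derivative_transform_within_open[OF Ck_on_Suc_has_derivative[OF Suc.prems(2) that] S that]
      Suc.prems(1) by blast
  have "Ck_on k S (\<lambda>x. frechet_derivative g (at x) v)" for v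
  proof (rule Suc.IH)
    show "Ck_on k S (\<lambda>x. frechet_derivative f (at x) v)" using Suc.prems by simp
    show "frechet_derivative f (at x) v = frechet_derivative g (at x) v" if "x \<in> S" for x
      using frechet_derivative_at[OF der[OF that]] by simp
  qed
  then show ?case using der by (auto simp: differentiable_def)
qed

text \<open>The definition refers to \<open>frechet_derivative\<close>; here any explicit formula
  for the derivative is accepted, since it agrees with that on the open set \<open>S\<close>. This
  is the induction step of most closure properties below.\<close>

lemma Ck_on_SucI:
  assumes S: "open S" and der: "\<And>x. x \<in> S \<Longrightarrow> (f has_derivative f' x) (at x)"
    and f': "\<And>v. Ck_on k S (\<lambda>x. f' x v)"
  shows "Ck_on (Suc k) S f"
proof -
  have "Ck_on k S (\<lambda>x. frechet_derivative f (at x) v)" for v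
    by (rule Ck_on_cong[OF S _ f'[of v]]) (simp add: frechet_derivative_at[OF der, symmetric])
  then show ?thesis using der by (auto simp: differentiable_def)
qed

lemma Ck_on_subset: "Ck_on k S f \<Longrightarrow> T \<subseteq> S \<Longrightarrow> Ck_on k T f"
  by (induction k arbitrary: f) (auto intro: continuous_on_subset)

text \<open>Not built into the definition, which asks for order \<open>k\<close> of the derivatives
  but not of \<open>f\<close>; differentiability supplies the continuity at the bottom of the
  induction.\<close>

lemma Ck_on_Suc_imp: "Ck_on (Suc k) S f \<Longrightarrow> Ck_on k S f"
proof (induction k arbitrary: f)
  case 0
  then show ?case
    by (auto intro!: continuous_at_imp_continuous_on differentiable_imp_continuous_within)
next
  case (Suc k)
  then show ?case by (metis Ck_on.simps(2))
qed

lemma Ck_on_local: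
  assumes "\<And>x. x \<in> S \<Longrightarrow> \<exists>T. open T \<and> x \<in> T \<and> Ck_on k T f"
  shows "Ck_on k S f"
  using assms
proof (induction k arbitrary: f)
  case 0
  have "continuous (at x) f" if "x \<in> S" for x
    using 0[OF that] by (auto simp: continuous_on_eq_continuous_at)
  then show ?case by (simp add: continuous_at_imp_continuous_on)
next
  case (Suc k)
  have "f differentiable (at x)" if "x \<in> S" for x
    using Suc.prems[OF that] by auto
  moreover have "Ck_on k S (\<lambda>x. frechet_derivative f (at x) v)" for v
    using Suc.prems by (intro Suc.IH) fastforce
  ultimately show ?case by simp
qed

lemma Ck_on_const: "Ck_on k S (\<lambda>x. c)"
  by (induction k arbitrary: c) auto

lemma Ck_on_linear:
  assumes "bounded_linear L" "open S" shows "Ck_on k S L"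
proof (cases k)
  case 0
  then show ?thesis using assms by (simp add: linear_continuous_on)
next
  case (Suc n)
  show ?thesis unfolding Suc
    by (rule Ck_on_SucI[OF assms(2), where f' = "\<lambda>x. L"])
      (auto intro: bounded_linear_imp_has_derivative assms Ck_on_const)
qed

lemma Ck_on_linear_compose:
  assumes L: "bounded_linear L" and S: "open S" and f: "Ck_on k S f"
  shows "Ck_on k S (\<lambda>x. L (f x))"
  using f
proof (induction k arbitrary: f)
  case 0
  then show ?case by (simp add: bounded_linear.continuous_on[OF L])
next
  case (Suc k)
  show ?case
    by (rule Ck_on_SucI[OF S, where f' = "\<lambda>x v. L (frechet_derivative f (at x) v)"])
      (use Suc bounded_linear.has_derivative[OF L Ck_on_Suc_has_derivative[OF Suc.prems]] in auto)
qed

lemma Ck_on_add: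
  assumes S: "open S" and f: "Ck_on k S f" and g: "Ck_on k S g"
  shows "Ck_on k S (\<lambda>x. f x + g x)"
  using f g
proof (induction k arbitrary: f g)
  case 0
  then show ?case by (simp add: continuous_on_add)
next
  case (Suc k)
  show ?case
    by (rule Ck_on_SucI[OF S has_derivative_add[OF Ck_on_Suc_has_derivative[OF Suc.prems(1)]
            Ck_on_Suc_has_derivative[OF Suc.prems(2)]]])
      (use Suc in auto)
qed

lemma Ck_on_scaleR:
  assumes S: "open S" and f: "Ck_on k S f" and g: "Ck_on k S g"
  shows "Ck_on k S (\<lambda>x. f x *\<^sub>R g x)"
  using f g
proof (induction k arbitrary: f g)
  case 0
  then show ?case by (simp add: continuous_on_scaleR)
next
  case (Suc k)
  show ?case
    by (rule Ck_on_SucI[OF S has_derivative_scaleR[OF Ck_on_Suc_has_derivative[OF Suc.prems(1)]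
            Ck_on_Suc_has_derivative[OF Suc.prems(2)]]])
      (use Suc Ck_on_Suc_imp[OF Suc.prems(1)] Ck_on_Suc_imp[OF Suc.prems(2)] in \<open>auto intro!: Ck_on_add[OF S]\<close>)
qed

lemma Ck_on_mult:
  fixes f g :: "'e::real_normed_vector \<Rightarrow> real"
  assumes "open S" "Ck_on k S f" "Ck_on k S g"
  shows "Ck_on k S (\<lambda>x. f x * g x)"
  using Ck_on_scaleR[OF assms] by simp

lemma Ck_on_sum:
  assumes "open S" "\<And>i. i \<in> I \<Longrightarrow> Ck_on k S (f i)"
  shows "Ck_on k S (\<lambda>x. \<Sum>i\<in>I. f i x)"
  using assms(2)
  by (induction I rule: infinite_finite_induct) (auto intro!: Ck_on_const Ck_on_add[OF assms(1)])

lemma Ck_on_Pair: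
  assumes S: "open S" and f: "Ck_on k S f" and g: "Ck_on k S g"
  shows "Ck_on k S (\<lambda>x. (f x, g x))"
  using f g
proof (induction k arbitrary: f g)
  case 0
  then show ?case by (simp add: continuous_on_Pair)
next
  case (Suc k)
  show ?case
    by (rule Ck_on_SucI[OF S has_derivative_Pair[OF Ck_on_Suc_has_derivative[OF Suc.prems(1)]
            Ck_on_Suc_has_derivative[OF Suc.prems(2)]]])
      (use Suc in auto)
qed

lemma Ck_on_inverse:
  fixes f :: "'e::real_normed_vector \<Rightarrow> real"
  assumes S: "open S" and f: "Ck_on k S f" and nz: "\<And>x. x \<in> S \<Longrightarrow> f x \<noteq> 0"
  shows "Ck_on k S (\<lambda>x. inverse (f x))"
  using f
proof (induction k)
  case 0
  then show ?case using nz by (simp add: continuous_on_inverse)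
next
  case (Suc k)
  have inv: "Ck_on k S (\<lambda>x. inverse (f x))"
    using Suc.IH Ck_on_Suc_imp[OF Suc.prems] .
  show ?case
  proof (rule Ck_on_SucI[OF S])
    show "((\<lambda>x. inverse (f x)) has_derivative
        (\<lambda>h. - (inverse (f x) * frechet_derivative f (at x) h * inverse (f x)))) (at x)" if "x \<in> S" for x
      by (rule Deriv.has_derivative_inverse[OF nz[OF that] Ck_on_Suc_has_derivative[OF Suc.prems that]])
    have "Ck_on k S (\<lambda>x. (-1) * (inverse (f x) * frechet_derivative f (at x) v * inverse (f x)))" for v
      using Suc.prems by (intro Ck_on_mult[OF S] Ck_on_const inv) auto
    then show "Ck_on k S (\<lambda>x. - (inverse (f x) * frechet_derivative f (at x) v * inverse (f x)))" for v
      by simp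
  qed
qed

section \<open>Closure properties of smooth functions on open sets\<close>

lemma smooth_on_cong:
  "open S \<Longrightarrow> (\<And>x. x \<in> S \<Longrightarrow> f x = g x) \<Longrightarrow> smooth_on S f \<Longrightarrow> smooth_on S g"
  unfolding smooth_on_def using Ck_on_cong by blast

lemma smooth_on_subset: "smooth_on S f \<Longrightarrow> T \<subseteq> S \<Longrightarrow> smooth_on T f"
  unfolding smooth_on_def using Ck_on_subset by blast

lemma smooth_on_local:
  "(\<And>x. x \<in> S \<Longrightarrow> \<exists>T. open T \<and> x \<in> T \<and> smooth_on T f) \<Longrightarrow> smooth_on S f"
  unfolding smooth_on_def by (meson Ck_on_local)

lemma smooth_on_has_derivative:
  "smooth_on S f \<Longrightarrow> x \<in> S \<Longrightarrow> (f has_derivative frechet_derivative f (at x)) (at x)"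
  unfolding smooth_on_def using Ck_on_Suc_has_derivative by blast

lemma smooth_on_dirderiv: "smooth_on S f \<Longrightarrow> smooth_on S (dirderiv f v)"
  unfolding smooth_on_def by (metis Ck_on.simps(2))

lemma smooth_on_continuous: "smooth_on S f \<Longrightarrow> continuous_on S f"
  unfolding smooth_on_def by (metis Ck_on.simps(1))

lemma smooth_on_const: "smooth_on S (\<lambda>x. c)"
  by (simp add: smooth_on_def Ck_on_const)

lemma smooth_on_linear: "bounded_linear L \<Longrightarrow> open S \<Longrightarrow> smooth_on S L"
  by (simp add: smooth_on_def Ck_on_linear)

lemma smooth_on_linear_compose:
  "bounded_linear L \<Longrightarrow> open S \<Longrightarrow> smooth_on S f \<Longrightarrow> smooth_on S (\<lambda>x. L (f x))"
  by (simp add: smooth_on_def Ck_on_linear_compose)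

lemma smooth_on_add:
  "open S \<Longrightarrow> smooth_on S f \<Longrightarrow> smooth_on S g \<Longrightarrow> smooth_on S (\<lambda>x. f x + g x)"
  by (simp add: smooth_on_def Ck_on_add)

lemma smooth_on_mult:
  fixes f g :: "'e::real_normed_vector \<Rightarrow> real"
  shows "open S \<Longrightarrow> smooth_on S f \<Longrightarrow> smooth_on S g \<Longrightarrow> smooth_on S (\<lambda>x. f x * g x)"
  by (simp add: smooth_on_def Ck_on_mult)

lemma smooth_on_diff:
  fixes f g :: "'e::real_normed_vector \<Rightarrow> real"
  shows "open S \<Longrightarrow> smooth_on S f \<Longrightarrow> smooth_on S g \<Longrightarrow> smooth_on S (\<lambda>x. f x - g x)"
  using smooth_on_add[of S f "\<lambda>x. (-1) * g x"] smooth_on_mult[of S "\<lambda>x. -1" g]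
  by (simp add: smooth_on_const)

lemma smooth_on_sum:
  "open S \<Longrightarrow> (\<And>i. i \<in> I \<Longrightarrow> smooth_on S (f i)) \<Longrightarrow> smooth_on S (\<lambda>x. \<Sum>i\<in>I. f i x)"
  by (simp add: smooth_on_def Ck_on_sum)

lemma smooth_on_Pair:
  "open S \<Longrightarrow> smooth_on S f \<Longrightarrow> smooth_on S g \<Longrightarrow> smooth_on S (\<lambda>x. (f x, g x))"
  by (simp add: smooth_on_def Ck_on_Pair)

lemma smooth_on_inverse:
  fixes f :: "'e::real_normed_vector \<Rightarrow> real"
  shows "open S \<Longrightarrow> smooth_on S f \<Longrightarrow> (\<And>x. x \<in> S \<Longrightarrow> f x \<noteq> 0) \<Longrightarrow> smooth_on S (\<lambda>x. inverse (f x))"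
  by (simp add: smooth_on_def Ck_on_inverse)

subsection \<open>Frames of finite-dimensional inner product spaces\<close>

text \<open>The reconstruction identity of a Parseval frame. Nothing is said about independence,
  length or the zero vector, so products are easily formed and a 0-dimensional space has a frame as
  well.\<close>

definition frame :: "'e::real_inner set \<Rightarrow> bool" where
  "frame B \<longleftrightarrow> finite B \<and> (\<forall>x. (\<Sum>b\<in>B. (x \<bullet> b) *\<^sub>R b) = x)"

lemma frame_finite: "frame B \<Longrightarrow> finite B"
  and frame_sum: "frame B \<Longrightarrow> (\<Sum>b\<in>B. (x \<bullet> b) *\<^sub>R b) = x"
  by (auto simp: frame_def)

text \<open>An orthogonal spanning set is normalised after dropping zero. The remainder
  \<open>x - P\<close> of the expansion is orthogonal to every spanning vector, hence to
  itself.\<close>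

lemma finite_span_imp_frame:
  assumes "finite B" "span B = (UNIV :: 'e::real_inner set)"
  shows "\<exists>B :: 'e set. frame B"
proof -
  obtain C :: "'e set" where C: "finite C" "span C = UNIV" "pairwise orthogonal C"
    using basis_orthogonal[OF assms(1)] assms(2) by auto
  define u :: "'e \<Rightarrow> 'e" where "u c = c /\<^sub>R norm c" for c
  \<comment> \<open>The sum over the normalised set is reindexed over \<open>C - {0}\<close>, so no
    two members may have the same normalisation; orthogonality excludes this.\<close>
  have inj: "inj_on u (C - {0})"
  proof (rule inj_onI)
    fix c d assume cd: "c \<in> C - {0}" "d \<in> C - {0}" "u c = u d"
    show "c = d"
    proof (rule ccontr)
      assume "c \<noteq> d"
      then have "c \<bullet> d = 0" using C(3) cd by (auto simp: pairwise_def orthogonal_def)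
      then have "u c \<bullet> u d = 0" by (simp add: u_def)
      then have "u c \<bullet> u c = 0" using cd(3) by simp
      then show False using cd by (simp add: u_def)
    qed
  qed
  have "(\<Sum>b\<in>u ` (C - {0}). (x \<bullet> b) *\<^sub>R b) = x" for x
  proof -
    define P where "P = (\<Sum>b\<in>u ` (C - {0}). (x \<bullet> b) *\<^sub>R b)"
    have P: "P = (\<Sum>c\<in>C - {0}. (x \<bullet> u c) *\<^sub>R u c)"
      unfolding P_def by (simp add: sum.reindex[OF inj])
    have orth: "orthogonal (x - P) d" if d: "d \<in> C" for d
    proof (cases "d = 0")
      case False
      have "P \<bullet> d = (\<Sum>c\<in>C - {0}. (x \<bullet> u c) * (u c \<bullet> d))"
        by (simp add: P inner_sum_left)
      also have "\<dots> = (\<Sum>c\<in>{d}. (x \<bullet> u c) * (u c \<bullet> d))"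
        by (rule sum.mono_neutral_right)
          (use C d False in \<open>auto simp: pairwise_def orthogonal_def u_def\<close>)
      also have "\<dots> = x \<bullet> d"
        using False by (simp add: u_def power2_norm_eq_inner[symmetric] power2_eq_square field_simps)
      finally show ?thesis by (simp add: orthogonal_def inner_diff_left)
    qed (simp add: orthogonal_def)
    have "orthogonal (x - P) (x - P)"
      by (rule orthogonal_to_span[of _ C]) (use C orth in auto)
    then show ?thesis by (simp add: orthogonal_def P_def)
  qed
  then show ?thesis
    using C(1) by (intro exI[of _ "u ` (C - {0})"]) (simp add: frame_def)
qed

text \<open>Zero is removed from \<open>C\<close> so that the two images are disjoint and the sum
  splits; a zero summand contributes nothing.\<close>

lemma frame_prod:
  assumes B: "frame B" and C: "frame C"
  shows "frame ((\<lambda>b. (b, 0)) ` B \<union> (\<lambda>c. (0, c)) ` (C - {0}))"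
proof -
  have fin: "finite B" "finite C" using assms by (auto simp: frame_def)
  have C': "(\<Sum>c\<in>C - {0}. (y \<bullet> c) *\<^sub>R c) = y" for y
  proof -
    have "(\<Sum>c\<in>C - {0}. (y \<bullet> c) *\<^sub>R c) = (\<Sum>c\<in>C. (y \<bullet> c) *\<^sub>R c)"
      by (rule sum.mono_neutral_left) (use fin in auto)
    then show ?thesis using frame_sum[OF C] by simp
  qed
  have "(\<Sum>b\<in>(\<lambda>b. (b, 0)) ` B \<union> (\<lambda>c. (0, c)) ` (C - {0}). ((x, y) \<bullet> b) *\<^sub>R b) = (x, y)" for x y
  proof -
    have "(\<Sum>b\<in>(\<lambda>b. (b, 0)) ` B \<union> (\<lambda>c. (0, c)) ` (C - {0}). ((x, y) \<bullet> b) *\<^sub>R b)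
        = (\<Sum>b\<in>(\<lambda>b. (b, 0)) ` B. ((x, y) \<bullet> b) *\<^sub>R b)
        + (\<Sum>b\<in>(\<lambda>c. (0, c)) ` (C - {0}). ((x, y) \<bullet> b) *\<^sub>R b)"
      by (rule sum.union_disjoint) (use fin in auto)
    also have "\<dots> = (\<Sum>b\<in>B. ((x \<bullet> b) *\<^sub>R b, 0)) + (\<Sum>c\<in>C - {0}. (0, (y \<bullet> c) *\<^sub>R c))"
      by (simp add: sum.reindex inj_on_def)
    also have "\<dots> = (x, y)"
      using frame_sum[OF B, of x] C'[of y] by (simp add: sum_prod)
    finally show ?thesis .
  qed
  then show ?thesis using fin by (auto simp: frame_def)
qed

text \<open>The induction on the order treats all \<open>f\<close> at once: expanding the derivative
  of \<tau> in the frame writes the derivative of the composite through \<open>dirderiv f b\<close>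
  composed with \<tau>, for fixed directions \<open>b\<close>, and each \<open>dirderiv f b\<close>
  is again smooth on \<open>S\<close>.\<close>

lemma smooth_on_compose:
  fixes \<tau> :: "'e::real_normed_vector \<Rightarrow> 'a::real_inner" and B :: "'a set"
  assumes B: "frame B" and T: "open T" and f: "smooth_on S f" and \<tau>: "smooth_on T \<tau>" "\<tau> ` T \<subseteq> S"
  shows "smooth_on T (\<lambda>x. f (\<tau> x))"
proof -
  have "Ck_on k T (\<lambda>x. f (\<tau> x))" for k
    using f
  proof (induction k arbitrary: f)
    case 0
    then show ?case
      using continuous_on_compose2[OF smooth_on_continuous smooth_on_continuous] \<tau> by auto
  next
    case (Suc k)
    have fin: "finite B" using B by (rule frame_finite)
    show ?case
    proof (rule Ck_on_SucI[OF T])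
      fix x assume x: "x \<in> T"
      have \<tau>d: "(\<tau> has_derivative frechet_derivative \<tau> (at x)) (at x)"
        by (rule smooth_on_has_derivative[OF \<tau>(1) x])
      have fd: "(f has_derivative frechet_derivative f (at (\<tau> x))) (at (\<tau> x))"
        using smooth_on_has_derivative[OF Suc.prems] \<tau>(2) x by blast
      have lin: "linear (frechet_derivative f (at (\<tau> x)))"
        using fd has_derivative_linear by blast
      have "frechet_derivative f (at (\<tau> x)) (dirderiv \<tau> v x)
          = (\<Sum>b\<in>B. (dirderiv \<tau> v x \<bullet> b) *\<^sub>R dirderiv f b (\<tau> x))" for v
        by (subst frame_sum[OF B, symmetric]) (simp add: linear_sum[OF lin] linear_scale[OF lin])
      then show "((\<lambda>x. f (\<tau> x)) has_derivative
          (\<lambda>v. \<Sum>b\<in>B. (dirderiv \<tau> v x \<bullet> b) *\<^sub>R dirderiv f b (\<tau> x))) (at x)"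
        using has_derivative_compose[OF \<tau>d fd] by simp
    next
      fix v
      have "Ck_on k T (\<lambda>x. dirderiv \<tau> v x \<bullet> b)" for b
        using smooth_on_linear_compose[OF bounded_linear_inner_left T smooth_on_dirderiv[OF \<tau>(1)]]
        by (simp add: smooth_on_def)
      moreover have "Ck_on k T (\<lambda>x. dirderiv f b (\<tau> x))" for b
        by (rule Suc.IH[OF smooth_on_dirderiv[OF Suc.prems]])
      ultimately show "Ck_on k T (\<lambda>x. \<Sum>b\<in>B. (dirderiv \<tau> v x \<bullet> b) *\<^sub>R dirderiv f b (\<tau> x))"
        by (intro Ck_on_sum[OF T] Ck_on_scaleR[OF T])
    qed
  qed
  then show ?thesis by (simp add: smooth_on_def)
qed

lemma frame_real: "frame {1 :: real}"
  by (simp add: frame_def)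

subsection \<open>Bump functions\<close>

text \<open>The functions \<open>x^(-n) exp(-1/x)\<close>, continued by 0. The case
  \<open>n = 0\<close> is the usual flat function; the whole family appears because differentiation
  leads to linear combinations of its members.\<close>

definition flat_exp :: "nat \<Rightarrow> real \<Rightarrow> real" where
  "flat_exp n x = (if x > 0 then (1 / x) ^ n * exp (- (1 / x)) else 0)"

text \<open>One term of the exponential series gives \<open>z^m exp(-z) <= m!\<close>. With
  \<open>z = 1/y\<close> and \<open>m = n + 2\<close> two powers are left over, so that even
  \<open>flat_exp n y / y\<close> tends to 0 at 0.\<close>

lemma flat_exp_le: "\<bar>flat_exp n y\<bar> \<le> fact (n + 2) * y\<^sup>2"
proof (cases "y > 0")
  case True
  define z where "z = 1 / y"
  have z: "z > 0" using True by (simp add: z_def)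
  have "z ^ m * exp (- z) \<le> fact m" for m
  proof -
    have s: "(\<lambda>n. z ^ n /\<^sub>R fact n) sums exp z" by (rule exp_converges)
    have "(\<Sum>i\<in>{m}. z ^ i /\<^sub>R fact i) \<le> (\<Sum>i. z ^ i /\<^sub>R fact i)"
      by (rule sum_le_suminf[OF sums_summable[OF s]]) (use z in auto)
    then have "z ^ m /\<^sub>R fact m \<le> exp z" using sums_unique[OF s] by simp
    then show ?thesis by (simp add: exp_minus field_simps)
  qed
  from this[of "n + 2"]
  have "z ^ n * exp (- z) * z\<^sup>2 \<le> fact (n + 2)"
    by (simp add: power_add power2_eq_square mult_ac del: fact_Suc)
  then have "z ^ n * exp (- z) \<le> fact (n + 2) * y\<^sup>2"
    using True by (simp add: z_def power2_eq_square field_simps)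
  then show ?thesis using True by (simp add: flat_exp_def z_def)
qed (simp add: flat_exp_def)

lemma flat_exp_has_derivative:
  "(flat_exp n has_real_derivative flat_exp (n + 2) x - n * flat_exp (n + 1) x) (at x)"
proof -
  consider "x > 0" | "x < 0" | "x = 0" by linarith
  then show ?thesis
  proof cases
    case 1
    have "((\<lambda>y. (1 / y) ^ n * exp (- (1 / y))) has_real_derivative
        flat_exp (n + 2) x - n * flat_exp (n + 1) x) (at x)"
    proof (cases n)
      case 0
      then show ?thesis
        using 1 by (auto intro!: derivative_eq_intros simp: flat_exp_def power2_eq_square)
    next
      case (Suc m)
      then show ?thesis
        using 1 by (auto intro!: derivative_eq_intros simp: flat_exp_def power2_eq_square field_simps)
          (cases m; simp)
    qed
    then show ?thesis
      by (rule has_field_derivative_transform_within_open[of _ _ _ "{0<..}"])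
        (use 1 in \<open>auto simp: flat_exp_def\<close>)
  next
    case 2
    have "((\<lambda>y. 0) has_real_derivative 0) (at x)" by simp
    then have "(flat_exp n has_real_derivative 0) (at x)"
      by (rule has_field_derivative_transform_within_open[of _ _ _ "{..<0}"])
        (use 2 in \<open>auto simp: flat_exp_def\<close>)
    then show ?thesis using 2 by (simp add: flat_exp_def)
  next
    case 3
    have "((\<lambda>y. flat_exp n y / y) \<longlongrightarrow> 0) (at 0)"
    proof (rule Lim_null_comparison)
      show "\<forall>\<^sub>F y in at 0. norm (flat_exp n y / y) \<le> fact (n + 2) * \<bar>y\<bar>"
      proof (rule eventually_at_topological[THEN iffD2], intro exI[of _ UNIV] conjI ballI impI)
        fix y :: real assume "y \<noteq> 0"
        then show "norm (flat_exp n y / y) \<le> fact (n + 2) * \<bar>y\<bar>"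
          using flat_exp_le[of n y] by (simp add: field_simps abs_mult power2_eq_square del: fact_Suc)
      qed auto
      show "((\<lambda>y. fact (n + 2) * \<bar>y\<bar>) \<longlongrightarrow> 0) (at (0::real))"
        by (auto intro!: tendsto_eq_intros)
    qed
    then show ?thesis using 3
      by (simp add: has_field_derivative_iff flat_exp_def)
  qed
qed

lemma smooth_on_flat_exp: "smooth_on UNIV (flat_exp n)"
proof -
  have "Ck_on k UNIV (flat_exp n)" for k
  proof (induction k arbitrary: n)
    case 0
    show ?case
      by (auto intro!: DERIV_isCont[OF flat_exp_has_derivative] simp: continuous_on_eq_continuous_at)
  next
    case (Suc k)
    show ?case
    proof (rule Ck_on_SucI)
      show "(flat_exp n has_derivative (\<lambda>v. (flat_exp (n + 2) x + (- n) * flat_exp (n + 1) x) * v)) (at x)" for x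
        using flat_exp_has_derivative[of n x] by (simp add: has_field_derivative_def)
      show "Ck_on k UNIV (\<lambda>x. (flat_exp (n + 2) x + (- n) * flat_exp (n + 1) x) * v)" for v
        by (intro Ck_on_mult Ck_on_add Ck_on_const Suc.IH) auto
    qed simp
  qed
  then show ?thesis by (simp add: smooth_on_def)
qed

lemma smooth_on_norm_square:
  fixes B :: "'e::real_inner set" and c :: 'e
  assumes B: "frame B" shows "smooth_on UNIV (\<lambda>x. (x - c) \<bullet> (x - c))"
proof -
  have "smooth_on UNIV (\<lambda>x. (x - c) \<bullet> b)" for b
    using smooth_on_add[of UNIV "\<lambda>x. x \<bullet> b" "\<lambda>x. - (c \<bullet> b)"]
    by (simp add: smooth_on_linear bounded_linear_inner_left smooth_on_const inner_diff_left)
  then have "smooth_on UNIV (\<lambda>x. \<Sum>b\<in>B. ((x - c) \<bullet> b) * ((x - c) \<bullet> b))"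
    by (intro smooth_on_sum smooth_on_mult) auto
  moreover have "(\<Sum>b\<in>B. (y \<bullet> b) * (y \<bullet> b)) = y \<bullet> y" for y
  proof -
    have "y \<bullet> y = y \<bullet> (\<Sum>b\<in>B. (y \<bullet> b) *\<^sub>R b)" by (simp add: frame_sum[OF B])
    then show ?thesis by (simp add: inner_sum_right)
  qed
  ultimately show ?thesis by simp
qed

text \<open>The quotient \<open>\<alpha> / (\<alpha> + \<beta>)\<close>, where \<alpha> vanishes
  outside the ball of radius \<open>r\<close> and \<beta> inside the ball of radius
  \<open>r / 2\<close>. As the radii differ, the two never vanish together.\<close>

lemma smooth_bump:
  fixes B :: "'e::real_inner set"
  assumes B: "frame B" and r: "r > 0"
  obtains \<theta> :: "'e \<Rightarrow> real" where "smooth_on UNIV \<theta>"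
    "\<And>x. dist c x \<le> r / 2 \<Longrightarrow> \<theta> x = 1" "\<And>x. dist c x \<ge> r \<Longrightarrow> \<theta> x = 0"
proof
  define q where "q x = (x - c) \<bullet> (x - c)" for x
  have q: "q x = (dist c x)\<^sup>2" for x
    by (simp add: q_def dist_norm norm_minus_commute[of c x] power2_norm_eq_inner)
  define \<alpha> where "\<alpha> x = flat_exp 0 (r\<^sup>2 - q x)" for x
  define \<beta> where "\<beta> x = flat_exp 0 (q x - (r / 2)\<^sup>2)" for x
  define \<theta> where "\<theta> x = \<alpha> x * inverse (\<alpha> x + \<beta> x)" for x
  have sq: "smooth_on UNIV q"
    unfolding q_def using smooth_on_norm_square[OF B] .
  have \<alpha>: "smooth_on UNIV \<alpha>"
    unfolding \<alpha>_def
    by (rule smooth_on_compose[OF frame_real _ smooth_on_flat_exp])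
      (auto intro: smooth_on_diff smooth_on_const sq)
  have \<beta>: "smooth_on UNIV \<beta>"
    unfolding \<beta>_def
    by (rule smooth_on_compose[OF frame_real _ smooth_on_flat_exp])
      (auto intro: smooth_on_diff smooth_on_const sq)
  have pos: "\<alpha> x + \<beta> x \<noteq> 0" for x
  proof (cases "q x < r\<^sup>2")
    case True
    then have "\<alpha> x > 0" by (simp add: \<alpha>_def flat_exp_def)
    moreover have "\<beta> x \<ge> 0" by (simp add: \<beta>_def flat_exp_def)
    ultimately show ?thesis by simp
  next
    case False
    have "(r / 2)\<^sup>2 < r\<^sup>2" using r by (intro power_strict_mono) auto
    then have "\<beta> x > 0" using False by (simp add: \<beta>_def flat_exp_def)
    moreover have "\<alpha> x \<ge> 0" by (simp add: \<alpha>_def flat_exp_def)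
    ultimately show ?thesis by simp
  qed
  show "smooth_on UNIV \<theta>"
    unfolding \<theta>_def by (intro smooth_on_mult smooth_on_inverse smooth_on_add \<alpha> \<beta> pos) auto
  show "\<theta> x = 1" if "dist c x \<le> r / 2" for x
  proof -
    have "q x \<le> (r / 2)\<^sup>2" unfolding q by (rule power_mono[OF that]) simp
    then have "\<beta> x = 0" by (simp add: \<beta>_def flat_exp_def)
    then show ?thesis using pos[of x] by (simp add: \<theta>_def)
  qed
  show "\<theta> x = 0" if "dist c x \<ge> r" for x
  proof -
    have "q x \<ge> r\<^sup>2" unfolding q by (rule power_mono[OF that]) (use r in simp)
    then show ?thesis by (simp add: \<theta>_def \<alpha>_def flat_exp_def)
  qed
qed

subsection \<open>Hadamard's lemma\<close>

lemma frame_linear_bound: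
  fixes L :: "'e::real_inner \<Rightarrow> 'f::real_normed_vector"
  assumes B: "frame B" and L: "linear L" and le: "\<And>b. b \<in> B \<Longrightarrow> norm (L b) \<le> \<epsilon>" and "\<epsilon> \<ge> 0"
  shows "norm (L v) \<le> \<epsilon> * (\<Sum>b\<in>B. norm b) * norm v"
proof -
  have "L v = (\<Sum>b\<in>B. (v \<bullet> b) *\<^sub>R L b)"
    by (subst frame_sum[OF B, of v, symmetric]) (simp add: linear_sum[OF L] linear_scale[OF L])
  also have "norm \<dots> \<le> (\<Sum>b\<in>B. (norm v * norm b) * \<epsilon>)"
    by (rule order_trans[OF norm_sum])
      (auto intro!: sum_mono mult_mono le Cauchy_Schwarz_ineq2)
  also have "\<dots> = \<epsilon> * (\<Sum>b\<in>B. norm b) * norm v"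
    by (simp add: sum_distrib_left sum_distrib_right mult_ac)
  finally show ?thesis .
qed

text \<open>The directional derivatives along the finite frame are uniformly continuous on the
  compact set \<open>K\<close>, which controls the variation of the whole derivative; the mean value
  inequality on the convex intersection of \<open>K\<close> with a ball does the rest. It serves
  twice, for differentiating under an integral and for a contraction estimate.\<close>

lemma smooth_on_uniform_linearization:
  fixes f :: "'e::{real_inner,heine_borel} \<Rightarrow> 'f::real_normed_vector"
  assumes B: "frame (B::'e set)" and f: "smooth_on S f" and K: "compact K" "convex K" "K \<subseteq> S" and "\<epsilon> > 0"
  obtains d where "d > 0"
    "\<And>x y z. x \<in> K \<Longrightarrow> y \<in> K \<Longrightarrow> z \<in> K \<Longrightarrow> dist x z < d \<Longrightarrow> dist y z < d
      \<Longrightarrow> norm (f y - f x - frechet_derivative f (at z) (y - x)) \<le> \<epsilon> * norm (y - x)"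
proof -
  \<comment> \<open>The summand 1 keeps \<open>C\<close> positive even for an empty frame.\<close>
  define C where "C = 1 + (\<Sum>b\<in>B. norm b)"
  have C: "C \<ge> 1" by (simp add: C_def sum_nonneg)
  have "\<exists>d>0. \<forall>x\<in>K. \<forall>y\<in>K. dist x y < d \<longrightarrow> norm (dirderiv f b x - dirderiv f b y) \<le> \<epsilon> / C" for b
  proof -
    have "uniformly_continuous_on K (dirderiv f b)"
      using smooth_on_continuous[OF smooth_on_dirderiv[OF f]] K
      by (intro compact_uniformly_continuous) (auto intro: continuous_on_subset)
    moreover have "\<epsilon> / C > 0" using \<open>\<epsilon> > 0\<close> C by simp
    ultimately show ?thesis unfolding uniformly_continuous_on_def dist_norm[of "dirderiv f b _"]
      by (metis dist_commute less_imp_le)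
  qed
  then obtain d where d: "\<And>b. d b > 0"
    "\<And>b x y. x \<in> K \<Longrightarrow> y \<in> K \<Longrightarrow> dist x y < d b \<Longrightarrow> norm (dirderiv f b x - dirderiv f b y) \<le> \<epsilon> / C"
    by metis
  \<comment> \<open>Inserting 1 gives the minimum a meaning for an empty frame.\<close>
  define D where "D = Min (insert 1 (d ` B))"
  have fin: "finite (insert 1 (d ` B))" using frame_finite[OF B] by simp
  have D: "D > 0" unfolding D_def using fin d(1) by (subst Min_gr_iff) auto
  have Db: "D \<le> d b" if "b \<in> B" for b unfolding D_def using fin that by (intro Min_le) auto
  show ?thesis
  proof
    show "D > 0" by (rule D)
    fix x y z assume xyz: "x \<in> K" "y \<in> K" "z \<in> K" "dist x z < D" "dist y z < D"
    define T where "T = K \<inter> ball z D"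
    have cT: "convex T" unfolding T_def by (intro convex_Int K convex_ball)
    have der: "(f has_derivative frechet_derivative f (at w)) (at w)" if "w \<in> K" for w
      using smooth_on_has_derivative[OF f] K(3) that by blast
    have on: "onorm (frechet_derivative f (at w) - frechet_derivative f (at z)) \<le> \<epsilon>" if w: "w \<in> T" for w
    proof (rule onorm_bound)
      fix v
      have l: "linear (frechet_derivative f (at w) - frechet_derivative f (at z))"
        using has_derivative_linear[OF der] w xyz(3)
        by (auto simp: T_def fun_diff_def intro!: linear_compose_sub)
      have "norm ((frechet_derivative f (at w) - frechet_derivative f (at z)) v)
          \<le> \<epsilon> / C * (\<Sum>b\<in>B. norm b) * norm v"
      proof (rule frame_linear_bound[OF B l])
        fix b assume "b \<in> B"
        then show "norm ((frechet_derivative f (at w) - frechet_derivative f (at z)) b) \<le> \<epsilon> / C"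
          using d(2)[of w z b] w xyz(3) Db[of b] by (auto simp: T_def dist_commute)
      qed (use \<open>\<epsilon> > 0\<close> C in auto)
      also have "\<dots> \<le> \<epsilon> * norm v"
      proof (rule mult_right_mono)
        have "\<epsilon> / C * (\<Sum>b\<in>B. norm b) \<le> \<epsilon> / C * C"
          using \<open>\<epsilon> > 0\<close> C by (intro mult_left_mono) (auto simp: C_def)
        then show "\<epsilon> / C * (\<Sum>b\<in>B. norm b) \<le> \<epsilon>" using C by simp
      qed simp
      finally show "norm ((frechet_derivative f (at w) - frechet_derivative f (at z)) v) \<le> \<epsilon> * norm v" .
    qed (use \<open>\<epsilon> > 0\<close> in simp)
    have "norm (f y - f x - frechet_derivative f (at z) (y - x)) \<le> norm (y - x) * \<epsilon>"
    proof (rule differentiable_bound_linearization[where S = T and f' = "\<lambda>x. frechet_derivative f (at x)"])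
      show "x + t *\<^sub>R (y - x) \<in> T" if "t \<in> {0..1}" for t
      proof -
        have "(1 - t) *\<^sub>R x + t *\<^sub>R y \<in> T"
          using xyz that by (intro convexD[OF cT]) (auto simp: T_def dist_commute)
        then show ?thesis by (simp add: algebra_simps)
      qed
      show "(f has_derivative frechet_derivative f (at w)) (at w within T)" if "w \<in> T" for w
        using der that by (auto simp: T_def intro: has_derivative_at_withinI)
    qed (use on xyz D in \<open>auto simp: T_def\<close>)
    then show "norm (f y - f x - frechet_derivative f (at z) (y - x)) \<le> \<epsilon> * norm (y - x)"
      by (simp add: mult.commute)
  qed
qed

text \<open>The weight \<open>t ^ n\<close> records \<open>n\<close> differentiations with respect
  to \<open>x\<close>: each brings out one factor \<open>t\<close> by the chain rule.\<close>

definition ray_integral :: "'e::real_normed_vector \<Rightarrow> nat \<Rightarrow> ('e \<Rightarrow> real) \<Rightarrow> 'e \<Rightarrow> real" where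
  "ray_integral c n h x = integral {0..1} (\<lambda>t. t ^ n * h (c + t *\<^sub>R (x - c)))"

lemma ray_in_ball:
  fixes c x :: "'e::real_normed_vector"
  assumes "t \<in> {0..1}"
  shows "x \<in> ball c r \<Longrightarrow> c + t *\<^sub>R (x - c) \<in> ball c r"
    and "x \<in> cball c r \<Longrightarrow> c + t *\<^sub>R (x - c) \<in> cball c r"
proof -
  have "t * norm (x - c) \<le> 1 * norm (x - c)" using assms by (intro mult_right_mono) auto
  then have "dist c (c + t *\<^sub>R (x - c)) \<le> dist c x"
    using assms by (simp add: dist_norm norm_minus_commute[of c x])
  then show "x \<in> ball c r \<Longrightarrow> c + t *\<^sub>R (x - c) \<in> ball c r"
    and "x \<in> cball c r \<Longrightarrow> c + t *\<^sub>R (x - c) \<in> cball c r"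
    by auto
qed

lemma ray_integrable:
  fixes c :: "'e::real_normed_vector" and h :: "'e \<Rightarrow> real"
  assumes h: "continuous_on (ball c R) h" and x: "x \<in> ball c R"
  shows "(\<lambda>t. t ^ n * h (c + t *\<^sub>R (x - c))) integrable_on {0..1}"
proof (rule integrable_continuous_real, intro continuous_intros continuous_on_compose2[OF h])
  show "(\<lambda>t. c + t *\<^sub>R (x - c)) ` {0..1} \<subseteq> ball c R"
    by (intro image_subsetI ray_in_ball(1) x)
qed

text \<open>Differentiation under the integral sign. The linearization error of \<open>h\<close> is
  bounded by a small multiple of \<open>norm (y - x)\<close>, uniformly along the ray, and
  integration over the unit interval keeps the bound.\<close>

lemma ray_integral_has_derivative:
  fixes c :: "'e::{real_inner,heine_borel}"
  assumes B: "frame (B::'e set)" and h: "smooth_on (ball c R) h" and x: "x \<in> ball c R"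
  shows "(ray_integral c n h has_derivative
    (\<lambda>v. \<Sum>b\<in>B. (v \<bullet> b) * ray_integral c (Suc n) (dirderiv h b) x)) (at x)"
proof -
  \<comment> \<open>A radius strictly between \<open>dist c x\<close> and \<open>R\<close>: the
    closed ball is compact, lies in the domain of \<open>h\<close> and contains all points near
    \<open>x\<close>.\<close>
  define r where "r = (dist c x + R) / 2"
  have r: "dist c x < r" "r < R" using x by (auto simp: r_def)
  have cb: "cball c r \<subseteq> ball c R" using r by auto
  let ?p = "\<lambda>x t. c + t *\<^sub>R (x - c)"
  have cont: "continuous_on (ball c R) h" "\<And>b. continuous_on (ball c R) (dirderiv h b)"
    using smooth_on_continuous h smooth_on_dirderiv by blast+
  have est: "\<exists>d>0. \<forall>y. dist y x < d \<longrightarrow>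
      norm (ray_integral c n h y - ray_integral c n h x
        - (\<Sum>b\<in>B. ((y - x) \<bullet> b) * ray_integral c (Suc n) (dirderiv h b) x)) \<le> \<epsilon> * norm (y - x)"
    if eps: "\<epsilon> > 0" for \<epsilon>
  proof -
    obtain d where d: "d > 0" "\<And>x y z. x \<in> cball c r \<Longrightarrow> y \<in> cball c r \<Longrightarrow> z \<in> cball c r
        \<Longrightarrow> dist x z < d \<Longrightarrow> dist y z < d
        \<Longrightarrow> norm (h y - h x - frechet_derivative h (at z) (y - x)) \<le> \<epsilon> * norm (y - x)"
      using smooth_on_uniform_linearization[OF B h compact_cball convex_cball cb eps] by blast
    show ?thesis
    proof (intro exI[of _ "min d (r - dist c x)"] conjI allI impI)
      fix y assume y: "dist y x < min d (r - dist c x)"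
      then have yr: "dist c y < r" using dist_triangle[of c y x] by (simp add: dist_commute)
      have yR: "y \<in> ball c R" using yr r by auto
      have xr: "x \<in> cball c r" using r by simp
      define g where "g t = t ^ n * h (?p y t) - t ^ n * h (?p x t)
        - (\<Sum>b\<in>B. ((y - x) \<bullet> b) * (t ^ Suc n * dirderiv h b (?p x t)))" for t
      have gi: "(g has_integral (ray_integral c n h y - ray_integral c n h x
        - (\<Sum>b\<in>B. ((y - x) \<bullet> b) * ray_integral c (Suc n) (dirderiv h b) x))) {0..1}"
        unfolding g_def ray_integral_def
        by (intro has_integral_diff has_integral_sum has_integral_mult_right integrable_integral
            ray_integrable[OF cont(1)] ray_integrable[OF cont(2)] frame_finite[OF B] x yR)
      have "norm (g t) \<le> \<epsilon> * norm (y - x)" if t: "t \<in> {0..1}" for t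
      proof -
        have px: "?p x t \<in> cball c r" and py: "?p y t \<in> cball c r"
          using ray_in_ball(2)[OF t, of x c r] ray_in_ball(2)[OF t, of y c r] xr yr by auto
        have dd: "?p y t - ?p x t = t *\<^sub>R (y - x)" by (simp add: algebra_simps)
        have ts: "norm (t *\<^sub>R (y - x)) \<le> norm (y - x)"
          using t by (simp add: mult_left_le_one_le)
        have lin: "linear (frechet_derivative h (at (?p x t)))"
          using smooth_on_has_derivative[OF h] has_derivative_linear px cb by blast
        have "frechet_derivative h (at (?p x t)) (y - x) = (\<Sum>b\<in>B. ((y - x) \<bullet> b) * dirderiv h b (?p x t))"
          by (subst frame_sum[OF B, of "y - x", symmetric])
            (simp add: linear_sum[OF lin] linear_scale[OF lin])
        then have "g t = t ^ n * (h (?p y t) - h (?p x t) - frechet_derivative h (at (?p x t)) (?p y t - ?p x t))"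
          unfolding dd g_def linear_scale[OF lin]
          by (simp add: algebra_simps sum_distrib_left)
        then have "norm (g t) = t ^ n * norm (h (?p y t) - h (?p x t) - frechet_derivative h (at (?p x t)) (?p y t - ?p x t))"
          using t by (simp add: abs_mult)
        also have "\<dots> \<le> 1 * (\<epsilon> * norm (?p y t - ?p x t))"
        proof (rule mult_mono)
          have "dist (?p y t) (?p x t) < d"
            using ts y unfolding dist_norm dd by linarith
          then show "norm (h (?p y t) - h (?p x t) - frechet_derivative h (at (?p x t)) (?p y t - ?p x t))
            \<le> \<epsilon> * norm (?p y t - ?p x t)"
            by (intro d(2) px py) (use d(1) in auto)
        qed (use t in \<open>auto intro: power_le_one\<close>)
        also have "\<dots> \<le> \<epsilon> * norm (y - x)"
          using ts \<open>\<epsilon> > 0\<close> unfolding dd by (simp del: norm_scaleR)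
        finally show ?thesis .
      qed
      then show "norm (ray_integral c n h y - ray_integral c n h x
        - (\<Sum>b\<in>B. ((y - x) \<bullet> b) * ray_integral c (Suc n) (dirderiv h b) x)) \<le> \<epsilon> * norm (y - x)"
        using has_integral_bound[of "\<epsilon> * norm (y - x)" g _ 0 1] gi \<open>\<epsilon> > 0\<close> by simp
    qed (use d r in simp)
  qed
  have "bounded_linear (\<lambda>v. \<Sum>b\<in>B. (v \<bullet> b) * ray_integral c (Suc n) (dirderiv h b) x)"
    by (intro bounded_linear_sum bounded_linear_mult_const bounded_linear_inner_left)
  then show ?thesis using est by (simp add: has_derivative_at_alt dist_norm)
qed

lemma smooth_on_ray_integral:
  fixes c :: "'e::{real_inner,heine_borel}"
  assumes B: "frame (B::'e set)" and h: "smooth_on (ball c R) h"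
  shows "smooth_on (ball c R) (ray_integral c n h)"
proof -
  have "Ck_on k (ball c R) (ray_integral c n h)" for k
    using h
  proof (induction k arbitrary: n h)
    case 0
    show ?case
      using has_derivative_continuous[OF ray_integral_has_derivative[OF B 0]]
      by (auto intro: continuous_at_imp_continuous_on)
  next
    case (Suc k)
    show ?case
      by (rule Ck_on_SucI[OF _ ray_integral_has_derivative[OF B Suc.prems]])
        (rule open_ball, assumption, intro Ck_on_sum Ck_on_mult Ck_on_const Suc.IH smooth_on_dirderiv Suc.prems open_ball)
  qed
  then show ?thesis by (simp add: smooth_on_def)
qed

text \<open>Integrating the derivative of \<open>f\<close> along the ray from \<open>c\<close>
  yields the coefficients as ray integrals; at \<open>c\<close> itself the integrand is constant,
  whence their values there.\<close>

lemma hadamard: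
  fixes c :: "'e::{real_inner,heine_borel}"
  assumes B: "frame (B::'e set)" and f: "smooth_on (ball c R) f" and R: "R > 0"
  obtains g where "\<And>b. smooth_on (ball c R) (g b)" "\<And>b. g b c = dirderiv f b c"
    "\<And>x. x \<in> ball c R \<Longrightarrow> f x = f c + (\<Sum>b\<in>B. ((x - c) \<bullet> b) * g b x)"
proof
  define g where "g b = ray_integral c 0 (dirderiv f b)" for b
  show "smooth_on (ball c R) (g b)" for b
    unfolding g_def by (intro smooth_on_ray_integral[OF B] smooth_on_dirderiv f)
  show "g b c = dirderiv f b c" for b
    by (simp add: g_def ray_integral_def)
  fix x assume x: "x \<in> ball c R"
  let ?p = "\<lambda>t. c + t *\<^sub>R (x - c)"
  have pR: "?p t \<in> ball c R" if "t \<in> {0..1}" for t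
    by (rule ray_in_ball(1)[OF that x])
  have i1: "((\<lambda>t. \<Sum>b\<in>B. ((x - c) \<bullet> b) * (t ^ 0 * dirderiv f b (?p t))) has_integral
      (\<Sum>b\<in>B. ((x - c) \<bullet> b) * g b x)) {0..1}"
    unfolding g_def ray_integral_def
    by (intro has_integral_sum has_integral_mult_right integrable_integral ray_integrable[of c R]
        frame_finite[OF B] x smooth_on_continuous smooth_on_dirderiv f)
  have i2: "((\<lambda>t. \<Sum>b\<in>B. ((x - c) \<bullet> b) * (t ^ 0 * dirderiv f b (?p t))) has_integral
      (f (?p 1) - f (?p 0))) {0..1}"
  proof (rule fundamental_theorem_of_calculus)
    fix t :: real assume t: "t \<in> {0..1}"
    have fd: "(f has_derivative frechet_derivative f (at (?p t))) (at (?p t))"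
      by (rule smooth_on_has_derivative[OF f pR[OF t]])
    have lin: "linear (frechet_derivative f (at (?p t)))" using has_derivative_linear[OF fd] .
    have "(\<Sum>b\<in>B. ((x - c) \<bullet> b) * (t ^ 0 * dirderiv f b (?p t))) = frechet_derivative f (at (?p t)) (x - c)"
      by (subst (2) frame_sum[OF B, of "x - c", symmetric])
        (simp add: linear_sum[OF lin] linear_scale[OF lin])
    moreover have "(?p has_vector_derivative (x - c)) (at t within {0..1})"
      by (auto intro!: derivative_eq_intros)
    then have "((f \<circ> ?p) has_vector_derivative frechet_derivative f (at (?p t)) (x - c)) (at t within {0..1})"
      by (rule vector_derivative_diff_chain_within) (rule has_derivative_at_withinI[OF fd])
    ultimately show "((\<lambda>t. f (?p t)) has_vector_derivative
      (\<Sum>b\<in>B. ((x - c) \<bullet> b) * (t ^ 0 * dirderiv f b (?p t)))) (at t within {0..1})"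
      by (simp add: o_def)
  qed simp
  from has_integral_unique[OF i2 i1] show "f x = f c + (\<Sum>b\<in>B. ((x - c) \<bullet> b) * g b x)" by simp
qed

subsection \<open>Curves in a level set\<close>

lemma has_vector_derivative_zero_iff:
  assumes "f 0 = 0"
  shows "(f has_vector_derivative 0) (at 0) \<longleftrightarrow> ((\<lambda>t. f t /\<^sub>R t) \<longlongrightarrow> 0) (at 0)"
  by (subst tendsto_norm_zero_iff[symmetric])
    (simp add: has_vector_derivative_def has_derivative_at divide_inverse mult.commute assms)

text \<open>The straight line \<open>p\<close> with direction \<open>D\<close> is corrected to
  \<open>p t + R (y t)\<close>, where \<open>R\<close> is a linear right inverse of the derivative
  and \<open>y t\<close> is a fixed point of \<open>y - F (p t + R y)\<close>. As \<open>D\<close>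
  lies in the kernel, \<open>F (p t)\<close> is \<open>o(t)\<close>; so is the correction, and the
  velocity remains \<open>D\<close>.\<close>

lemma curve_in_level_set:
  fixes F :: "'e::{real_inner,heine_borel} \<Rightarrow> 'f::{real_inner,heine_borel}"
  assumes B: "frame (B::'e set)" and C: "frame (C::'f set)"
    and S: "open S" "x0 \<in> S" and F: "smooth_on S F" "F x0 = 0"
    and surj: "surj (frechet_derivative F (at x0))" and D: "frechet_derivative F (at x0) D = 0"
  obtains c :: "real \<Rightarrow> 'e" where "c 0 = x0" "(c has_vector_derivative D) (at 0)"
    "\<And>t. c t \<in> S" "\<And>t. F (c t) = 0"
proof -
  let ?A = "frechet_derivative F (at x0)"
  have A: "bounded_linear ?A"
    using smooth_on_has_derivative[OF F(1) S(2)] has_derivative_bounded_linear by blast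
  obtain e where e: "\<And>b. ?A (e b) = b" using surj by (metis surj_def)
  \<comment> \<open>Preimages are chosen on the frame only, and the formula extends them
    linearly.\<close>
  define R where "R z = (\<Sum>b\<in>C. (z \<bullet> b) *\<^sub>R e b)" for z
  have R: "bounded_linear R"
    unfolding R_def
    by (intro bounded_linear_sum bounded_linear_compose[OF bounded_linear_scaleR_left] bounded_linear_inner_left)
  have AR: "?A (R z) = z" for z
    using bounded_linear.linear[OF A] frame_sum[OF C, of z]
    by (simp add: R_def linear_sum linear_scale e)
  obtain L where L: "L > 0" "\<And>z. norm (R z) \<le> norm z * L"
    using bounded_linear.pos_bounded[OF R] by blast
  obtain s where s: "s > 0" "cball x0 s \<subseteq> S" using S open_contains_cball by blast
  \<comment> \<open>The slope \<open>1 / (2 * L)\<close> makes the fixed point map contract by 1/2,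
    since \<open>R\<close> stretches by at most \<open>L\<close>.\<close>
  obtain d where d: "d > 0" "\<And>x y z. x \<in> cball x0 s \<Longrightarrow> y \<in> cball x0 s \<Longrightarrow> z \<in> cball x0 s
      \<Longrightarrow> dist x z < d \<Longrightarrow> dist y z < d
      \<Longrightarrow> norm (F y - F x - frechet_derivative F (at z) (y - x)) \<le> 1 / (2 * L) * norm (y - x)"
    using smooth_on_uniform_linearization[OF B F(1) compact_cball convex_cball s(2), of "1 / (2 * L)"] L(1)
    by auto
  define \<rho> where "\<rho> = min s d / 2"
  have \<rho>: "\<rho> > 0" "\<rho> \<le> s" "\<rho> < d" using s d by (auto simp: \<rho>_def)
  have lin: "norm (F y - F x - ?A (y - x)) \<le> 1 / (2 * L) * norm (y - x)"
    if "dist x x0 \<le> \<rho>" "dist y x0 \<le> \<rho>" for x y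
    using d(2)[of x y x0] that \<rho> s by (auto simp: dist_commute)
  define p where "p t = x0 + t *\<^sub>R D" for t :: real
  \<comment> \<open>The radius of the ball in which the fixed point is sought: \<open>T 0\<close>
    has norm \<open>\<eta> t / 2\<close>, and the contraction factor 1/2 adds at most another
    \<open>\<eta> t / 2\<close>.\<close>
  define \<eta> where "\<eta> t = 2 * norm (F (p t))" for t
  have p: "(p has_vector_derivative D) (at 0)" "p 0 = x0"
    unfolding p_def by (auto intro!: derivative_eq_intros)
  have Fp: "((\<lambda>t. F (p t)) has_vector_derivative 0) (at 0)"
    using vector_derivative_diff_chain_within[of p D 0 UNIV F ?A] p
      smooth_on_has_derivative[OF F(1) S(2)] D has_derivative_at_withinI by (force simp: o_def)
  have tp: "(p \<longlongrightarrow> x0) (at 0)"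
    using has_vector_derivative_continuous[OF p(1)] p(2) by (simp add: continuous_at)
  have "((\<lambda>t. F (p t)) \<longlongrightarrow> 0) (at 0)"
    using has_vector_derivative_continuous[OF Fp] p(2) F(2) by (simp add: continuous_at)
  then have "((\<lambda>t. L * \<eta> t) \<longlongrightarrow> 0) (at 0)"
    unfolding \<eta>_def by (auto intro!: tendsto_eq_intros)
  with tp have "\<forall>\<^sub>F t in at 0. dist (p t) x0 < \<rho> / 2 \<and> dist (L * \<eta> t) 0 < \<rho> / 2"
    using \<rho>(1) by (intro eventually_conj tendstoD) auto
  then obtain \<delta> where \<delta>: "\<delta> > 0"
    "\<And>t. t \<noteq> 0 \<Longrightarrow> dist t 0 < \<delta> \<Longrightarrow> dist (p t) x0 < \<rho> / 2 \<and> dist (L * \<eta> t) 0 < \<rho> / 2"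
    unfolding eventually_at by auto
  have "\<exists>y. norm y \<le> \<eta> t \<and> F (p t + R y) = 0 \<and> p t + R y \<in> S" if t: "\<bar>t\<bar> < \<delta>" for t
  proof -
    have small: "dist (p t) x0 < \<rho> / 2" "L * \<eta> t < \<rho> / 2"
      using \<delta>(2)[of t] t \<rho>(1) by (cases "t = 0"; auto simp: p(2) \<eta>_def F(2))+
    define T where "T y = y - F (p t + R y)" for y
    have near: "dist (p t + R y) x0 \<le> \<rho>" if "y \<in> cball 0 (\<eta> t)" for y
    proof -
      have "norm (R y) \<le> \<eta> t * L"
        using L(2)[of y] that L(1) by (smt (verit) dist_0_norm mem_cball mult_right_mono)
      then have "dist (p t + R y) (p t) \<le> \<rho> / 2" using small by (simp add: dist_norm mult.commute)
      then show ?thesis using small dist_triangle[of "p t + R y" x0 "p t"] by linarith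
    qed
    have contr: "dist (T x) (T y) \<le> 1 / 2 * dist x y" if "x \<in> cball 0 (\<eta> t)" "y \<in> cball 0 (\<eta> t)" for x y
    proof -
      have Rd: "p t + R y - (p t + R x) = R (y - x)" using R by (simp add: linear_diff bounded_linear.linear)
      have "dist (T x) (T y) = norm (F (p t + R y) - F (p t + R x) - (y - x))"
        by (simp add: T_def dist_norm algebra_simps)
      also have "\<dots> \<le> 1 / (2 * L) * norm (R (y - x))"
        using lin[OF near[OF that(1)] near[OF that(2)]] unfolding Rd AR .
      also have "\<dots> \<le> 1 / (2 * L) * (norm (y - x) * L)"
        using L by (intro mult_left_mono) auto
      also have "\<dots> = 1 / 2 * dist x y" using L(1) by (simp add: dist_norm norm_minus_commute)
      finally show ?thesis .
    qed
    have "\<exists>!y\<in>cball 0 (\<eta> t). T y = y"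
    proof (rule Banach_fix[where c = "1 / 2"])
      show "complete (cball (0::'f) (\<eta> t))" by (rule compact_imp_complete[OF compact_cball])
      show "cball (0::'f) (\<eta> t) \<noteq> {}" by (simp add: \<eta>_def)
      show "T ` cball 0 (\<eta> t) \<subseteq> cball 0 (\<eta> t)"
      proof clarify
        fix y :: 'f assume y: "y \<in> cball 0 (\<eta> t)"
        have "dist (T 0) (T y) \<le> 1 / 2 * dist 0 y" by (rule contr[OF _ y]) (simp add: \<eta>_def)
        moreover have "norm (T 0) = \<eta> t / 2"
          using R by (simp add: T_def \<eta>_def linear_0 bounded_linear.linear)
        moreover have "norm (T y) \<le> norm (T 0) + dist (T 0) (T y)"
          by (metis dist_norm norm_triangle_sub norm_minus_commute)
        moreover have "dist 0 y \<le> \<eta> t" using y by simp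
        ultimately show "T y \<in> cball 0 (\<eta> t)" by simp
      qed
    qed (use contr in auto)
    then obtain y where y: "y \<in> cball 0 (\<eta> t)" "T y = y" by blast
    then show ?thesis
      using near[OF y(1)] s \<rho> by (intro exI[of _ y]) (auto simp: T_def dist_commute)
  qed
  then obtain y where y: "\<And>t. \<bar>t\<bar> < \<delta> \<Longrightarrow> norm (y t) \<le> \<eta> t \<and> F (p t + R (y t)) = 0 \<and> p t + R (y t) \<in> S"
    by metis
  \<comment> \<open>The fixed points were chosen separately for each \<open>t\<close>; the bound
    \<open>norm (y t) \<le> \<eta> t\<close> is all that relates them, and it settles
    differentiability at 0. Away from 0 the curve is held at \<open>x0\<close>.\<close>
  define c where "c t = (if \<bar>t\<bar> < \<delta> then p t + R (y t) else x0)" for t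
  have y0: "y 0 = 0" using y[of 0] \<delta>(1) by (simp add: \<eta>_def p F)
  have c0: "c 0 = x0" using \<delta>(1) R by (simp add: c_def y0 p linear_0 bounded_linear.linear)
  have "((\<lambda>t. F (p t) /\<^sub>R t) \<longlongrightarrow> 0) (at 0)"
    using Fp by (simp add: has_vector_derivative_zero_iff p(2) F(2))
  then have lim: "((\<lambda>t. norm (F (p t) /\<^sub>R t) * (2 * L)) \<longlongrightarrow> 0) (at 0)"
    by (intro tendsto_mult_left_zero tendsto_norm_zero)
  have "((\<lambda>t. R (y t) /\<^sub>R t) \<longlongrightarrow> 0) (at 0)"
  proof (rule Lim_null_comparison[OF _ lim])
    have le: "norm (R (y t) /\<^sub>R t) \<le> norm (F (p t) /\<^sub>R t) * (2 * L)" if "\<bar>t\<bar> < \<delta>" for t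
    proof -
      have "norm (R (y t)) \<le> \<eta> t * L"
        using L(2)[of "y t"] y[OF that] L(1) by (smt (verit) mult_right_mono)
      then have "inverse \<bar>t\<bar> * norm (R (y t)) \<le> inverse \<bar>t\<bar> * (\<eta> t * L)"
        by (intro mult_left_mono) auto
      then show ?thesis by (simp add: \<eta>_def mult_ac)
    qed
    then show "\<forall>\<^sub>F t in at 0. norm (R (y t) /\<^sub>R t) \<le> norm (F (p t) /\<^sub>R t) * (2 * L)"
      unfolding eventually_at
    proof (intro exI[of _ \<delta>] conjI ballI impI)
      fix t :: real assume "t \<noteq> 0 \<and> dist t 0 < \<delta>"
      then show "norm (R (y t) /\<^sub>R t) \<le> norm (F (p t) /\<^sub>R t) * (2 * L)" by (intro le) simp
    qed (rule \<delta>(1))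
  qed
  then have "((\<lambda>t. R (y t)) has_vector_derivative 0) (at 0)"
    using R y0 by (simp add: has_vector_derivative_zero_iff linear_0 bounded_linear.linear)
  then have "((\<lambda>t. p t + R (y t)) has_vector_derivative (D + 0)) (at 0)"
    using p(1) by (rule has_vector_derivative_add[rotated])
  then have "((\<lambda>t. p t + R (y t)) has_vector_derivative D) (at 0)" by simp
  then have cd: "(c has_vector_derivative D) (at 0)"
    by (rule has_vector_derivative_transform_within_open[of _ _ _ "{-\<delta><..<\<delta>}"])
      (use \<delta>(1) in \<open>auto simp: c_def\<close>)
  show ?thesis
    using y by (intro that[OF c0 cd]) (auto simp: c_def S F)
qed

section \<open>Smooth functions and tangent vectors in charts\<close>

text \<open>The working notion of manifold, with the spanning set of the model space turned into a
  frame. By \<open>prod_charted\<close> it passes to products, which gives access to pairs and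
  triples of arrows.\<close>

definition charted :: "('a, 'e::{real_inner,heine_borel}) manifold \<Rightarrow> bool" where
  "charted M \<longleftrightarrow>
     (\<exists>B::'e set. frame B) \<and> Hausdorff_space (mtop M) \<and> \<Union> (fst ` atlas M) = points M \<and>
     (\<forall>(U, \<phi>) \<in> atlas M. openin (mtop M) U \<and> open (\<phi> ` U) \<and>
        homeomorphic_map (subtopology (mtop M) U) (top_of_set (\<phi> ` U)) \<phi>) \<and>
     (\<forall>(U, \<phi>) \<in> atlas M. \<forall>(V, \<psi>) \<in> atlas M. smooth_on (\<phi> ` (U \<inter> V)) (\<psi> \<circ> inv_into U \<phi>))"

lemma smooth_manifold_imp_charted:
  fixes M :: "('a, 'e::{real_inner,heine_borel}) manifold"
  assumes "smooth_manifold M" shows "charted M"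
proof -
  obtain B :: "'e set" where "finite B" "span B = UNIV"
    using assms unfolding smooth_manifold_def by blast
  then have "\<exists>B::'e set. frame B" by (rule finite_span_imp_frame)
  then show ?thesis using assms unfolding smooth_manifold_def charted_def by simp
qed

lemma chart_exists:
  assumes "charted M" "p \<in> points M"
  obtains U \<phi> where "(U, \<phi>) \<in> atlas M" "p \<in> U"
proof -
  have "p \<in> \<Union> (fst ` atlas M)" using assms unfolding charted_def by simp
  then obtain c where "c \<in> atlas M" "p \<in> fst c" by blast
  then show thesis using that[of "fst c" "snd c"] by simp
qed

context
  fixes M :: "('a, 'e::{real_inner,heine_borel}) manifold" and U \<phi>
  assumes M: "charted M" and chart: "(U, \<phi>) \<in> atlas M"
begin

lemma chart_openin: "openin (mtop M) U"
  and chart_open_range: "open (\<phi> ` U)"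
  and chart_homeomorphic: "homeomorphic_map (subtopology (mtop M) U) (top_of_set (\<phi> ` U)) \<phi>"
proof -
  have "openin (mtop M) U \<and> open (\<phi> ` U) \<and>
      homeomorphic_map (subtopology (mtop M) U) (top_of_set (\<phi> ` U)) \<phi>"
    using M chart unfolding charted_def by fast
  then show "openin (mtop M) U" "open (\<phi> ` U)"
    "homeomorphic_map (subtopology (mtop M) U) (top_of_set (\<phi> ` U)) \<phi>"
    by simp_all
qed

lemma chart_subset: "U \<subseteq> points M"
  using chart_openin openin_subset by blast

lemma chart_topspace: "topspace (subtopology (mtop M) U) = U"
  using chart_subset by auto

lemma chart_inj: "inj_on \<phi> U"
  using chart_homeomorphic homeomorphic_imp_injective_map chart_topspace by metis

lemma chart_inv: "q \<in> U \<Longrightarrow> inv_into U \<phi> (\<phi> q) = q"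
  using chart_inj by simp

lemma chart_inv_in: "x \<in> \<phi> ` U \<Longrightarrow> inv_into U \<phi> x \<in> U"
  by (rule inv_into_into)

lemma chart_open_image:
  assumes "openin (mtop M) W" "W \<subseteq> U" shows "open (\<phi> ` W)"
proof -
  have "openin (subtopology (mtop M) U) W"
    using assms openin_subtopology by blast
  then have "openin (top_of_set (\<phi> ` U)) (\<phi> ` W)"
    using chart_homeomorphic homeomorphic_imp_open_map open_map_def by blast
  then show ?thesis using chart_open_range openin_open_eq by blast
qed

lemma chart_openin_preimage:
  assumes "open X" shows "openin (mtop M) {q \<in> U. \<phi> q \<in> X}"
proof -
  have "openin (subtopology (mtop M) U) {q \<in> topspace (subtopology (mtop M) U). \<phi> q \<in> \<phi> ` U \<inter> X}"
    using chart_homeomorphic assms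
    by (intro openin_continuous_map_preimage[OF homeomorphic_imp_continuous_map]) auto
  moreover have "{q \<in> topspace (subtopology (mtop M) U). \<phi> q \<in> \<phi> ` U \<inter> X} = {q \<in> U. \<phi> q \<in> X}"
    using chart_topspace by auto
  ultimately show ?thesis using chart_openin openin_open_subtopology by metis
qed

text \<open>A compact subset of a chart is closed in the whole manifold because the topology is
  Hausdorff. This is what allows functions to be extended by zero beyond a chart.\<close>

lemma chart_closedin_preimage:
  assumes K: "compact K" "K \<subseteq> \<phi> ` U" shows "closedin (mtop M) {q \<in> U. \<phi> q \<in> K}"
proof -
  have "\<phi> ` {q \<in> U. \<phi> q \<in> K} = K" using K by auto
  then have "compactin (top_of_set (\<phi> ` U)) (\<phi> ` {q \<in> U. \<phi> q \<in> K})"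
    using K by (simp add: compactin_subtopology)
  then have "compactin (subtopology (mtop M) U) {q \<in> U. \<phi> q \<in> K}"
    using homeomorphic_map_compactness[OF chart_homeomorphic] chart_topspace by (metis (no_types, lifting) mem_Collect_eq subsetI)
  then have "compactin (mtop M) {q \<in> U. \<phi> q \<in> K}" by (simp add: compactin_subtopology)
  then show ?thesis using M compactin_imp_closedin unfolding charted_def by blast
qed

lemma smooth_fun_chart: "f \<in> smooth_fun M \<Longrightarrow> smooth_on (\<phi> ` U) (\<lambda>x. f (inv_into U \<phi> x))"
  using chart by (auto simp: smooth_fun_def o_def)

lemma chart_transition:
  "(V, \<psi>) \<in> atlas M \<Longrightarrow> smooth_on (\<psi> ` (V \<inter> U)) (\<lambda>x. \<phi> (inv_into V \<psi> x))"
proof -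
  assume "(V, \<psi>) \<in> atlas M"
  then have "smooth_on (\<psi> ` (V \<inter> U)) (\<phi> \<circ> inv_into V \<psi>)"
    using M chart unfolding charted_def by fast
  then show ?thesis by (simp add: o_def)
qed

end

lemma smooth_funI:
  "(\<And>U \<phi>. (U, \<phi>) \<in> atlas M \<Longrightarrow> smooth_on (\<phi> ` U) (\<lambda>x. f (inv_into U \<phi> x))) \<Longrightarrow> f \<in> smooth_fun M"
  by (auto simp: smooth_fun_def o_def)

section \<open>Local character of smoothness, and cutoff functions\<close>

lemma smooth_fun_local:
  assumes M: "charted M"
    and loc: "\<And>p. p \<in> points M \<Longrightarrow> \<exists>W g. openin (mtop M) W \<and> p \<in> W \<and> g \<in> smooth_fun M \<and> (\<forall>q\<in>W. f q = g q)"
  shows "f \<in> smooth_fun M"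
proof (rule smooth_funI, rule smooth_on_local)
  fix U \<phi> x assume c: "(U, \<phi>) \<in> atlas M" and x: "x \<in> \<phi> ` U"
  then obtain p where p: "p \<in> U" "x = \<phi> p" by auto
  then obtain W g where W: "openin (mtop M) W" "p \<in> W" "g \<in> smooth_fun M" "\<forall>q\<in>W. f q = g q"
    using loc chart_subset[OF M c] by blast
  have o: "open (\<phi> ` (U \<inter> W))"
    using chart_open_image[OF M c] chart_openin[OF M c] W(1) by (simp add: openin_Int)
  have "smooth_on (\<phi> ` (U \<inter> W)) (\<lambda>x. f (inv_into U \<phi> x))"
  proof (rule smooth_on_cong[OF o])
    show "smooth_on (\<phi> ` (U \<inter> W)) (\<lambda>x. g (inv_into U \<phi> x))"
      by (rule smooth_on_subset[OF smooth_fun_chart[OF M c W(3)]]) auto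
    show "g (inv_into U \<phi> y) = f (inv_into U \<phi> y)" if "y \<in> \<phi> ` (U \<inter> W)" for y
      using that chart_inv[OF M c] W(4) by auto
  qed
  then show "\<exists>T. open T \<and> x \<in> T \<and> smooth_on T (\<lambda>x. f (inv_into U \<phi> x))"
    using o p W(2) by blast
qed

lemma smooth_fun_cong:
  assumes "charted M" "f \<in> smooth_fun M" "\<And>q. q \<in> points M \<Longrightarrow> f q = g q"
  shows "g \<in> smooth_fun M"
proof (rule smooth_fun_local[OF assms(1)])
  show "\<exists>W h. openin (mtop M) W \<and> p \<in> W \<and> h \<in> smooth_fun M \<and> (\<forall>q\<in>W. g q = h q)" if "p \<in> points M" for p
    using that assms(2,3) by (intro exI[of _ "points M"] exI[of _ f]) auto
qed

context
  fixes M :: "('a, 'e::{real_inner,heine_borel}) manifold"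
  assumes M: "charted M"
begin

lemma smooth_fun_const: "(\<lambda>x. k) \<in> smooth_fun M"
  by (intro smooth_funI smooth_on_const)

lemma smooth_fun_add: "f \<in> smooth_fun M \<Longrightarrow> g \<in> smooth_fun M \<Longrightarrow> (\<lambda>x. f x + g x) \<in> smooth_fun M"
  by (rule smooth_funI) (simp add: smooth_on_add chart_open_range[OF M] smooth_fun_chart[OF M])

lemma smooth_fun_mult: "f \<in> smooth_fun M \<Longrightarrow> g \<in> smooth_fun M \<Longrightarrow> (\<lambda>x. f x * g x) \<in> smooth_fun M"
  by (rule smooth_funI) (simp add: smooth_on_mult chart_open_range[OF M] smooth_fun_chart[OF M])

lemma smooth_fun_diff: "f \<in> smooth_fun M \<Longrightarrow> g \<in> smooth_fun M \<Longrightarrow> (\<lambda>x. f x - g x) \<in> smooth_fun M"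
  by (rule smooth_funI) (simp add: smooth_on_diff chart_open_range[OF M] smooth_fun_chart[OF M])

lemma smooth_fun_on_self: "smooth_fun_on M (points M) = smooth_fun M"
proof
  show "smooth_fun_on M (points M) \<subseteq> smooth_fun M"
  proof
    fix f assume f: "f \<in> smooth_fun_on M (points M)"
    show "f \<in> smooth_fun M"
    proof (rule smooth_fun_local[OF M])
      fix p assume "p \<in> points M"
      then obtain W g where W: "openin (mtop M) W" "p \<in> W" "g \<in> smooth_fun M" "\<forall>q\<in>points M \<inter> W. f q = g q"
        using f unfolding smooth_fun_on_def by blast
      then show "\<exists>W g. openin (mtop M) W \<and> p \<in> W \<and> g \<in> smooth_fun M \<and> (\<forall>q\<in>W. f q = g q)"
        using openin_subset by blast
    qed
  qed
  show "smooth_fun M \<subseteq> smooth_fun_on M (points M)"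
    unfolding smooth_fun_on_def by blast
qed

end

lemma smooth_fun_onI_restrict:
  assumes S: "S \<subseteq> points M" and f: "f \<in> smooth_fun M" and eq: "\<And>q. q \<in> S \<Longrightarrow> g q = f q"
  shows "g \<in> smooth_fun_on M S"
proof -
  have "\<exists>W h. openin (mtop M) W \<and> p \<in> W \<and> h \<in> smooth_fun M \<and> (\<forall>q\<in>S \<inter> W. g q = h q)" if "p \<in> S" for p
    using that S f eq by (intro exI[of _ "points M"] exI[of _ f]) auto
  then show ?thesis by (simp add: smooth_fun_on_def)
qed

lemma smooth_fun_on_binary:
  assumes op: "\<And>f g. f \<in> smooth_fun M \<Longrightarrow> g \<in> smooth_fun M \<Longrightarrow> (\<lambda>x. b (f x) (g x)) \<in> smooth_fun M"
    and f: "f \<in> smooth_fun_on M S" and g: "g \<in> smooth_fun_on M S"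
  shows "(\<lambda>x. b (f x) (g x)) \<in> smooth_fun_on M S"
  unfolding smooth_fun_on_def
proof (intro CollectI ballI)
  fix p assume p: "p \<in> S"
  obtain W f' where W: "openin (mtop M) W" "p \<in> W" "f' \<in> smooth_fun M" "\<forall>q\<in>S \<inter> W. f q = f' q"
    using f p unfolding smooth_fun_on_def by blast
  obtain V g' where V: "openin (mtop M) V" "p \<in> V" "g' \<in> smooth_fun M" "\<forall>q\<in>S \<inter> V. g q = g' q"
    using g p unfolding smooth_fun_on_def by blast
  show "\<exists>W h. openin (mtop M) W \<and> p \<in> W \<and> h \<in> smooth_fun M \<and> (\<forall>q\<in>S \<inter> W. b (f q) (g q) = h q)"
    using W V op by (intro exI[of _ "W \<inter> V"] exI[of _ "\<lambda>x. b (f' x) (g' x)"]) auto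
qed

text \<open>The open set \<open>W\<close> and the complement of the closed set \<open>K\<close>
  cover the manifold: on the first a change of charts is applied to \<open>f\<close>, on the second
  \<open>F\<close> is 0.\<close>

lemma smooth_fun_extend_by_zero:
  fixes M :: "('a, 'e::{real_inner,heine_borel}) manifold"
  assumes M: "charted M" and c: "(U, \<phi>) \<in> atlas M" and W: "openin (mtop M) W" "W \<subseteq> U"
    and K: "closedin (mtop M) K" "K \<subseteq> W" and f: "smooth_on (\<phi> ` W) f"
    and F: "\<And>q. q \<in> W \<Longrightarrow> F q = f (\<phi> q)" "\<And>q. q \<in> points M \<Longrightarrow> q \<notin> K \<Longrightarrow> F q = 0"
  shows "F \<in> smooth_fun M"
proof (rule smooth_funI, rule smooth_on_local)
  obtain B :: "'e set" where B: "frame B" using M unfolding charted_def by blast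
  fix V \<psi> x assume d: "(V, \<psi>) \<in> atlas M" and x: "x \<in> \<psi> ` V"
  then obtain p where p: "p \<in> V" "x = \<psi> p" by auto
  show "\<exists>T. open T \<and> x \<in> T \<and> smooth_on T (\<lambda>x. F (inv_into V \<psi> x))"
  proof (cases "p \<in> W")
    case True
    have o: "open (\<psi> ` (V \<inter> W))"
      using chart_open_image[OF M d] chart_openin[OF M d] W(1) by (simp add: openin_Int)
    have "smooth_on (\<psi> ` (V \<inter> W)) (\<lambda>x. f (\<phi> (inv_into V \<psi> x)))"
    proof (rule smooth_on_compose[OF B o f])
      show "smooth_on (\<psi> ` (V \<inter> W)) (\<lambda>x. \<phi> (inv_into V \<psi> x))"
        by (rule smooth_on_subset[OF chart_transition[OF M c d]]) (use W in auto)
    qed (use chart_inv[OF M d] in auto)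
    then have "smooth_on (\<psi> ` (V \<inter> W)) (\<lambda>x. F (inv_into V \<psi> x))"
      by (rule smooth_on_cong[OF o, rotated]) (use chart_inv[OF M d] F in auto)
    then show ?thesis using o p True by blast
  next
    case False
    have o: "open (\<psi> ` (V - K))"
      using chart_open_image[OF M d] chart_openin[OF M d] K(1) by (simp add: openin_diff)
    have "smooth_on (\<psi> ` (V - K)) (\<lambda>x. F (inv_into V \<psi> x))"
      by (rule smooth_on_cong[OF o _ smooth_on_const[of _ 0]])
        (use chart_inv[OF M d] chart_subset[OF M d] F in auto)
    then show ?thesis using o p False K(2) by blast
  qed
qed

text \<open>The bump function of a ball inside the image of \<open>W\<close>, pulled back to the
  manifold. One cutoff serves all functions \<open>f\<close>, so a whole family of local functions
  can be made global while being preserved on the same neighbourhood \<open>W'\<close>.\<close>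

lemma chart_cutoff:
  fixes M :: "('a, 'e::{real_inner,heine_borel}) manifold"
  assumes M: "charted M" and c: "(U, \<phi>) \<in> atlas M" and W: "openin (mtop M) W" "W \<subseteq> U" and p: "p \<in> W"
  obtains \<theta> W' where "openin (mtop M) W'" "p \<in> W'" "W' \<subseteq> W"
    "\<And>q. q \<in> W' \<Longrightarrow> \<theta> q = 1" "\<And>q. q \<notin> W \<Longrightarrow> \<theta> q = 0"
    "\<And>f. smooth_on (\<phi> ` W) f \<Longrightarrow> (\<lambda>q. if q \<in> W then \<theta> q * f (\<phi> q) else 0) \<in> smooth_fun M"
proof -
  obtain B :: "'e set" where B: "frame B" using M unfolding charted_def by blast
  have o: "open (\<phi> ` W)" using chart_open_image[OF M c W] .
  then obtain R where R: "R > 0" "cball (\<phi> p) R \<subseteq> \<phi> ` W"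
    using p open_contains_cball by blast
  obtain b :: "'e \<Rightarrow> real" where b: "smooth_on UNIV b" "\<And>x. dist (\<phi> p) x \<le> R / 2 \<Longrightarrow> b x = 1"
    "\<And>x. dist (\<phi> p) x \<ge> R \<Longrightarrow> b x = 0"
    using smooth_bump[OF B R(1), of "\<phi> p"] by blast
  define \<theta> where "\<theta> q = (if q \<in> W then b (\<phi> q) else 0)" for q
  define K where "K = {q \<in> U. \<phi> q \<in> cball (\<phi> p) R}"
  define W' where "W' = {q \<in> U. \<phi> q \<in> ball (\<phi> p) (R / 2)}"
  have inW: "q \<in> W" if q: "q \<in> U" "\<phi> q \<in> cball (\<phi> p) R" for q
  proof -
    obtain q' where "q' \<in> W" "\<phi> q = \<phi> q'" using q R(2) by blast
    then show ?thesis using chart_inj[OF M c] q(1) W(2) by (metis inj_onD subsetD)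
  qed
  have K: "closedin (mtop M) K" "K \<subseteq> W"
    using chart_closedin_preimage[OF M c compact_cball, of "\<phi> p" R] R(2) W(2) inW by (auto simp: K_def)
  show ?thesis
  proof
    show "openin (mtop M) W'" unfolding W'_def by (rule chart_openin_preimage[OF M c open_ball])
    show "p \<in> W'" using p W R(1) by (auto simp: W'_def)
    show W'W: "W' \<subseteq> W" using inW R(1) by (auto simp: W'_def)
    show "\<theta> q = 1" if "q \<in> W'" for q
      using that W'W b(2)[of "\<phi> q"] by (auto simp: \<theta>_def W'_def)
    show "\<theta> q = 0" if "q \<notin> W" for q using that by (simp add: \<theta>_def)
    fix f :: "'e \<Rightarrow> real" assume f: "smooth_on (\<phi> ` W) f"
    have bf: "smooth_on (\<phi> ` W) (\<lambda>x. b x * f x)"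
      by (rule smooth_on_mult[OF o smooth_on_subset[OF b(1)] f]) simp
    show "(\<lambda>q. if q \<in> W then \<theta> q * f (\<phi> q) else 0) \<in> smooth_fun M"
    proof (rule smooth_fun_extend_by_zero[OF M c W K bf])
      show "(if q \<in> W then \<theta> q * f (\<phi> q) else 0) = 0" if "q \<notin> K" for q
        using that b(3)[of "\<phi> q"] W(2) by (auto simp: \<theta>_def K_def)
    qed (simp add: \<theta>_def)
  qed
qed

lemma chart_coordinates:
  fixes M :: "('a, 'e::{real_inner,heine_borel}) manifold"
  assumes M: "charted M" and c: "(U, \<phi>) \<in> atlas M" and p: "p \<in> U"
  obtains X W where "openin (mtop M) W" "p \<in> W" "W \<subseteq> U"
    "\<And>b::'e. X b \<in> smooth_fun M" "\<And>b q. q \<in> W \<Longrightarrow> X b q = \<phi> q \<bullet> b"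
proof (rule chart_cutoff[OF M c chart_openin[OF M c] subset_refl p])
  fix \<theta> W
  assume \<theta>: "openin (mtop M) W" "p \<in> W" "W \<subseteq> U" "\<And>q. q \<in> W \<Longrightarrow> \<theta> q = 1"
    and s: "\<And>f. smooth_on (\<phi> ` U) f \<Longrightarrow> (\<lambda>q. if q \<in> U then \<theta> q * f (\<phi> q) else 0) \<in> smooth_fun M"
  show thesis
  proof (rule that[OF \<theta>(1-3)])
    show "(\<lambda>q. if q \<in> U then \<theta> q * (\<phi> q \<bullet> b) else 0) \<in> smooth_fun M" for b
      by (rule s[OF smooth_on_linear[OF bounded_linear_inner_left chart_open_range[OF M c]]])
  qed (use \<theta>(3,4) in auto)
qed

lemma manifold_cutoff:
  assumes M: "charted M" and W: "openin (mtop M) W" and p: "p \<in> W"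
  obtains \<theta> where "\<theta> \<in> smooth_fun M" "\<theta> p = 1" "\<And>q. q \<notin> W \<Longrightarrow> \<theta> q = 0"
proof -
  obtain U \<phi> where c: "(U, \<phi>) \<in> atlas M" "p \<in> U"
    using chart_exists[OF M] W p openin_subset by (metis subsetD)
  have o: "openin (mtop M) (W \<inter> U)" using W chart_openin[OF M c(1)] by (simp add: openin_Int)
  show ?thesis
  proof (rule chart_cutoff[OF M c(1) o])
    show "W \<inter> U \<subseteq> U" "p \<in> W \<inter> U" using p c(2) by auto
    fix W' \<theta>
    assume \<theta>: "openin (mtop M) W'" "p \<in> W'" "W' \<subseteq> W \<inter> U"
      "\<And>q. q \<in> W' \<Longrightarrow> \<theta> q = 1" "\<And>q. q \<notin> W \<inter> U \<Longrightarrow> \<theta> q = 0"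
      "\<And>f. smooth_on (\<phi> ` (W \<inter> U)) f \<Longrightarrow> (\<lambda>q. if q \<in> W \<inter> U then \<theta> q * f (\<phi> q) else 0) \<in> smooth_fun M"
    have "(\<lambda>q. if q \<in> W \<inter> U then \<theta> q * 1 else 0) \<in> smooth_fun M"
      by (rule \<theta>(6)) (rule smooth_on_const)
    moreover have "(\<lambda>q. if q \<in> W \<inter> U then \<theta> q * 1 else 0) = \<theta>" using \<theta>(5) by auto
    ultimately show ?thesis using \<theta> by (intro that[of \<theta>]) auto
  qed
qed

subsection \<open>Derivations are local\<close>

lemma dualD:
  assumes "v \<in> dual V"
  shows "f \<in> V \<Longrightarrow> g \<in> V \<Longrightarrow> v (f + g) = v f + v g" "f \<in> V \<Longrightarrow> v (k *\<^sub>R f) = k * v f" "f \<notin> V \<Longrightarrow> v f = 0"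
  using assms by (auto simp: dual_def linear_on_def)

lemma dual_pointwise:
  fixes v :: "('a \<Rightarrow> real) \<Rightarrow> real"
  assumes "v \<in> dual V"
  shows "f \<in> V \<Longrightarrow> g \<in> V \<Longrightarrow> v (\<lambda>x. f x + g x) = v f + v g" "f \<in> V \<Longrightarrow> v (\<lambda>x. k * f x) = k * v f"
  using dualD(1,2)[OF assms, of f] by (simp_all add: plus_fun_def scaleR_fun_def)

lemma on_space_simps [simp]: "x \<in> V \<Longrightarrow> on_space V f x = f x" "x \<notin> V \<Longrightarrow> on_space V f x = 0"
  by (auto simp: on_space_def)

lemma on_space_dual:
  assumes "\<And>f g. f \<in> V \<Longrightarrow> g \<in> V \<Longrightarrow> f + g \<in> V \<and> v (f + g) = v f + v g"
    and "\<And>k f. f \<in> V \<Longrightarrow> k *\<^sub>R f \<in> V \<and> v (k *\<^sub>R f) = k * v f"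
  shows "on_space V v \<in> dual V"
  using assms by (auto simp: dual_def linear_on_def)

lemma dual_eqI: "a \<in> dual V \<Longrightarrow> b \<in> dual V \<Longrightarrow> (\<And>v. v \<in> V \<Longrightarrow> a v = b v) \<Longrightarrow> a = b"
  by (rule ext) (metis dualD(3))

lemma derivations_product:
  "v \<in> derivations C p \<Longrightarrow> f \<in> C \<Longrightarrow> g \<in> C \<Longrightarrow> v (\<lambda>x. f x * g x) = f p * v g + g p * v f"
  by (simp add: derivations_def)

lemma derivations_dual: "v \<in> derivations C p \<Longrightarrow> v \<in> dual C"
  by (simp add: derivations_def)

context
  fixes M :: "('a, 'e::{real_inner,heine_borel}) manifold"
  assumes M: "charted M"
begin

lemma smooth_fun_on_add:
  "f \<in> smooth_fun_on M T \<Longrightarrow> g \<in> smooth_fun_on M T \<Longrightarrow> (\<lambda>x. f x + g x) \<in> smooth_fun_on M T"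
  by (rule smooth_fun_on_binary) (rule smooth_fun_add[OF M])

lemma smooth_fun_on_mult:
  "f \<in> smooth_fun_on M T \<Longrightarrow> g \<in> smooth_fun_on M T \<Longrightarrow> (\<lambda>x. f x * g x) \<in> smooth_fun_on M T"
  by (rule smooth_fun_on_binary) (rule smooth_fun_mult[OF M])

lemma smooth_fun_on_diff:
  "f \<in> smooth_fun_on M T \<Longrightarrow> g \<in> smooth_fun_on M T \<Longrightarrow> (\<lambda>x. f x - g x) \<in> smooth_fun_on M T"
  by (rule smooth_fun_on_binary) (rule smooth_fun_diff[OF M])


end

context
  fixes M :: "('a, 'e::{real_inner,heine_borel}) manifold" and S p v
  assumes M: "charted M" and S: "S \<subseteq> points M" and p: "p \<in> S"
    and v: "v \<in> derivations (smooth_fun_on M S) p"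
begin

lemma derivation_vanishing:
  assumes u: "u \<in> smooth_fun_on M S" and z: "\<And>q. q \<in> S \<Longrightarrow> u q = 0"
  shows "v u = 0"
proof -
  \<comment> \<open>\<open>u\<close> may be nonzero off \<open>S\<close>, where it is multiplied by 1.\<close>
  define e where "e q = (if q \<in> S then 0 else 1 :: real)" for q
  have e: "e \<in> smooth_fun_on M S"
    by (rule smooth_fun_onI_restrict[OF S smooth_fun_const[OF M, of 0]]) (simp add: e_def)
  have "u = (\<lambda>x. u x * e x)" using z by (auto simp: e_def)
  then have "v u = v (\<lambda>x. u x * e x)" by simp
  also have "\<dots> = 0"
    using derivations_product[OF v u e] p z by (simp add: e_def)
  finally show ?thesis .
qed

text \<open>A cutoff times \<open>f - g\<close> vanishes on \<open>S\<close>. The Leibniz rule at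
  \<open>p\<close>, where the cutoff is 1 and \<open>f - g\<close> is 0, then yields the value on
  \<open>f - g\<close>.\<close>

lemma derivation_local:
  assumes f: "f \<in> smooth_fun_on M S" and g: "g \<in> smooth_fun_on M S"
    and W: "openin (mtop M) W" "p \<in> W" and eq: "\<And>q. q \<in> S \<Longrightarrow> q \<in> W \<Longrightarrow> f q = g q"
  shows "v f = v g"
proof -
  obtain \<theta> where \<theta>: "\<theta> \<in> smooth_fun M" "\<theta> p = 1" "\<And>q. q \<notin> W \<Longrightarrow> \<theta> q = 0"
    by (rule manifold_cutoff[OF M W]) blast
  have \<theta>S: "\<theta> \<in> smooth_fun_on M S" by (rule smooth_fun_onI_restrict[OF S \<theta>(1)]) simp
  have d: "(\<lambda>x. f x - g x) \<in> smooth_fun_on M S" by (rule smooth_fun_on_diff[OF M f g])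
  have "v (\<lambda>x. \<theta> x * (f x - g x)) = 0"
    by (rule derivation_vanishing[OF smooth_fun_on_mult[OF M \<theta>S d]]) (use eq \<theta>(3) in auto)
  then have "v (\<lambda>x. f x - g x) = 0"
    using derivations_product[OF v \<theta>S d] \<theta>(2) p W(2) eq by simp
  moreover have "v f = v (\<lambda>x. (f x - g x) + g x)" by simp
  ultimately show ?thesis
    unfolding dual_pointwise(1)[OF derivations_dual[OF v] d g] by simp
qed

end

lemma tangent_space_eq: "charted M \<Longrightarrow> tangent_space M p = derivations (smooth_fun_on M (points M)) p"
  by (simp add: tangent_space_def smooth_fun_on_self)

context
  fixes M :: "('a, 'e::{real_inner,heine_borel}) manifold" and p v
  assumes M: "charted M" and p: "p \<in> points M" and v: "v \<in> tangent_space M p"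
begin

lemma tangent_dual: "v \<in> dual (smooth_fun M)"
  using v by (simp add: tangent_space_def derivations_dual)

lemma tangent_off: "f \<notin> smooth_fun M \<Longrightarrow> v f = 0"
  using dualD(3)[OF tangent_dual] .

lemma tangent_add: "f \<in> smooth_fun M \<Longrightarrow> g \<in> smooth_fun M \<Longrightarrow> v (\<lambda>x. f x + g x) = v f + v g"
  using dual_pointwise(1)[OF tangent_dual] .

lemma tangent_scale: "f \<in> smooth_fun M \<Longrightarrow> v (\<lambda>x. k * f x) = k * v f"
  using dual_pointwise(2)[OF tangent_dual] .

lemma tangent_product:
  "f \<in> smooth_fun M \<Longrightarrow> g \<in> smooth_fun M \<Longrightarrow> v (\<lambda>x. f x * g x) = f p * v g + g p * v f"
  using v by (simp add: tangent_space_def derivations_def)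

lemma tangent_local:
  assumes "f \<in> smooth_fun M" "g \<in> smooth_fun M" "openin (mtop M) W" "p \<in> W" "\<And>q. q \<in> W \<Longrightarrow> f q = g q"
  shows "v f = v g"
  using derivation_local[OF M subset_refl p] v assms
  unfolding tangent_space_eq[OF M] smooth_fun_on_self[OF M] by blast

text \<open>Smoothness is unaffected by values off the manifold, and functions that are not smooth
  are sent to 0. Hence rewriting under a tangent vector can be done before smoothness is
  established.\<close>

lemma tangent_cong:
  assumes "\<And>q. q \<in> points M \<Longrightarrow> f q = g q" shows "v f = v g"
proof (cases "f \<in> smooth_fun M")
  case True
  then show ?thesis
    using smooth_fun_cong[OF M True assms] p assms tangent_local[of f g "points M"] by blast
next
  case False
  then have "g \<notin> smooth_fun M" using smooth_fun_cong[OF M, of g f] assms by auto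
  then show ?thesis using False by (simp add: tangent_off)
qed

lemma tangent_const: "v (\<lambda>x. k) = 0"
proof -
  have "v (\<lambda>x. 1 * 1) = 1 * v (\<lambda>x. 1) + 1 * v (\<lambda>x. 1)"
    by (rule tangent_product) (rule smooth_fun_const[OF M])+
  then have "v (\<lambda>x. 1) = 0" by simp
  then show ?thesis using tangent_scale[OF smooth_fun_const[OF M], of k 1] by simp
qed

lemma tangent_sum:
  assumes "finite I" "\<And>i. i \<in> I \<Longrightarrow> f i \<in> smooth_fun M"
  shows "v (\<lambda>x. \<Sum>i\<in>I. f i x) = (\<Sum>i\<in>I. v (f i)) \<and> (\<lambda>x. \<Sum>i\<in>I. f i x) \<in> smooth_fun M"
  using assms
proof (induction I)
  case empty
  then show ?case by (simp add: tangent_const smooth_fun_const[OF M])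
next
  case (insert i I)
  have i: "f i \<in> smooth_fun M" and I: "v (\<lambda>x. \<Sum>i\<in>I. f i x) = (\<Sum>i\<in>I. v (f i))"
    "(\<lambda>x. \<Sum>i\<in>I. f i x) \<in> smooth_fun M"
    using insert by blast+
  show ?case
    using tangent_add[OF i I(2)] smooth_fun_add[OF M i I(2)] I(1) insert.hyps by simp
qed

end

text \<open>Records bring their own operations named \<open>extend\<close>; with these hidden, the
  name stands for the extension of a tangent vector to a vector field.\<close>

hide_const (open) manifold.extend groupoid.extend lie_groupoid.extend
hide_fact (open) manifold.extend_def groupoid.extend_def lie_groupoid.extend_def

subsection \<open>Tangent vectors in a chart\<close>

definition chart_vec ::
    "('a, 'e::real_normed_vector) manifold \<Rightarrow> 'a set \<Rightarrow> ('a \<Rightarrow> 'e) \<Rightarrow> 'a \<Rightarrow> 'e \<Rightarrow> 'a tvec" where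
  "chart_vec M U \<phi> p e =
     on_space (smooth_fun M) (\<lambda>f. dirderiv (\<lambda>x. f (inv_into U \<phi> x)) e (\<phi> p))"

lemma dual_pointwiseI:
  fixes v :: "('a \<Rightarrow> real) \<Rightarrow> real"
  assumes "\<And>f g. f \<in> C \<Longrightarrow> g \<in> C \<Longrightarrow> v (\<lambda>x. f x + g x) = v f + v g"
    and "\<And>k f. f \<in> C \<Longrightarrow> v (\<lambda>x. k * f x) = k * v f" and "\<And>f. f \<notin> C \<Longrightarrow> v f = 0"
  shows "v \<in> dual C"
  using assms unfolding dual_def linear_on_def plus_fun_def scaleR_fun_def by simp

lemma tangent_space_zero: "charted M \<Longrightarrow> 0 \<in> tangent_space M p"
  by (simp add: tangent_space_def derivations_def dual_def linear_on_def)

lemma tangent_space_scaleR: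
  assumes "v \<in> tangent_space M p" shows "k *\<^sub>R v \<in> tangent_space M p"
  using assms
  by (auto simp: tangent_space_def derivations_def dual_def linear_on_def scaleR_fun_def algebra_simps)

context
  fixes M :: "('a, 'e::{real_inner,heine_borel}) manifold" and U \<phi> p
  assumes M: "charted M" and c: "(U, \<phi>) \<in> atlas M" and p: "p \<in> U"
begin

lemma chart_rep_has_derivative:
  assumes "f \<in> smooth_fun M"
  shows "((\<lambda>x. f (inv_into U \<phi> x)) has_derivative (\<lambda>e. chart_vec M U \<phi> p e f)) (at (\<phi> p))"
  using smooth_on_has_derivative[OF smooth_fun_chart[OF M c assms], of "\<phi> p"] p assms
  by (simp add: chart_vec_def)

lemma chart_vec_eqI:
  assumes "f \<in> smooth_fun M" "((\<lambda>x. f (inv_into U \<phi> x)) has_derivative f') (at (\<phi> p))"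
  shows "chart_vec M U \<phi> p e f = f' e"
  using has_derivative_unique[OF chart_rep_has_derivative[OF assms(1)] assms(2)] by metis

lemma chart_vec_tangent: "chart_vec M U \<phi> p e \<in> tangent_space M p"
proof -
  let ?v = "chart_vec M U \<phi> p e"
  have rp: "inv_into U \<phi> (\<phi> p) = p" by (rule chart_inv[OF M c p])
  have add: "?v (\<lambda>x. f x + g x) = ?v f + ?v g" if "f \<in> smooth_fun M" "g \<in> smooth_fun M" for f g
    by (rule chart_vec_eqI[OF smooth_fun_add[OF M that]
          has_derivative_add[OF chart_rep_has_derivative[OF that(1)] chart_rep_has_derivative[OF that(2)]]])
  have mult: "?v (\<lambda>x. f x * g x) = f p * ?v g + g p * ?v f"
    if "f \<in> smooth_fun M" "g \<in> smooth_fun M" for f g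
    using chart_vec_eqI[OF smooth_fun_mult[OF M that]
          has_derivative_mult[OF chart_rep_has_derivative[OF that(1)] chart_rep_has_derivative[OF that(2)]]]
    by (simp add: rp mult.commute)
  have scale: "?v (\<lambda>x. k * f x) = k * ?v f" if f: "f \<in> smooth_fun M" for k f
  proof -
    have s: "(\<lambda>x. k * f x) \<in> smooth_fun M" by (rule smooth_fun_mult[OF M smooth_fun_const[OF M] f])
    show ?thesis
      using chart_vec_eqI[OF s has_derivative_mult_right[OF chart_rep_has_derivative[OF f]]] by simp
  qed
  have "?v \<in> dual (smooth_fun M)"
    by (rule dual_pointwiseI) (use add scale in \<open>auto simp: chart_vec_def\<close>)
  then show ?thesis using mult by (simp add: tangent_space_def derivations_def)
qed

text \<open>By Hadamard's lemma, \<open>f\<close> is near \<open>p\<close> the constant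
  \<open>f p\<close> plus products of coordinates vanishing at \<open>p\<close> with smooth
  functions; the Leibniz rule leaves only the values of \<open>v\<close> on the coordinates. Both
  factors are made global by cutoffs, which locality of \<open>v\<close> permits.\<close>

lemma tangent_chart_vec:
  assumes v: "v \<in> tangent_space M p"
  obtains e where "v = chart_vec M U \<phi> p e"
proof -
  have pM: "p \<in> points M" using p chart_subset[OF M c] by blast
  obtain B :: "'e set" where B: "frame B" using M unfolding charted_def by blast
  have fin: "finite B" by (rule frame_finite[OF B])
  obtain Y W' where W': "openin (mtop M) W'" "p \<in> W'" "W' \<subseteq> U"
    and Ys: "\<And>b. Y b \<in> smooth_fun M" and Y: "\<And>b q. q \<in> W' \<Longrightarrow> Y b q = \<phi> q \<bullet> b"
    by (rule chart_coordinates[OF M c p]) blast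
  define X where "X b q = Y b q - \<phi> p \<bullet> b" for b q
  have Xs: "X b \<in> smooth_fun M" for b
    unfolding X_def by (rule smooth_fun_diff[OF M Ys smooth_fun_const[OF M]])
  \<comment> \<open>The components of \<open>v\<close> are its values on the coordinate functions
    centred at \<open>p\<close>.\<close>
  define e where "e = (\<Sum>b\<in>B. v (X b) *\<^sub>R b)"
  have "v f = chart_vec M U \<phi> p e f" if f: "f \<in> smooth_fun M" for f
  proof -
    let ?f = "\<lambda>x. f (inv_into U \<phi> x)"
    obtain R where R: "R > 0" "ball (\<phi> p) R \<subseteq> \<phi> ` U"
      using chart_open_range[OF M c] p open_contains_ball by blast
    obtain g where g: "\<And>b. smooth_on (ball (\<phi> p) R) (g b)" "\<And>b. g b (\<phi> p) = dirderiv ?f b (\<phi> p)"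
      "\<And>x. x \<in> ball (\<phi> p) R \<Longrightarrow> ?f x = ?f (\<phi> p) + (\<Sum>b\<in>B. ((x - \<phi> p) \<bullet> b) * g b x)"
      by (rule hadamard[OF B smooth_on_subset[OF smooth_fun_chart[OF M c f] R(2)] R(1)]) blast
    define V where "V = {q \<in> U. \<phi> q \<in> ball (\<phi> p) R}"
    have V: "openin (mtop M) V" "V \<subseteq> U" "p \<in> V" "\<phi> ` V \<subseteq> ball (\<phi> p) R"
      using chart_openin_preimage[OF M c open_ball] p R(1) by (auto simp: V_def)
    obtain \<eta> V' where \<eta>: "openin (mtop M) V'" "p \<in> V'" "V' \<subseteq> V" "\<And>q. q \<in> V' \<Longrightarrow> \<eta> q = 1"
      and \<eta>s: "\<And>f. smooth_on (\<phi> ` V) f \<Longrightarrow> (\<lambda>q. if q \<in> V then \<eta> q * f (\<phi> q) else 0) \<in> smooth_fun M"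
      by (rule chart_cutoff[OF M c V(1,2,3)]) blast
    define G where "G b q = (if q \<in> V then \<eta> q * g b (\<phi> q) else 0)" for b q
    have Gs: "G b \<in> smooth_fun M" for b
      unfolding G_def by (rule \<eta>s) (rule smooth_on_subset[OF g(1) V(4)])
    have XGs: "(\<lambda>q. X b q * G b q) \<in> smooth_fun M" for b by (rule smooth_fun_mult[OF M Xs Gs])
    note sum = tangent_sum[OF M pM v fin XGs]
    have const: "(\<lambda>q. f p) \<in> smooth_fun M" by (rule smooth_fun_const[OF M])
    have "v f = v (\<lambda>q. f p + (\<Sum>b\<in>B. X b q * G b q))"
    proof (rule tangent_local[OF M pM v f _ openin_Int[OF W'(1) \<eta>(1)]])
      show "(\<lambda>q. f p + (\<Sum>b\<in>B. X b q * G b q)) \<in> smooth_fun M"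
        by (rule smooth_fun_add[OF M const conjunct2[OF sum]])
      show "p \<in> W' \<inter> V'" using W'(2) \<eta>(2) by simp
      fix q assume q: "q \<in> W' \<inter> V'"
      then have qV: "q \<in> V" "q \<in> U" using \<eta>(3) V(2) by auto
      have "f q = f p + (\<Sum>b\<in>B. ((\<phi> q - \<phi> p) \<bullet> b) * g b (\<phi> q))"
        using g(3)[of "\<phi> q"] V(4) qV chart_inv[OF M c] p by auto
      moreover have "X b q = (\<phi> q - \<phi> p) \<bullet> b" "G b q = g b (\<phi> q)" for b
        using q qV Y \<eta>(4) by (auto simp: X_def G_def inner_diff_left)
      ultimately show "f q = f p + (\<Sum>b\<in>B. X b q * G b q)" by simp
    qed
    also have "\<dots> = (\<Sum>b\<in>B. v (\<lambda>q. X b q * G b q))"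
      using tangent_add[OF M pM v const conjunct2[OF sum]] tangent_const[OF M pM v] sum by simp
    also have "\<dots> = (\<Sum>b\<in>B. v (X b) * dirderiv ?f b (\<phi> p))"
    proof (rule sum.cong[OF refl])
      fix b
      have "X b p = 0" "G b p = dirderiv ?f b (\<phi> p)"
        using V(3) \<eta>(2,4) g(2) Y[OF W'(2)] by (auto simp: X_def G_def)
      then show "v (\<lambda>q. X b q * G b q) = v (X b) * dirderiv ?f b (\<phi> p)"
        using tangent_product[OF M pM v Xs Gs] by simp
    qed
    also have "\<dots> = dirderiv ?f e (\<phi> p)"
    proof -
      have "linear (frechet_derivative ?f (at (\<phi> p)))"
        using smooth_on_has_derivative[OF smooth_fun_chart[OF M c f]] p has_derivative_linear by blast
      then show ?thesis by (simp add: e_def linear_sum linear_scale)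
    qed
    finally show ?thesis using f by (simp add: chart_vec_def)
  qed
  moreover have "v f = chart_vec M U \<phi> p e f" if "f \<notin> smooth_fun M" for f
    using that tangent_off[OF M pM v] by (simp add: chart_vec_def)
  ultimately have "v = chart_vec M U \<phi> p e" by (metis ext)
  then show ?thesis by (rule that)
qed

end

text \<open>\<open>extend\<close> is a choice, so \<open>lie_deriv\<close> and
  \<open>ext_deriv\<close> can be evaluated only once some extension is known: the field with
  constant components in a chart, times a cutoff.\<close>

lemma vector_field_extension:
  assumes M: "charted M" and p: "p \<in> points M" and v: "v \<in> tangent_space M p"
  shows "vector_field M (extend M p v)" "extend M p v p = v"
proof -
  obtain U \<phi> where c: "(U, \<phi>) \<in> atlas M" "p \<in> U" using chart_exists[OF M p] .
  obtain e where e: "v = chart_vec M U \<phi> p e" by (rule tangent_chart_vec[OF M c v])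
  obtain \<theta> W' where \<theta>: "p \<in> W'" "\<And>q. q \<in> W' \<Longrightarrow> \<theta> q = 1"
    and \<theta>s: "\<And>f. smooth_on (\<phi> ` U) f \<Longrightarrow> (\<lambda>q. if q \<in> U then \<theta> q * f (\<phi> q) else 0) \<in> smooth_fun M"
    by (rule chart_cutoff[OF M c(1) chart_openin[OF M c(1)] subset_refl c(2)]) blast
  define X where "X q = (if q \<in> U then \<theta> q *\<^sub>R chart_vec M U \<phi> q e else 0)" for q
  have "vector_field M X"
    unfolding vector_field_def
  proof (intro conjI ballI)
    show "X q \<in> tangent_space M q" for q
      using tangent_space_zero[OF M] tangent_space_scaleR[OF chart_vec_tangent[OF M c(1)]]
      by (auto simp: X_def)
    fix f assume f: "f \<in> smooth_fun M"
    have "(\<lambda>q. if q \<in> U then \<theta> q * dirderiv (\<lambda>x. f (inv_into U \<phi> x)) e (\<phi> q) else 0) \<in> smooth_fun M"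
      by (rule \<theta>s[OF smooth_on_dirderiv[OF smooth_fun_chart[OF M c(1) f]]])
    moreover have "X q f = (if q \<in> U then \<theta> q * dirderiv (\<lambda>x. f (inv_into U \<phi> x)) e (\<phi> q) else 0)" for q
      using f by (simp add: X_def chart_vec_def scaleR_fun_def)
    ultimately show "(\<lambda>q. X q f) \<in> smooth_fun M" by simp
  qed
  moreover have "X p = v" using c(2) \<theta> by (simp add: X_def e)
  ultimately have "\<exists>X. vector_field M X \<and> X p = v" by blast
  from someI_ex[OF this] show "vector_field M (extend M p v)" "extend M p v p = v"
    by (simp_all add: extend_def)
qed

subsection \<open>Curves and their velocities\<close>

text \<open>A curve lives on the whole real line but is tested at 0 only, so one that is found near
  0 can be completed by a constant value.\<close>

definition diff_curve :: "('a, 'e::real_normed_vector) manifold \<Rightarrow> (real \<Rightarrow> 'a) \<Rightarrow> bool" where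
  "diff_curve M c \<longleftrightarrow> (\<forall>t. c t \<in> points M) \<and>
     (\<forall>f\<in>smooth_fun M. \<exists>D. ((\<lambda>t. f (c t)) has_real_derivative D) (at 0))"

text \<open>The class \<open>C\<close> is a parameter so that one curve has a velocity both in the
  manifold, with \<open>smooth_fun M\<close>, and in a subset containing it, with
  \<open>smooth_fun_on M S\<close>.\<close>

definition curve_vec :: "('a \<Rightarrow> real) set \<Rightarrow> (real \<Rightarrow> 'a) \<Rightarrow> 'a tvec" where
  "curve_vec C c = on_space C (\<lambda>f. deriv (\<lambda>t. f (c t)) 0)"

abbreviation velocity :: "('a, 'e::real_normed_vector) manifold \<Rightarrow> (real \<Rightarrow> 'a) \<Rightarrow> 'a tvec" where
  "velocity M \<equiv> curve_vec (smooth_fun M)"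

lemma curve_vec_eqI: "f \<in> C \<Longrightarrow> ((\<lambda>t. f (c t)) has_real_derivative D) (at 0) \<Longrightarrow> curve_vec C c f = D"
  by (simp add: curve_vec_def DERIV_imp_deriv)

context
  fixes M :: "('a, 'e::{real_inner,heine_borel}) manifold" and c
  assumes M: "charted M" and c: "diff_curve M c"
begin

lemma diff_curve_point: "c t \<in> points M"
  using c by (simp add: diff_curve_def)

lemma diff_curve_has_derivative:
  assumes "f \<in> smooth_fun M"
  shows "((\<lambda>t. f (c t)) has_real_derivative velocity M c f) (at 0)"
proof -
  obtain D where "((\<lambda>t. f (c t)) has_real_derivative D) (at 0)"
    using c assms unfolding diff_curve_def by blast
  then show ?thesis using curve_vec_eqI[OF assms] by metis
qed

text \<open>Continuity at 0 is extracted from smooth functions: a cutoff that vanishes off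
  \<open>W\<close> remains positive along the curve for small \<open>t\<close>.\<close>

lemma diff_curve_eventually:
  assumes W: "openin (mtop M) W" "c 0 \<in> W"
  shows "\<forall>\<^sub>F t in nhds 0. c t \<in> W"
proof -
  obtain \<theta> where \<theta>: "\<theta> \<in> smooth_fun M" "\<theta> (c 0) = 1" "\<And>q. q \<notin> W \<Longrightarrow> \<theta> q = 0"
    by (rule manifold_cutoff[OF M W]) blast
  have "isCont (\<lambda>t. \<theta> (c t)) 0"
    using DERIV_isCont[OF diff_curve_has_derivative[OF \<theta>(1)]] .
  then have "((\<lambda>t. \<theta> (c t)) \<longlongrightarrow> 1) (at 0)" using \<theta>(2) by (simp add: isCont_def)
  then have "\<forall>\<^sub>F t in at 0. 0 < \<theta> (c t)" by (rule order_tendstoD) simp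
  then have "\<forall>\<^sub>F t in at 0. c t \<in> W" by (rule eventually_mono) (use \<theta>(3) in force)
  then show ?thesis using W(2) by (simp add: eventually_nhds_conv_at)
qed

lemma diff_curve_has_derivative_on:
  assumes cS: "\<And>t. c t \<in> S" and f: "f \<in> smooth_fun_on M S"
  shows "((\<lambda>t. f (c t)) has_real_derivative curve_vec (smooth_fun_on M S) c f) (at 0)"
proof -
  obtain W g where W: "openin (mtop M) W" "c 0 \<in> W" "g \<in> smooth_fun M" "\<forall>q\<in>S \<inter> W. f q = g q"
    using f cS[of 0] unfolding smooth_fun_on_def by blast
  have "\<forall>\<^sub>F t in nhds 0. g (c t) = f (c t)"
    using diff_curve_eventually[OF W(1,2)] by (rule eventually_mono) (use W(4) cS in auto)
  then have "((\<lambda>t. f (c t)) has_real_derivative velocity M c g) (at 0)"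
    using diff_curve_has_derivative[OF W(3)] by (rule DERIV_cong_ev[OF refl _ refl, THEN iffD1])
  then show ?thesis using curve_vec_eqI[OF f] by metis
qed

lemma curve_vec_derivation:
  assumes S: "S \<subseteq> points M" and cS: "\<And>t. c t \<in> S"
  shows "curve_vec (smooth_fun_on M S) c \<in> derivations (smooth_fun_on M S) (c 0)"
proof -
  let ?C = "smooth_fun_on M S" and ?v = "curve_vec (smooth_fun_on M S) c"
  note der = diff_curve_has_derivative_on[OF cS]
  have const: "(\<lambda>x. k) \<in> ?C" for k
    by (rule smooth_fun_onI_restrict[OF S smooth_fun_const[OF M]]) simp
  have add: "?v (\<lambda>x. f x + g x) = ?v f + ?v g" if "f \<in> ?C" "g \<in> ?C" for f g
    by (rule curve_vec_eqI[OF smooth_fun_on_add[OF M that] DERIV_add[OF der[OF that(1)] der[OF that(2)]]])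
  have mult: "?v (\<lambda>x. f x * g x) = f (c 0) * ?v g + g (c 0) * ?v f" if "f \<in> ?C" "g \<in> ?C" for f g
    using curve_vec_eqI[OF smooth_fun_on_mult[OF M that] DERIV_mult[OF der[OF that(1)] der[OF that(2)]]]
    by (simp add: mult.commute)
  have scale: "?v (\<lambda>x. k * f x) = k * ?v f" if f: "f \<in> ?C" for k f
    by (rule curve_vec_eqI[OF smooth_fun_on_mult[OF M const f] DERIV_cmult[OF der[OF f]]])
  have "?v \<in> dual ?C"
    by (rule dual_pointwiseI) (use add scale in \<open>auto simp: curve_vec_def\<close>)
  then show ?thesis using mult by (simp add: derivations_def)
qed

lemma curve_vec_tangent: "velocity M c \<in> tangent_space M (c 0)"
  using curve_vec_derivation[OF subset_refl diff_curve_point]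
  by (simp add: tangent_space_eq[OF M] smooth_fun_on_self[OF M])

lemma push_curve_vec:
  assumes F: "smooth_map_on M S N F" and cS: "\<And>t. c t \<in> S"
  shows "diff_curve N (\<lambda>t. F (c t))"
    and "push N F (curve_vec (smooth_fun_on M S) c) = velocity N (\<lambda>t. F (c t))"
proof -
  have h: "h \<circ> F \<in> smooth_fun_on M S" if "h \<in> smooth_fun N" for h
    using F that by (simp add: smooth_map_on_def)
  show "diff_curve N (\<lambda>t. F (c t))"
    using diff_curve_has_derivative_on[OF cS h] F cS
    by (auto simp: diff_curve_def smooth_map_on_def o_def)
  show "push N F (curve_vec (smooth_fun_on M S) c) = velocity N (\<lambda>t. F (c t))"
    using h by (auto simp: push_def curve_vec_def on_space_def o_def fun_eq_iff)
qed

text \<open>Near 0 the chart expression of the curve is a frame sum of global coordinate functions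
  along it, and each of these is differentiable at 0.\<close>

lemma diff_curve_chart:
  assumes ch: "(U, \<phi>) \<in> atlas M" and U: "c 0 \<in> U"
  obtains e where "((\<lambda>t. \<phi> (c t)) has_vector_derivative e) (at 0)"
proof -
  obtain B :: "'e set" where B: "frame B" using M unfolding charted_def by blast
  obtain X W where W: "openin (mtop M) W" "c 0 \<in> W" "W \<subseteq> U"
    and Xs: "\<And>b. X b \<in> smooth_fun M" and XW: "\<And>b q. q \<in> W \<Longrightarrow> X b q = \<phi> q \<bullet> b"
    by (rule chart_coordinates[OF M ch U]) blast
  have "((\<lambda>t. \<Sum>b\<in>B. X b (c t) *\<^sub>R b) has_vector_derivative
      (\<Sum>b\<in>B. velocity M c (X b) *\<^sub>R b)) (at 0)"
  proof (rule has_vector_derivative_sum)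
    fix b
    show "((\<lambda>t. X b (c t) *\<^sub>R b) has_vector_derivative velocity M c (X b) *\<^sub>R b) (at 0)"
      using has_vector_derivative_scaleR[OF diff_curve_has_derivative[OF Xs[of b]] has_vector_derivative_const[of b]]
      by simp
  qed
  note sum = this
  obtain T where T: "open T" "0 \<in> T" "\<And>t. t \<in> T \<Longrightarrow> c t \<in> W"
    using diff_curve_eventually[OF W(1,2)] unfolding eventually_nhds by blast
  have eq: "(\<Sum>b\<in>B. X b (c t) *\<^sub>R b) = \<phi> (c t)" if "t \<in> T" for t
    using XW[OF T(3)[OF that]] frame_sum[OF B, of "\<phi> (c t)"] by simp
  from has_vector_derivative_transform_within_open[OF sum T(1,2) eq]
  have "((\<lambda>t. \<phi> (c t)) has_vector_derivative
      (\<Sum>b\<in>B. velocity M c (X b) *\<^sub>R b)) (at 0)" .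
  then show ?thesis by (rule that)
qed

end

lemma real_derivative_along_curve:
  assumes "(g has_derivative g') (at (x 0))" "(x has_vector_derivative e) (at 0)"
  shows "((\<lambda>t. g (x t)) has_real_derivative g' e) (at 0)"
proof -
  have "((g \<circ> x) has_vector_derivative g' e) (at 0)"
    by (rule vector_derivative_diff_chain_within[OF assms(2)]) (rule has_derivative_at_withinI[OF assms(1)])
  then show ?thesis by (simp add: has_real_derivative_iff_has_vector_derivative o_def)
qed

lemma chart_curve:
  assumes M: "charted M" and ch: "(U, \<phi>) \<in> atlas M" and p: "p \<in> U"
    and x: "x 0 = \<phi> p" "(x has_vector_derivative e) (at 0)" "\<And>t. x t \<in> \<phi> ` U"
  shows "diff_curve M (\<lambda>t. inv_into U \<phi> (x t))"
    and "velocity M (\<lambda>t. inv_into U \<phi> (x t)) = chart_vec M U \<phi> p e"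
proof -
  have der: "((\<lambda>t. f (inv_into U \<phi> (x t))) has_real_derivative chart_vec M U \<phi> p e f) (at 0)"
    if "f \<in> smooth_fun M" for f
    using real_derivative_along_curve[of "\<lambda>y. f (inv_into U \<phi> y)" _ x e]
      chart_rep_has_derivative[OF M ch p that] x(1,2) by simp
  show "diff_curve M (\<lambda>t. inv_into U \<phi> (x t))"
    using der chart_subset[OF M ch] chart_inv_in[OF M ch x(3)] by (auto simp: diff_curve_def)
  show "velocity M (\<lambda>t. inv_into U \<phi> (x t)) = chart_vec M U \<phi> p e"
  proof
    show "velocity M (\<lambda>t. inv_into U \<phi> (x t)) f = chart_vec M U \<phi> p e f" for f
    proof (cases "f \<in> smooth_fun M")
      case True
      show ?thesis by (rule curve_vec_eqI[OF True der[OF True]])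
    qed (simp add: curve_vec_def chart_vec_def)
  qed
qed

lemma tangent_curve:
  assumes M: "charted M" and p: "p \<in> points M" and v: "v \<in> tangent_space M p"
  obtains c where "diff_curve M c" "c 0 = p" "velocity M c = v"
proof -
  obtain U \<phi> where ch: "(U, \<phi>) \<in> atlas M" "p \<in> U" using chart_exists[OF M p] .
  obtain e where e: "v = chart_vec M U \<phi> p e" by (rule tangent_chart_vec[OF M ch v])
  \<comment> \<open>A straight line in the chart, held at \<open>\<phi> p\<close> for parameters at
    which it would leave the chart.\<close>
  define x where "x t = (if \<phi> p + t *\<^sub>R e \<in> \<phi> ` U then \<phi> p + t *\<^sub>R e else \<phi> p)" for t
  have x0: "x 0 = \<phi> p" by (simp add: x_def)
  have xU: "x t \<in> \<phi> ` U" for t using ch(2) by (simp add: x_def)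
  have "open ((\<lambda>t. \<phi> p + t *\<^sub>R e) -` \<phi> ` U)"
    by (rule continuous_open_vimage) (use chart_open_range[OF M ch(1)] in \<open>auto intro!: continuous_intros\<close>)
  moreover have "((\<lambda>t. \<phi> p + t *\<^sub>R e) has_vector_derivative e) (at 0)"
    by (auto intro!: derivative_eq_intros)
  ultimately have xd: "(x has_vector_derivative e) (at 0)"
    using ch(2) by (elim has_vector_derivative_transform_within_open) (auto simp: x_def)
  show ?thesis
    using chart_curve[OF M ch x0 xd xU] chart_inv[OF M ch] by (intro that) (auto simp: x0 e)
qed

subsection \<open>Tangent vectors of subsets\<close>

lemma push_derivation:
  assumes N: "charted N" and F: "smooth_map_on M S N F" and d: "\<delta> \<in> derivations (smooth_fun_on M S) p"
  shows "push N F \<delta> \<in> tangent_space N (F p)"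
proof -
  have h: "h \<circ> F \<in> smooth_fun_on M S" if "h \<in> smooth_fun N" for h
    using F that by (simp add: smooth_map_on_def)
  note du = dual_pointwise[OF derivations_dual[OF d]]
  have sc: "(\<lambda>x. k * f x) \<in> smooth_fun N" if "f \<in> smooth_fun N" for k f
    by (rule smooth_fun_mult[OF N smooth_fun_const[OF N] that])
  have "push N F \<delta> \<in> dual (smooth_fun N)"
    unfolding dual_def linear_on_def push_def
    using du h smooth_fun_add[OF N] sc
    by (auto simp: plus_fun_def scaleR_fun_def o_def)
  then show ?thesis
    using derivations_product[OF d] h smooth_fun_mult[OF N]
    by (auto simp: tangent_space_def derivations_def push_def o_def)
qed

lemma inclusion_smooth_map:
  "S \<subseteq> points M \<Longrightarrow> smooth_map_on M S M (\<lambda>x. x)"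
  by (auto simp: smooth_map_on_def o_def intro: smooth_fun_onI_restrict)

text \<open>A function smooth on \<open>S\<close> agrees near \<open>p\<close> with an ambient one,
  so by locality a derivation is known from its values on ambient functions. This is the uniqueness
  behind the \<open>THE\<close> of \<open>as_sub_tangent\<close> and \<open>Tmul\<close>.\<close>

lemma derivation_eqI:
  assumes M: "charted M" and S: "S \<subseteq> points M" and p: "p \<in> S"
    and d: "\<delta> \<in> derivations (smooth_fun_on M S) p" and e: "\<epsilon> \<in> derivations (smooth_fun_on M S) p"
    and eq: "push M (\<lambda>x. x) \<delta> = push M (\<lambda>x. x) \<epsilon>"
  shows "\<delta> = \<epsilon>"
proof (rule dual_eqI[OF derivations_dual[OF d] derivations_dual[OF e]])
  fix f assume f: "f \<in> smooth_fun_on M S"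
  obtain W g where W: "openin (mtop M) W" "p \<in> W" "g \<in> smooth_fun M" "\<forall>q\<in>S \<inter> W. f q = g q"
    using f p unfolding smooth_fun_on_def by blast
  have g: "g \<in> smooth_fun_on M S" by (rule smooth_fun_onI_restrict[OF S W(3)]) simp
  have "\<delta> f = \<delta> g" "\<epsilon> f = \<epsilon> g"
    using derivation_local[OF M S p _ f g W(1,2)] d e W(4) by blast+
  moreover have "push M (\<lambda>x. x) \<delta> g = push M (\<lambda>x. x) \<epsilon> g" using eq by simp
  ultimately show "\<delta> f = \<epsilon> f" using W(3) by (simp add: push_def o_def)
qed

lemma curve_vec_sub_tangent:
  assumes M: "charted M" and c: "diff_curve M c" and S: "S \<subseteq> points M" and cS: "\<And>t. c t \<in> S"
  shows "velocity M c \<in> sub_tangent M S (c 0)"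
  unfolding sub_tangent_def
  using push_curve_vec(2)[OF M c inclusion_smooth_map[OF S] cS] curve_vec_derivation[OF M c S cS]
  by (metis imageI)

subsection \<open>Products\<close>

lemma points_prod [simp]: "points (prod_manifold M N) = points M \<times> points N"
  by (simp add: prod_manifold_def)

lemma atlas_prodI: "(U, \<phi>) \<in> atlas M \<Longrightarrow> (V, \<psi>) \<in> atlas N \<Longrightarrow> (U \<times> V, map_prod \<phi> \<psi>) \<in> atlas (prod_manifold M N)"
  by (auto simp: prod_manifold_def)

lemma atlas_prodE:
  assumes "(W, \<rho>) \<in> atlas (prod_manifold M N)"
  obtains U \<phi> V \<psi> where "W = U \<times> V" "\<rho> = map_prod \<phi> \<psi>" "(U, \<phi>) \<in> atlas M" "(V, \<psi>) \<in> atlas N"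
  using assms by (auto simp: prod_manifold_def)

lemma homeomorphic_map_map_prod:
  assumes f: "homeomorphic_map X X' f" and g: "homeomorphic_map Y Y' g"
  shows "homeomorphic_map (prod_topology X Y) (prod_topology X' Y') (map_prod f g)"
proof -
  obtain f' g' where "homeomorphic_maps X X' f f'" "homeomorphic_maps Y Y' g g'"
    using f g by (auto simp: homeomorphic_map_maps)
  then have "homeomorphic_maps (prod_topology X Y) (prod_topology X' Y') (\<lambda>(x,y). (f x, g y)) (\<lambda>(x,y). (f' x, g' y))"
    by (simp add: homeomorphic_maps_prod)
  moreover have "map_prod f g = (\<lambda>(x,y). (f x, g y))" by auto
  ultimately show ?thesis by (auto simp: homeomorphic_map_maps)
qed

context
  fixes M :: "('a, 'e::{real_inner,heine_borel}) manifold" and N :: "('b, 'f::{real_inner,heine_borel}) manifold"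
  assumes M: "charted M" and N: "charted N"
begin

context
  fixes U \<phi> V \<psi>
  assumes c: "(U, \<phi>) \<in> atlas M" and d: "(V, \<psi>) \<in> atlas N"
begin

lemma prod_chart_image: "map_prod \<phi> \<psi> ` (U \<times> V) = \<phi> ` U \<times> \<psi> ` V"
  by (rule map_prod_surj_on[OF refl refl])

lemma prod_chart_inv:
  assumes "x \<in> \<phi> ` U" "y \<in> \<psi> ` V"
  shows "inv_into (U \<times> V) (map_prod \<phi> \<psi>) (x, y) = (inv_into U \<phi> x, inv_into V \<psi> y)"
  by (rule inv_into_f_eq[OF map_prod_inj_on[OF chart_inj[OF M c] chart_inj[OF N d]]])
    (use assms in \<open>auto intro: inv_into_into f_inv_into_f\<close>)

end

lemma prod_charted: "charted (prod_manifold M N)"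
proof -
  obtain B :: "'e set" where B: "frame B" using M unfolding charted_def by blast
  obtain C :: "'f set" where C: "frame C" using N unfolding charted_def by blast
  have c1: "\<exists>B::('e \<times> 'f) set. frame B" using frame_prod[OF B C] by blast
  have c2: "Hausdorff_space (mtop (prod_manifold M N))"
    using M N by (simp add: prod_manifold_def charted_def Hausdorff_space_prod_topology)
  have c3: "\<Union> (fst ` atlas (prod_manifold M N)) = points (prod_manifold M N)"
  proof (intro equalityI subsetI)
    fix z assume "z \<in> \<Union> (fst ` atlas (prod_manifold M N))"
    then obtain W \<rho> where W: "(W, \<rho>) \<in> atlas (prod_manifold M N)" "z \<in> W" by auto
    from W(1) obtain U \<phi> V \<psi> where "W = U \<times> V" and c: "(U, \<phi>) \<in> atlas M" "(V, \<psi>) \<in> atlas N"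
      by (rule atlas_prodE)
    then show "z \<in> points (prod_manifold M N)"
      using W(2) chart_subset[OF M c(1)] chart_subset[OF N c(2)] by auto
  next
    fix z assume "z \<in> points (prod_manifold M N)"
    then have z: "fst z \<in> points M" "snd z \<in> points N" by auto
    obtain U \<phi> where U: "(U, \<phi>) \<in> atlas M" "fst z \<in> U" using chart_exists[OF M z(1)] .
    obtain V \<psi> where V: "(V, \<psi>) \<in> atlas N" "snd z \<in> V" using chart_exists[OF N z(2)] .
    have "z \<in> U \<times> V" using U V by (simp add: mem_Times_iff)
    then show "z \<in> \<Union> (fst ` atlas (prod_manifold M N))"
      using image_eqI[OF _ atlas_prodI[OF U(1) V(1)], of "U \<times> V" fst] by auto
  qed
  have c4: "openin (mtop (prod_manifold M N)) W \<and> open (\<rho> ` W) \<and>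
      homeomorphic_map (subtopology (mtop (prod_manifold M N)) W) (top_of_set (\<rho> ` W)) \<rho>"
    if W: "(W, \<rho>) \<in> atlas (prod_manifold M N)" for W \<rho>
  proof -
    from W obtain U \<phi> V \<psi> where W: "W = U \<times> V" "\<rho> = map_prod \<phi> \<psi>"
      and c: "(U, \<phi>) \<in> atlas M" and d: "(V, \<psi>) \<in> atlas N" by (rule atlas_prodE)
    have "openin (mtop (prod_manifold M N)) W"
      using chart_openin[OF M c] chart_openin[OF N d] by (simp add: W prod_manifold_def openin_prod_Times_iff)
    moreover have "open (\<rho> ` W)"
      using chart_open_range[OF M c] chart_open_range[OF N d] by (simp add: W prod_chart_image[OF c d] open_Times)
    moreover have "homeomorphic_map (subtopology (mtop (prod_manifold M N)) W) (top_of_set (\<rho> ` W)) \<rho>"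
      using homeomorphic_map_map_prod[OF chart_homeomorphic[OF M c] chart_homeomorphic[OF N d]]
      by (simp add: W prod_chart_image[OF c d] prod_manifold_def subtopology_Times)
    ultimately show ?thesis by blast
  qed
  have c5: "smooth_on (\<rho> ` (W \<inter> W')) (\<rho>' \<circ> inv_into W \<rho>)"
    if W: "(W, \<rho>) \<in> atlas (prod_manifold M N)" and W': "(W', \<rho>') \<in> atlas (prod_manifold M N)" for W \<rho> W' \<rho>'
  proof -
    from W obtain U \<phi> V \<psi> where W: "W = U \<times> V" "\<rho> = map_prod \<phi> \<psi>"
      and c: "(U, \<phi>) \<in> atlas M" and d: "(V, \<psi>) \<in> atlas N" by (rule atlas_prodE)
    from W' obtain U' \<phi>' V' \<psi>' where W': "W' = U' \<times> V'" "\<rho>' = map_prod \<phi>' \<psi>'"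
      and c': "(U', \<phi>') \<in> atlas M" and d': "(V', \<psi>') \<in> atlas N" by (rule atlas_prodE)
    have im: "\<rho> ` (W \<inter> W') = \<phi> ` (U \<inter> U') \<times> \<psi> ` (V \<inter> V')"
      unfolding W W' Times_Int_Times by (rule map_prod_surj_on[OF refl refl])
    have o: "open (\<phi> ` (U \<inter> U'))" "open (\<psi> ` (V \<inter> V'))"
      using chart_open_image[OF M c] chart_open_image[OF N d] chart_openin[OF M] chart_openin[OF N] c d c' d'
      by (simp_all add: openin_Int)
    then have oo: "open (\<phi> ` (U \<inter> U') \<times> \<psi> ` (V \<inter> V'))" by (rule open_Times)
    have "smooth_on (\<phi> ` (U \<inter> U') \<times> \<psi> ` (V \<inter> V')) (\<lambda>z. \<phi>' (inv_into U \<phi> (fst z)))"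
      by (rule smooth_on_compose[OF B oo chart_transition[OF M c' c] smooth_on_linear[OF bounded_linear_fst oo]]) auto
    moreover have "smooth_on (\<phi> ` (U \<inter> U') \<times> \<psi> ` (V \<inter> V')) (\<lambda>z. \<psi>' (inv_into V \<psi> (snd z)))"
      by (rule smooth_on_compose[OF C oo chart_transition[OF N d' d] smooth_on_linear[OF bounded_linear_snd oo]]) auto
    ultimately have "smooth_on (\<phi> ` (U \<inter> U') \<times> \<psi> ` (V \<inter> V'))
        (\<lambda>z. (\<phi>' (inv_into U \<phi> (fst z)), \<psi>' (inv_into V \<psi> (snd z))))"
      by (rule smooth_on_Pair[OF oo])
    then show ?thesis unfolding im
      by (rule smooth_on_cong[OF oo, rotated]) (auto simp: W W' prod_chart_inv[OF c d])
  qed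
  show ?thesis
    unfolding charted_def
  proof (intro conjI ballI)
    fix z assume z: "z \<in> atlas (prod_manifold M N)"
    show "case z of (W, \<rho>) \<Rightarrow> openin (mtop (prod_manifold M N)) W \<and> open (\<rho> ` W) \<and>
      homeomorphic_map (subtopology (mtop (prod_manifold M N)) W) (top_of_set (\<rho> ` W)) \<rho>"
      using c4[of "fst z" "snd z"] z by (simp add: case_prod_unfold)
    show "case z of (W, \<rho>) \<Rightarrow> \<forall>(W', \<rho>')\<in>atlas (prod_manifold M N).
      smooth_on (\<rho> ` (W \<inter> W')) (\<rho>' \<circ> inv_into W \<rho>)"
      using c5[of "fst z" "snd z"] z by (simp add: case_prod_unfold)
  qed (rule c1 c2 c3)+
qed

lemma smooth_fun_fst:
  assumes h: "h \<in> smooth_fun M" shows "(\<lambda>z. h (fst z)) \<in> smooth_fun (prod_manifold M N)"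
proof (rule smooth_funI)
  obtain B :: "'e set" where B: "frame B" using M unfolding charted_def by blast
  fix W \<rho> assume "(W, \<rho>) \<in> atlas (prod_manifold M N)"
  then obtain U \<phi> V \<psi> where W: "W = U \<times> V" "\<rho> = map_prod \<phi> \<psi>"
      and c: "(U, \<phi>) \<in> atlas M" and d: "(V, \<psi>) \<in> atlas N" by (rule atlas_prodE)
  have o: "open (\<phi> ` U \<times> \<psi> ` V)"
    by (rule open_Times[OF chart_open_range[OF M c] chart_open_range[OF N d]])
  have "smooth_on (\<phi> ` U \<times> \<psi> ` V) (\<lambda>z. h (inv_into U \<phi> (fst z)))"
    by (rule smooth_on_compose[OF B o smooth_fun_chart[OF M c h] smooth_on_linear[OF bounded_linear_fst o]]) auto
  then show "smooth_on (\<rho> ` W) (\<lambda>z. h (fst (inv_into W \<rho> z)))"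
    unfolding W prod_chart_image[OF c d]
    by (rule smooth_on_cong[OF o, rotated]) (auto simp: prod_chart_inv[OF c d])
qed

lemma smooth_fun_snd:
  assumes h: "h \<in> smooth_fun N" shows "(\<lambda>z. h (snd z)) \<in> smooth_fun (prod_manifold M N)"
proof (rule smooth_funI)
  obtain C :: "'f set" where C: "frame C" using N unfolding charted_def by blast
  fix W \<rho> assume "(W, \<rho>) \<in> atlas (prod_manifold M N)"
  then obtain U \<phi> V \<psi> where W: "W = U \<times> V" "\<rho> = map_prod \<phi> \<psi>"
      and c: "(U, \<phi>) \<in> atlas M" and d: "(V, \<psi>) \<in> atlas N" by (rule atlas_prodE)
  have o: "open (\<phi> ` U \<times> \<psi> ` V)"
    by (rule open_Times[OF chart_open_range[OF M c] chart_open_range[OF N d]])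
  have "smooth_on (\<phi> ` U \<times> \<psi> ` V) (\<lambda>z. h (inv_into V \<psi> (snd z)))"
    by (rule smooth_on_compose[OF C o smooth_fun_chart[OF N d h] smooth_on_linear[OF bounded_linear_snd o]]) auto
  then show "smooth_on (\<rho> ` W) (\<lambda>z. h (snd (inv_into W \<rho> z)))"
    unfolding W prod_chart_image[OF c d]
    by (rule smooth_on_cong[OF o, rotated]) (auto simp: prod_chart_inv[OF c d])
qed

lemma smooth_fun_slice_fst:
  assumes f: "f \<in> smooth_fun (prod_manifold M N)" and q: "q \<in> points N"
  shows "(\<lambda>x. f (x, q)) \<in> smooth_fun M"
proof (rule smooth_funI)
  obtain B :: "('e \<times> 'f) set" where B: "frame B" using prod_charted unfolding charted_def by blast
  fix U \<phi> assume c: "(U, \<phi>) \<in> atlas M"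
  obtain V \<psi> where d: "(V, \<psi>) \<in> atlas N" "q \<in> V" using chart_exists[OF N q] .
  note o = chart_open_range[OF M c]
  have "smooth_on (\<phi> ` U) (\<lambda>x. f (inv_into (U \<times> V) (map_prod \<phi> \<psi>) (x, \<psi> q)))"
    by (rule smooth_on_compose[OF B o smooth_fun_chart[OF prod_charted atlas_prodI[OF c d(1)] f]
          smooth_on_Pair[OF o smooth_on_linear[OF bounded_linear_ident o] smooth_on_const]])
      (use d(2) in \<open>auto simp: prod_chart_image[OF c d(1)]\<close>)
  then show "smooth_on (\<phi> ` U) (\<lambda>x. f (inv_into U \<phi> x, q))"
    by (rule smooth_on_cong[OF o, rotated])
      (use d(2) in \<open>auto simp: prod_chart_inv[OF c d(1)] chart_inv[OF N d(1)]\<close>)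
qed

lemma smooth_fun_slice_snd:
  assumes f: "f \<in> smooth_fun (prod_manifold M N)" and p: "p \<in> points M"
  shows "(\<lambda>y. f (p, y)) \<in> smooth_fun N"
proof (rule smooth_funI)
  obtain B :: "('e \<times> 'f) set" where B: "frame B" using prod_charted unfolding charted_def by blast
  fix V \<psi> assume d: "(V, \<psi>) \<in> atlas N"
  obtain U \<phi> where c: "(U, \<phi>) \<in> atlas M" "p \<in> U" using chart_exists[OF M p] .
  note o = chart_open_range[OF N d]
  have "smooth_on (\<psi> ` V) (\<lambda>y. f (inv_into (U \<times> V) (map_prod \<phi> \<psi>) (\<phi> p, y)))"
    by (rule smooth_on_compose[OF B o smooth_fun_chart[OF prod_charted atlas_prodI[OF c(1) d] f]
          smooth_on_Pair[OF o smooth_on_const smooth_on_linear[OF bounded_linear_ident o]]])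
      (use c(2) in \<open>auto simp: prod_chart_image[OF c(1) d]\<close>)
  then show "smooth_on (\<psi> ` V) (\<lambda>y. f (p, inv_into V \<psi> y))"
    by (rule smooth_on_cong[OF o, rotated])
      (use c(2) in \<open>auto simp: prod_chart_inv[OF c(1) d] chart_inv[OF M c(1)]\<close>)
qed

lemma smooth_map_fst: "S \<subseteq> points (prod_manifold M N) \<Longrightarrow> smooth_map_on (prod_manifold M N) S M fst"
proof -
  assume S: "S \<subseteq> points (prod_manifold M N)"
  have "(\<lambda>x. h (fst x)) \<in> smooth_fun_on (prod_manifold M N) S" if "h \<in> smooth_fun M" for h
    by (rule smooth_fun_onI_restrict[OF S smooth_fun_fst[OF that]]) simp
  then show ?thesis using S by (auto simp: smooth_map_on_def o_def)
qed

lemma smooth_map_snd: "S \<subseteq> points (prod_manifold M N) \<Longrightarrow> smooth_map_on (prod_manifold M N) S N snd"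
proof -
  assume S: "S \<subseteq> points (prod_manifold M N)"
  have "(\<lambda>x. h (snd x)) \<in> smooth_fun_on (prod_manifold M N) S" if "h \<in> smooth_fun N" for h
    by (rule smooth_fun_onI_restrict[OF S smooth_fun_snd[OF that]]) simp
  then show ?thesis using S by (auto simp: smooth_map_on_def o_def)
qed

text \<open>The total derivative in a product chart is linear, hence the sum of its values along the
  two factors; each partial term is the same computation with the other curve held constant.\<close>

lemma pair_curve_derivative:
  assumes c: "diff_curve M c" and d: "diff_curve N d" and f: "f \<in> smooth_fun (prod_manifold M N)"
  shows "((\<lambda>t. f (c t, d t)) has_real_derivative
      velocity M c (\<lambda>x. f (x, d 0)) + velocity N d (\<lambda>y. f (c 0, y))) (at 0)"
proof -
  obtain U \<phi> where U: "(U, \<phi>) \<in> atlas M" "c 0 \<in> U" using chart_exists[OF M diff_curve_point[OF M c]] .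
  obtain V \<psi> where V: "(V, \<psi>) \<in> atlas N" "d 0 \<in> V" using chart_exists[OF N diff_curve_point[OF N d]] .
  obtain e where e: "((\<lambda>t. \<phi> (c t)) has_vector_derivative e) (at 0)" by (rule diff_curve_chart[OF M c U])
  obtain e' where e': "((\<lambda>t. \<psi> (d t)) has_vector_derivative e') (at 0)" by (rule diff_curve_chart[OF N d V])
  let ?F = "\<lambda>z. f (inv_into (U \<times> V) (map_prod \<phi> \<psi>) z)"
  let ?z = "(\<phi> (c 0), \<psi> (d 0))"
  obtain F' where F': "(?F has_derivative F') (at ?z)"
    using smooth_on_has_derivative[OF smooth_fun_chart[OF prod_charted atlas_prodI[OF U(1) V(1)] f], of ?z] U(2) V(2)
    by (auto simp: prod_chart_image[OF U(1) V(1)])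
  have rep: "?F (\<phi> x, \<psi> y) = f (x, y)" if "x \<in> U" "y \<in> V" for x y
    using that by (simp add: prod_chart_inv[OF U(1) V(1)] chart_inv[OF M U(1)] chart_inv[OF N V(1)])
  have ev: "\<forall>\<^sub>F t in nhds 0. c t \<in> U" "\<forall>\<^sub>F t in nhds 0. d t \<in> V"
    by (rule diff_curve_eventually[OF M c chart_openin[OF M U(1)] U(2)]
        diff_curve_eventually[OF N d chart_openin[OF N V(1)] V(2)])+
  have der: "((\<lambda>t. f (x t, y t)) has_real_derivative F' (u, w)) (at 0)"
    if "x 0 = c 0" "y 0 = d 0" "((\<lambda>t. \<phi> (x t)) has_vector_derivative u) (at 0)"
      "((\<lambda>t. \<psi> (y t)) has_vector_derivative w) (at 0)"
      and ev: "\<forall>\<^sub>F t in nhds 0. x t \<in> U" "\<forall>\<^sub>F t in nhds 0. y t \<in> V" for x y u w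
  proof -
    have "((\<lambda>t. ?F (\<phi> (x t), \<psi> (y t))) has_real_derivative F' (u, w)) (at 0)"
      by (rule real_derivative_along_curve[where x = "\<lambda>t. (\<phi> (x t), \<psi> (y t))"])
        (use that F' in \<open>auto intro: has_vector_derivative_Pair\<close>)
    moreover have "\<forall>\<^sub>F t in nhds 0. ?F (\<phi> (x t), \<psi> (y t)) = f (x t, y t)"
      using ev by eventually_elim (rule rep)
    ultimately show ?thesis by (rule DERIV_cong_ev[OF refl _ refl, THEN iffD1, rotated])
  qed
  have D: "((\<lambda>t. f (c t, d t)) has_real_derivative F' (e, e')) (at 0)"
    by (rule der[OF refl refl e e' ev])
  have 1: "velocity M c (\<lambda>x. f (x, d 0)) = F' (e, 0)"
    by (rule curve_vec_eqI[OF smooth_fun_slice_fst[OF f diff_curve_point[OF N d]]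
          der[OF refl refl e has_vector_derivative_const ev(1)]]) (simp add: V(2))
  have 2: "velocity N d (\<lambda>y. f (c 0, y)) = F' (0, e')"
    by (rule curve_vec_eqI[OF smooth_fun_slice_snd[OF f diff_curve_point[OF M c]]
          der[OF refl refl has_vector_derivative_const e' _ ev(2)]]) (simp add: U(2))
  have "F' (e, e') = F' (e, 0) + F' (0, e')"
    using linear_add[OF has_derivative_linear[OF F'], of "(e, 0)" "(0, e')"] by simp
  then show ?thesis using D by (simp add: 1 2)
qed

lemma pair_diff_curve:
  assumes c: "diff_curve M c" and d: "diff_curve N d"
  shows "diff_curve (prod_manifold M N) (\<lambda>t. (c t, d t))"
    and "f \<in> smooth_fun (prod_manifold M N) \<Longrightarrow>
      velocity (prod_manifold M N) (\<lambda>t. (c t, d t)) f =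
      velocity M c (\<lambda>x. f (x, d 0)) + velocity N d (\<lambda>y. f (c 0, y))"
  using pair_curve_derivative[OF c d] diff_curve_point[OF M c] diff_curve_point[OF N d]
    curve_vec_eqI[of f "smooth_fun (prod_manifold M N)" "\<lambda>t. (c t, d t)"]
  by (auto simp: diff_curve_def)

text \<open>The vector is the velocity of a curve, and the curve is the pair of its components; so
  the vector is determined by its two projections.\<close>

lemma prod_tangent_decompose:
  assumes p: "p \<in> points M" and q: "q \<in> points N"
    and D: "D \<in> tangent_space (prod_manifold M N) (p, q)" and f: "f \<in> smooth_fun (prod_manifold M N)"
  shows "D f = push M fst D (\<lambda>x. f (x, q)) + push N snd D (\<lambda>y. f (p, y))"
proof -
  let ?P = "prod_manifold M N"
  have pq: "(p, q) \<in> points ?P" using p q by simp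
  obtain c where c: "diff_curve ?P c" "c 0 = (p, q)" "velocity ?P c = D"
    by (rule tangent_curve[OF prod_charted pq D])
  note pt = diff_curve_point[OF prod_charted c(1)]
  have cf: "diff_curve M (\<lambda>t. fst (c t))" "velocity M (\<lambda>t. fst (c t)) = push M fst D"
    using push_curve_vec[OF prod_charted c(1) smooth_map_fst[OF subset_refl] pt] c(3)
    by (simp_all only: smooth_fun_on_self[OF prod_charted])
  have cs: "diff_curve N (\<lambda>t. snd (c t))" "velocity N (\<lambda>t. snd (c t)) = push N snd D"
    using push_curve_vec[OF prod_charted c(1) smooth_map_snd[OF subset_refl] pt] c(3)
    by (simp_all only: smooth_fun_on_self[OF prod_charted])
  show ?thesis using pair_diff_curve(2)[OF cf(1) cs(1) f] c(2,3) cf(2) cs(2) by simp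
qed

end

subsection \<open>Curves in the coincidence set of two maps\<close>

text \<open>The condition \<open>F1 = F2\<close> is written as a zero set in coordinates near the
  common value, where \<open>curve_in_level_set\<close> applies; regularity is the surjectivity of
  the difference of the tangent maps. The two uses are \<open>src G g = tgt G h\<close> on pairs of
  arrows, and \<open>src G k = x\<close>, a coincidence with a constant map.\<close>

lemma coincidence_curve:
  fixes P :: "('a, 'e::{real_inner,heine_borel}) manifold" and N :: "('b, 'f::{real_inner,heine_borel}) manifold"
  assumes P: "charted P" and N: "charted N" and F1: "smooth_map P N F1" and F2: "smooth_map P N F2"
    and p: "p \<in> points P" "F1 p = F2 p"
    and surj: "\<And>u. u \<in> tangent_space N (F1 p) \<Longrightarrow> \<exists>v\<in>tangent_space P p. push N F1 v - push N F2 v = u"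
    and D: "D \<in> tangent_space P p" "push N F1 D = push N F2 D"
  obtains c where "diff_curve P c" "c 0 = p" "velocity P c = D" "\<And>t. F1 (c t) = F2 (c t)"
proof -
  let ?y = "F1 p"
  have y: "?y \<in> points N" using F1 p(1) by (auto simp: smooth_map_on_def)
  have pull: "(\<lambda>x. h (F1 x)) \<in> smooth_fun P" "(\<lambda>x. h (F2 x)) \<in> smooth_fun P" if "h \<in> smooth_fun N" for h
    using F1 F2 that smooth_fun_on_self[OF P] by (auto simp: smooth_map_on_def o_def)
  obtain B :: "'e set" where B: "frame B" using P unfolding charted_def by blast
  obtain C :: "'f set" where C: "frame C" using N unfolding charted_def by blast
  obtain U \<phi> where U: "(U, \<phi>) \<in> atlas P" "p \<in> U" using chart_exists[OF P p(1)] .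
  obtain V \<psi> where V: "(V, \<psi>) \<in> atlas N" "?y \<in> V" using chart_exists[OF N y] .
  obtain Y W where \<theta>: "openin (mtop N) W" "?y \<in> W" "W \<subseteq> V"
    and Ys: "\<And>b. Y b \<in> smooth_fun N" and Y: "\<And>b q. q \<in> W \<Longrightarrow> Y b q = \<psi> q \<bullet> b"
    by (rule chart_coordinates[OF N V]) blast
  obtain \<eta> where \<eta>: "\<eta> \<in> smooth_fun N" "\<eta> ?y = 1" "\<And>q. q \<notin> W \<Longrightarrow> \<eta> q = 0"
    by (rule manifold_cutoff[OF N \<theta>(1,2)]) blast
  have YW: "(\<Sum>b\<in>C. Y b q *\<^sub>R b) = \<psi> q" if "q \<in> W" for q
    using Y[OF that] frame_sum[OF C, of "\<psi> q"] by simp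
  define i where "i x = inv_into U \<phi> x" for x
  have ip: "i (\<phi> p) = p" unfolding i_def by (rule chart_inv[OF P U])
  define F where "F x = (\<Sum>b\<in>C. (Y b (F1 (i x)) - Y b (F2 (i x))) *\<^sub>R b)" for x
  have oU: "open (\<phi> ` U)" by (rule chart_open_range[OF P U(1)])
  have rs: "smooth_on (\<phi> ` U) (\<lambda>x. h (F1 (i x)))" "smooth_on (\<phi> ` U) (\<lambda>x. h (F2 (i x)))" if "h \<in> smooth_fun N" for h
    using smooth_fun_chart[OF P U(1)] pull[OF that] unfolding i_def by fast+
  have Fs: "smooth_on (\<phi> ` U) F"
    unfolding F_def
    by (rule smooth_on_sum[OF oU], rule smooth_on_linear_compose[OF bounded_linear_scaleR_left oU],
        rule smooth_on_diff[OF oU rs(1)[OF Ys] rs(2)[OF Ys]])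
  have Fd: "frechet_derivative F (at (\<phi> p)) e
      = (\<Sum>b\<in>C. (push N F1 (chart_vec P U \<phi> p e) (Y b) - push N F2 (chart_vec P U \<phi> p e) (Y b)) *\<^sub>R b)" for e
  proof -
    have "(F has_derivative (\<lambda>e. \<Sum>b\<in>C. (chart_vec P U \<phi> p e (\<lambda>x. Y b (F1 x)) - chart_vec P U \<phi> p e (\<lambda>x. Y b (F2 x))) *\<^sub>R b))
      (at (\<phi> p))"
      unfolding F_def i_def
      by (intro has_derivative_sum has_derivative_scaleR_left has_derivative_diff
          chart_rep_has_derivative[OF P U] pull Ys)
    from frechet_derivative_at[OF this]
    show ?thesis using Ys by (simp add: push_def o_def fun_eq_iff)
  qed
  have tan: "chart_vec P U \<phi> p e \<in> tangent_space P p" for e by (rule chart_vec_tangent[OF P U])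
  have sF: "surj (frechet_derivative F (at (\<phi> p)))"
  proof (rule surjI)
    fix z
    have u: "chart_vec N V \<psi> ?y z \<in> tangent_space N ?y" by (rule chart_vec_tangent[OF N V])
    then obtain v where v: "v \<in> tangent_space P p" "push N F1 v - push N F2 v = chart_vec N V \<psi> ?y z"
      using surj by blast
    obtain e where e: "v = chart_vec P U \<phi> p e" by (rule tangent_chart_vec[OF P U v(1)])
    \<comment> \<open>Near the base point \<open>Y b\<close> is the coordinate in direction
      \<open>b\<close>, so differentiating it along \<open>z\<close> gives the inner product with
      \<open>b\<close>.\<close>
    have uY: "chart_vec N V \<psi> ?y z (Y b) = z \<bullet> b" for b
    proof (rule chart_vec_eqI[OF N V Ys])
      have W\<psi>: "open (\<psi> ` W)" "\<psi> ?y \<in> \<psi> ` W" using chart_open_image[OF N V(1) \<theta>(1,3)] \<theta>(2) by auto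
      show "((\<lambda>x. Y b (inv_into V \<psi> x)) has_derivative (\<lambda>z. z \<bullet> b)) (at (\<psi> ?y))"
        by (rule has_derivative_transform_within_open[OF bounded_linear_imp_has_derivative[OF bounded_linear_inner_left] W\<psi>])
          (use \<theta>(3) chart_inv[OF N V(1)] Y in auto)
    qed
    have "push N F1 v (Y b) - push N F2 v (Y b) = z \<bullet> b" for b
      using fun_cong[OF v(2), of "Y b"] uY by (simp add: fun_diff_def)
    then have "frechet_derivative F (at (\<phi> p)) e = z" using frame_sum[OF C, of z] by (simp add: Fd e)
    then show "frechet_derivative F (at (\<phi> p)) (SOME e. frechet_derivative F (at (\<phi> p)) e = z) = z"
      by (rule someI)
  qed
  obtain e where e: "D = chart_vec P U \<phi> p e" by (rule tangent_chart_vec[OF P U D(1)])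
  have De: "frechet_derivative F (at (\<phi> p)) e = 0" using D(2) by (simp add: Fd e)
  \<comment> \<open>The cutoff \<eta> is positive only inside \<open>W\<close>. On \<open>S\<close>
    both maps therefore take values where the functions \<open>Y b\<close> are the chart
    coordinates, and there \<open>F = 0\<close> forces the two values to coincide.\<close>
  define S where "S = {x \<in> \<phi> ` U. \<eta> (F1 (i x)) > 0} \<inter> {x \<in> \<phi> ` U. \<eta> (F2 (i x)) > 0}"
  have pos: "open {x \<in> \<phi> ` U. g x > 0}" if "smooth_on (\<phi> ` U) g" for g :: "'e \<Rightarrow> real"
    using continuous_open_preimage[OF smooth_on_continuous[OF that] oU open_greaterThan[of 0]]
    by (simp add: Int_def vimage_def)
  have S: "open S" unfolding S_def by (intro open_Int pos rs \<eta>(1))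
  have pS: "\<phi> p \<in> S" using U(2) \<eta>(2) p(2) by (simp add: S_def ip)
  have SU: "S \<subseteq> \<phi> ` U" by (auto simp: S_def)
  have F0: "F (\<phi> p) = 0" using p(2) by (simp add: F_def ip)
  obtain x where x: "x 0 = \<phi> p" "(x has_vector_derivative e) (at 0)" "\<And>t. x t \<in> S" "\<And>t. F (x t) = 0"
    by (rule curve_in_level_set[OF B C S pS smooth_on_subset[OF Fs SU] F0 sF De]) blast
  have xU: "x t \<in> \<phi> ` U" for t using x(3) SU by blast
  show ?thesis
  proof (rule that)
    show "diff_curve P (\<lambda>t. i (x t))" "velocity P (\<lambda>t. i (x t)) = D"
      using chart_curve[OF P U x(1,2) xU] unfolding i_def e by blast+
    show "i (x 0) = p" by (simp add: x(1) ip)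
    show "F1 (i (x t)) = F2 (i (x t))" for t
    proof -
      have W: "F1 (i (x t)) \<in> W" "F2 (i (x t)) \<in> W"
        using x(3)[of t] \<eta>(3) by (force simp: S_def)+
      have "\<psi> (F1 (i (x t))) - \<psi> (F2 (i (x t))) = F (x t)"
        unfolding F_def using YW[OF W(1)] YW[OF W(2)] by (simp add: scaleR_diff_left sum_subtractf)
      then have "\<psi> (F1 (i (x t))) = \<psi> (F2 (i (x t)))" by (simp add: x(4))
      then show ?thesis using chart_inj[OF N V(1)] W \<theta>(3) by (meson inj_onD subsetD)
    qed
  qed
qed

section \<open>The Poisson bivector field of a generalized complex structure\<close>

lemma tangent_space_add:
  assumes "u \<in> tangent_space M p" "v \<in> tangent_space M p" shows "u + v \<in> tangent_space M p"
  using assms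
  by (auto simp: tangent_space_def derivations_def dual_def linear_on_def algebra_simps)

lemma scaleR_fun_apply: "(k *\<^sub>R f) x = k *\<^sub>R f x"
  by (simp add: scaleR_fun_def)

lemma dual_zero: "\<alpha> \<in> dual V \<Longrightarrow> \<alpha> 0 = (0::real)"
  using dualD(2)[of \<alpha> V _ 0] dualD(3)[of \<alpha> V 0] by (metis mult_zero_left scaleR_zero_left)

section \<open>Brackets of vector fields, and derivatives of exact one-forms\<close>

context
  fixes M :: "('a, 'e::{real_inner,heine_borel}) manifold"
  assumes M: "charted M"
begin

lemma differential_cotangent: "differential M f p \<in> cotangent_space M p"
  unfolding differential_def cotangent_space_def
  by (rule on_space_dual) (auto simp: tangent_space_add tangent_space_scaleR scaleR_fun_apply)

lemma vector_field_tangent: "vector_field M X \<Longrightarrow> p \<in> points M \<Longrightarrow> X p \<in> tangent_space M p"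
  by (simp add: vector_field_def)

lemma vector_field_smooth: "vector_field M X \<Longrightarrow> f \<in> smooth_fun M \<Longrightarrow> (\<lambda>p. X p f) \<in> smooth_fun M"
  by (simp add: vector_field_def)

lemma one_form_differential:
  assumes f: "f \<in> smooth_fun M" shows "one_form M (differential M f)"
  unfolding one_form_def
proof (intro conjI ballI allI impI)
  fix X assume X: "vector_field M X"
  show "(\<lambda>p. differential M f p (X p)) \<in> smooth_fun M"
    by (rule smooth_fun_cong[OF M vector_field_smooth[OF X f]])
      (simp add: differential_def vector_field_tangent[OF X])
qed (rule differential_cotangent)

lemma vector_field_zero: "vector_field M (\<lambda>p. 0)"
  using smooth_fun_const[OF M, of 0] tangent_space_zero[OF M] by (simp add: vector_field_def)

text \<open>Each of the two second-order operators violates the Leibniz rule by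
  \<open>X f * Y g + X g * Y f\<close> at \<open>p\<close>. This is symmetric in \<open>X\<close>
  and \<open>Y\<close> and cancels in the commutator.\<close>

lemma lie_bracket_tangent:
  assumes X: "vector_field M X" and Y: "vector_field M Y" and p: "p \<in> points M"
  shows "lie_bracket X Y p \<in> tangent_space M p"
proof -
  note tX = vector_field_tangent[OF X] and tY = vector_field_tangent[OF Y]
  note sX = vector_field_smooth[OF X] and sY = vector_field_smooth[OF Y]
  have half: "X p (\<lambda>q. Y q (\<lambda>x. f x + g x)) = X p (\<lambda>q. Y q f) + X p (\<lambda>q. Y q g)"
    "X p (\<lambda>q. Y q (\<lambda>x. k * f x)) = k * X p (\<lambda>q. Y q f)"
    "X p (\<lambda>q. Y q (\<lambda>x. f x * g x))
      = f p * X p (\<lambda>q. Y q g) + g p * X p (\<lambda>q. Y q f) + X p f * Y p g + X p g * Y p f"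
    if X: "vector_field M X" and Y: "vector_field M Y"
      and f: "f \<in> smooth_fun M" and g: "g \<in> smooth_fun M" for X Y f g k
  proof -
    note tX = vector_field_tangent[OF X p]
    note tY = vector_field_tangent[OF Y]
    note sY = vector_field_smooth[OF Y]
    have "X p (\<lambda>q. Y q (\<lambda>x. f x + g x)) = X p (\<lambda>q. Y q f + Y q g)"
      by (rule tangent_cong[OF M p tX]) (rule tangent_add[OF M _ tY f g])
    then show "X p (\<lambda>q. Y q (\<lambda>x. f x + g x)) = X p (\<lambda>q. Y q f) + X p (\<lambda>q. Y q g)"
      by (simp add: tangent_add[OF M p tX sY[OF f] sY[OF g]])
    have "X p (\<lambda>q. Y q (\<lambda>x. k * f x)) = X p (\<lambda>q. k * Y q f)"
      by (rule tangent_cong[OF M p tX]) (rule tangent_scale[OF M _ tY f])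
    then show "X p (\<lambda>q. Y q (\<lambda>x. k * f x)) = k * X p (\<lambda>q. Y q f)"
      by (simp add: tangent_scale[OF M p tX sY[OF f]])
    have "X p (\<lambda>q. Y q (\<lambda>x. f x * g x)) = X p (\<lambda>q. f q * Y q g + g q * Y q f)"
      by (rule tangent_cong[OF M p tX]) (rule tangent_product[OF M _ tY f g])
    also have "\<dots> = X p (\<lambda>q. f q * Y q g) + X p (\<lambda>q. g q * Y q f)"
      by (rule tangent_add[OF M p tX smooth_fun_mult[OF M f sY[OF g]] smooth_fun_mult[OF M g sY[OF f]]])
    finally show "X p (\<lambda>q. Y q (\<lambda>x. f x * g x))
      = f p * X p (\<lambda>q. Y q g) + g p * X p (\<lambda>q. Y q f) + X p f * Y p g + X p g * Y p f"
      by (simp add: tangent_product[OF M p tX f sY[OF g]] tangent_product[OF M p tX g sY[OF f]])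
  qed
  have off: "X p (\<lambda>q. Y q f) = 0"
    if X: "vector_field M X" and Y: "vector_field M Y" and f: "f \<notin> smooth_fun M" for X Y f
  proof -
    have "X p (\<lambda>q. Y q f) = X p (\<lambda>q. 0)"
      by (rule tangent_cong[OF M p vector_field_tangent[OF X p]])
        (rule tangent_off[OF M _ vector_field_tangent[OF Y] f])
    then show ?thesis by (simp add: tangent_const[OF M p vector_field_tangent[OF X p]])
  qed
  have "lie_bracket X Y p \<in> dual (smooth_fun M)"
    unfolding lie_bracket_def
    by (rule dual_pointwiseI)
      (simp_all add: half(1,2)[OF X Y] half(1,2)[OF Y X] off[OF X Y] off[OF Y X] right_diff_distrib)
  then show ?thesis
    unfolding tangent_space_def derivations_def
    by (simp add: lie_bracket_def half(3)[OF X Y] half(3)[OF Y X] algebra_simps)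
qed

lemma lie_bracket_zero:
  assumes X: "vector_field M X" and p: "p \<in> points M" and Y: "\<And>q. q \<in> points M \<Longrightarrow> Y q = 0"
  shows "lie_bracket X Y p = 0" "lie_bracket Y X p = 0"
proof -
  have "X p (\<lambda>q. Y q f) = X p (\<lambda>q. 0)" for f
    by (rule tangent_cong[OF M p vector_field_tangent[OF X p]]) (simp add: Y)
  then have "X p (\<lambda>q. Y q f) = 0" for f
    by (simp add: tangent_const[OF M p vector_field_tangent[OF X p]])
  then show "lie_bracket X Y p = 0" "lie_bracket Y X p = 0"
    by (simp_all add: lie_bracket_def Y[OF p] fun_eq_iff)
qed

text \<open>The terms \<open>X (Z g)\<close> coming from the derivative and from the bracket cancel,
  whichever extension \<open>Z\<close> of the vector was chosen.\<close>

lemma lie_deriv_differential: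
  assumes X: "vector_field M X" and p: "p \<in> points M" and g: "g \<in> smooth_fun M"
  shows "lie_deriv M X (differential M g) p = differential M (\<lambda>q. X q g) p"
proof
  fix v
  show "lie_deriv M X (differential M g) p v = differential M (\<lambda>q. X q g) p v"
  proof (cases "v \<in> tangent_space M p")
    case True
    define Z where "Z = extend M p v"
    have Z: "vector_field M Z" "Z p = v" unfolding Z_def by (rule vector_field_extension[OF M p True])+
    have "X p (\<lambda>q. differential M g q (Z q)) = X p (\<lambda>q. Z q g)"
      by (rule tangent_cong[OF M p vector_field_tangent[OF X p]])
        (simp add: differential_def vector_field_tangent[OF Z(1)])
    moreover have "differential M g p (lie_bracket X Z p) = X p (\<lambda>q. Z q g) - v (\<lambda>q. X q g)"
      using lie_bracket_tangent[OF X Z(1) p] Z(2) by (simp add: differential_def lie_bracket_def)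
    ultimately show ?thesis
      using True by (simp add: lie_deriv_def Z_def[symmetric] Let_def differential_def)
  qed (simp add: lie_deriv_def differential_def)
qed

lemma lie_deriv_zero:
  assumes p: "p \<in> points M" and \<beta>: "\<beta> p \<in> cotangent_space M p"
  shows "lie_deriv M (\<lambda>p. 0) \<beta> p = 0"
proof
  fix v
  show "lie_deriv M (\<lambda>p. 0) \<beta> p v = 0 v"
  proof (cases "v \<in> tangent_space M p")
    case True
    have "lie_bracket (\<lambda>p. 0) (extend M p v) p = 0"
      by (rule lie_bracket_zero(2)[OF vector_field_extension(1)[OF M p True] p]) simp
    then show ?thesis
      using \<beta> dual_zero[of "\<beta> p"] by (simp add: lie_deriv_def Let_def True cotangent_space_def)
  qed (simp add: lie_deriv_def)
qed

text \<open>The identity \<open>d(dg) = 0\<close>: applied to \<open>g\<close>, the bracket of the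
  two extensions is the difference of the two derivative terms.\<close>

lemma ext_deriv_differential:
  assumes p: "p \<in> points M" and g: "g \<in> smooth_fun M" and u: "u \<in> tangent_space M p" and v: "v \<in> tangent_space M p"
  shows "ext_deriv M (differential M g) p u v = 0"
proof -
  define X where "X = extend M p u"
  define Y where "Y = extend M p v"
  have X: "vector_field M X" "X p = u" unfolding X_def by (rule vector_field_extension[OF M p u])+
  have Y: "vector_field M Y" "Y p = v" unfolding Y_def by (rule vector_field_extension[OF M p v])+
  have "u (\<lambda>q. differential M g q (Y q)) = u (\<lambda>q. Y q g)" "v (\<lambda>q. differential M g q (X q)) = v (\<lambda>q. X q g)"
    by (rule tangent_cong[OF M p u] tangent_cong[OF M p v],
        simp add: differential_def vector_field_tangent[OF Y(1)] vector_field_tangent[OF X(1)])+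
  moreover have "differential M g p (lie_bracket X Y p) = u (\<lambda>q. Y q g) - v (\<lambda>q. X q g)"
    using lie_bracket_tangent[OF X(1) Y(1) p] X(2) Y(2) by (simp add: differential_def lie_bracket_def)
  ultimately show ?thesis by (simp add: ext_deriv_def X_def[symmetric] Y_def[symmetric] Let_def)
qed

end

section \<open>Hamiltonian vector fields and the Jacobi identity\<close>

locale block_generalized_complex =
  fixes M :: "('a, 'e::{real_inner,heine_borel}) manifold" and J N \<pi> \<omega>
  assumes M: "charted M" and gcs: "generalized_complex_structure M J"
    and N: "tensor11_field M N" and bi: "bivector_field M \<pi>" and block: "block_form M J N \<pi> \<omega>"
begin

lemma J_linear: "p \<in> points M \<Longrightarrow> linear_on (P_space M p) (J p)"
  and J_space: "p \<in> points M \<Longrightarrow> u \<in> P_space M p \<Longrightarrow> J p u \<in> P_space M p"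
  and J_section: "P_section M e \<Longrightarrow> P_section M (\<lambda>p. J p (e p))"
  and J_square: "p \<in> points M \<Longrightarrow> u \<in> P_space M p \<Longrightarrow> J p (J p u) = - u"
  and J_integrable: "eigen_section M J s \<Longrightarrow> eigen_section M J t \<Longrightarrow> eigen_section M J (dorfman_complex M s t)"
  using gcs unfolding generalized_complex_structure_def by blast+

lemma covector_in_P_space: "\<alpha> \<in> cotangent_space M p \<Longrightarrow> (0, \<alpha>) \<in> P_space M p"
  by (simp add: P_space_def tangent_space_zero[OF M])

lemma fst_J_covector:
  assumes p: "p \<in> points M" and \<alpha>: "\<alpha> \<in> cotangent_space M p"
  shows "fst (J p (0, \<alpha>)) = sharp M \<pi> p \<alpha>"
proof -
  have "N p (0 *\<^sub>R 0) = 0 *\<^sub>R N p 0"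
    using N p tangent_space_zero[OF M] unfolding tensor11_field_def linear_on_def by blast
  then have "N p 0 = 0" by simp
  then show ?thesis using block p \<alpha> tangent_space_zero[OF M] by (simp add: block_form_def)
qed

definition dsec :: "('a \<Rightarrow> real) \<Rightarrow> 'a \<Rightarrow> 'a gvec" where
  "dsec f p = (0, differential M f p)"

definition ham :: "('a \<Rightarrow> real) \<Rightarrow> 'a \<Rightarrow> 'a tvec" where
  "ham f p = fst (J p (dsec f p))"

definition torsion :: "('a \<Rightarrow> real) \<Rightarrow> 'a \<Rightarrow> 'a covec" where
  "torsion f p = on_space (tangent_space M p) (ext_deriv M (\<lambda>q. snd (J q (dsec f q))) p 0)"

lemma dsec_simps: "fst (dsec f p) = 0" "snd (dsec f p) = differential M f p"
  by (simp_all add: dsec_def)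

lemma dsec_section: "f \<in> smooth_fun M \<Longrightarrow> P_section M (dsec f)"
  by (simp add: P_section_def dsec_simps vector_field_zero[OF M] one_form_differential[OF M])

lemma dsec_space: "dsec f p \<in> P_space M p"
  unfolding dsec_def by (rule covector_in_P_space[OF differential_cotangent[OF M]])

lemma ham_vector_field: "f \<in> smooth_fun M \<Longrightarrow> vector_field M (ham f)"
  using J_section[OF dsec_section, of f] by (simp add: P_section_def ham_def[symmetric])

lemma ham_tangent: "f \<in> smooth_fun M \<Longrightarrow> p \<in> points M \<Longrightarrow> ham f p \<in> tangent_space M p"
  by (rule vector_field_tangent[OF M ham_vector_field])

lemma ham_sharp: "p \<in> points M \<Longrightarrow> ham f p = sharp M \<pi> p (differential M f p)"
  by (simp add: ham_def dsec_def fst_J_covector differential_cotangent[OF M])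

lemma ham_apply: "p \<in> points M \<Longrightarrow> g \<in> smooth_fun M \<Longrightarrow> ham f p g = poisson_bracket M \<pi> f g p"
  by (simp add: ham_sharp sharp_def poisson_bracket_def)

lemma eigen_section_dsec:
  assumes f: "f \<in> smooth_fun M" shows "eigen_section M J (\<lambda>p. J p (dsec f p), dsec f)"
  using dsec_section[OF f] J_section[OF dsec_section[OF f]] J_square dsec_space
  by (simp add: eigen_section_def)

text \<open>The \<open>torsion\<close> term is \<open>i\<^sub>0 d\<sigma>\<close> for the one-form part \<open>\<sigma>\<close> of \<open>J (0, df)\<close>.  It is zero because \<open>d\<sigma>\<close>
  is a tensor, but it suffices that \<open>\<pi>\<^sup>\<sharp>\<close> kills it, and this is the case \<open>g = 0\<close> of the second claim.\<close>

lemma ham_bracket_torsion: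
  assumes f: "f \<in> smooth_fun M" and g: "g \<in> smooth_fun M" and p: "p \<in> points M"
  shows "differential M (\<lambda>q. ham f q g) p - torsion f p \<in> cotangent_space M p"
    and "sharp M \<pi> p (differential M (\<lambda>q. ham f q g) p - torsion f p) = lie_bracket (ham f) (ham g) p"
proof -
  let ?s = "dorfman_complex M (\<lambda>p. J p (dsec f p), dsec f) (\<lambda>p. J p (dsec g p), dsec g)"
  let ?\<sigma> = "\<lambda>g q. snd (J q (dsec g q))"
  have eig: "eigen_section M J ?s" by (rule J_integrable[OF eigen_section_dsec[OF f] eigen_section_dsec[OF g]])
  have \<sigma>: "?\<sigma> g p \<in> cotangent_space M p"
    using J_space[OF p dsec_space, of g] by (simp add: P_space_def mem_Times_iff)
  have ext: "on_space (tangent_space M p) (ext_deriv M (differential M f) p (ham g p)) = 0"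
    by (auto simp: on_space_def fun_eq_iff
        intro!: ext_deriv_differential[OF M p f ham_tangent[OF g p]])
  \<comment> \<open>The imaginary part of the complex bracket. Since \<open>dsec\<close> has no
    vector part and a closed one-form part, what survives is the Lie derivative of \<open>dg\<close>
    along \<open>ham f\<close> and the contraction with the zero vector, which is
    \<open>torsion f\<close>.\<close>
  have snd: "snd ?s p = (0, differential M (\<lambda>q. ham f q g) p - torsion f p)"
    using lie_bracket_zero[OF M ham_vector_field[OF f] p, of "\<lambda>q. 0"]
      lie_bracket_zero[OF M ham_vector_field[OF g] p, of "\<lambda>q. 0"]
      lie_deriv_differential[OF M ham_vector_field[OF f] p g] lie_deriv_zero[where \<beta> = "?\<sigma> g", OF M p \<sigma>] ext
    by (simp add: dorfman_complex_def dorfman_def dsec_simps Let_def torsion_def ham_def[symmetric])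
  have fst: "fst (fst ?s p) = lie_bracket (ham f) (ham g) p"
    using lie_bracket_zero[OF M vector_field_zero[OF M] p, of "\<lambda>q. 0"]
    by (simp add: dorfman_complex_def dorfman_def dsec_simps Let_def ham_def[symmetric])
  show c: "differential M (\<lambda>q. ham f q g) p - torsion f p \<in> cotangent_space M p"
    using eig p snd by (auto simp: eigen_section_def P_section_def one_form_def)
  show "sharp M \<pi> p (differential M (\<lambda>q. ham f q g) p - torsion f p) = lie_bracket (ham f) (ham g) p"
  proof -
    \<comment> \<open>In the \<open>+i\<close>-eigenbundle \<open>J\<close> sends the imaginary part
      of a section to its real part.\<close>
    have "J p (snd ?s p) = fst ?s p" using eig p unfolding eigen_section_def by blast
    then have "fst (J p (snd ?s p)) = lie_bracket (ham f) (ham g) p" using fst by simp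
    then show ?thesis unfolding snd fst_J_covector[OF p c] .
  qed
qed

lemma sharp_torsion:
  assumes f: "f \<in> smooth_fun M" and p: "p \<in> points M"
  shows "torsion f p \<in> cotangent_space M p" and "sharp M \<pi> p (torsion f p) = 0"
proof -
  let ?z = "\<lambda>q::'a. 0::real"
  have z: "?z \<in> smooth_fun M" by (rule smooth_fun_const[OF M])
  have dz: "differential M g q = 0" if q: "q \<in> points M" and g: "\<And>x. x \<in> points M \<Longrightarrow> g x = 0" for g q
  proof
    show "differential M g q v = 0 v" for v
    proof (cases "v \<in> tangent_space M q")
      case True
      have "v g = v ?z" by (rule tangent_cong[OF M q True g])
      then show ?thesis using True tangent_const[OF M q True] by (simp add: differential_def)
    qed (simp add: differential_def)
  qed
  have hz: "ham f q ?z = 0" if q: "q \<in> points M" for q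
    by (rule tangent_const[OF M q ham_tangent[OF f q]])
  have 0: "ham ?z q = 0" if q: "q \<in> points M" for q
  proof -
    have "J q (0 *\<^sub>R dsec ?z q) = 0 *\<^sub>R J q (dsec ?z q)"
      using J_linear[OF q] dsec_space[of ?z q] unfolding linear_on_def by blast
    then show ?thesis by (simp add: ham_def dsec_def dz[OF q] zero_prod_def[symmetric])
  qed
  have d0: "differential M (\<lambda>q. ham f q ?z) p = 0" by (rule dz[OF p hz])
  have c: "- torsion f p \<in> cotangent_space M p"
    using ham_bracket_torsion(1)[OF f z p] d0 by simp
  have s: "sharp M \<pi> p (- torsion f p) = 0"
    using ham_bracket_torsion(2)[OF f z p] d0 lie_bracket_zero(1)[OF M ham_vector_field[OF f] p, of "ham ?z"] 0
    by simp
  have m: "- \<alpha> = (-1) *\<^sub>R \<alpha>" for \<alpha> :: "'a covec" by simp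
  have sc: "(-1) *\<^sub>R \<alpha> \<in> cotangent_space M p" if "\<alpha> \<in> cotangent_space M p" for \<alpha>
    using that by (auto simp: cotangent_space_def dual_def linear_on_def algebra_simps)
  from sc[OF c] show t: "torsion f p \<in> cotangent_space M p" by simp
  have "J p ((-1) *\<^sub>R (0, - torsion f p)) = (-1) *\<^sub>R J p (0, - torsion f p)"
    using J_linear[OF p] covector_in_P_space[OF c] unfolding linear_on_def by blast
  then show "sharp M \<pi> p (torsion f p) = 0"
    using fst_J_covector[OF p c] fst_J_covector[OF p t] s by simp
qed

text \<open>The torsion term lies in the kernel of \<open>\<pi>\<^sup>\<sharp>\<close>, so by
  linearity of \<open>J\<close> it can be added back to the covector without changing the
  image.\<close>

lemma ham_bracket:
  assumes f: "f \<in> smooth_fun M" and g: "g \<in> smooth_fun M" and p: "p \<in> points M"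
  shows "lie_bracket (ham f) (ham g) p = ham (\<lambda>q. ham f q g) p"
proof -
  let ?d = "differential M (\<lambda>q. ham f q g) p"
  note c = ham_bracket_torsion(1)[OF f g p] and t = sharp_torsion[OF f p]
  have "J p ((0, ?d - torsion f p) + (0, torsion f p)) = J p (0, ?d - torsion f p) + J p (0, torsion f p)"
    using J_linear[OF p] covector_in_P_space[OF c] covector_in_P_space[OF t(1)] unfolding linear_on_def by blast
  then have "J p (0, ?d) = J p (0, ?d - torsion f p) + J p (0, torsion f p)" by simp
  then have "fst (J p (0, ?d)) = fst (J p (0, ?d - torsion f p)) + fst (J p (0, torsion f p))" by simp
  then have "sharp M \<pi> p ?d = sharp M \<pi> p (?d - torsion f p) + sharp M \<pi> p (torsion f p)"
    by (simp only: fst_J_covector[OF p c] fst_J_covector[OF p t(1)]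
        fst_J_covector[OF p differential_cotangent[OF M]])
  then show ?thesis using t(2) ham_bracket_torsion(2)[OF f g p] ham_sharp[OF p] by simp
qed

lemma poisson_bracket_antisym:
  "p \<in> points M \<Longrightarrow> poisson_bracket M \<pi> g f p = - poisson_bracket M \<pi> f g p"
  using bi differential_cotangent[OF M]
  unfolding bivector_field_def alternating_on_def poisson_bracket_def by blast

lemma poisson: "poisson_structure M \<pi>"
  unfolding poisson_structure_def
proof (intro conjI ballI bi)
  fix f g h p
  assume f: "f \<in> smooth_fun M" and g: "g \<in> smooth_fun M" and h: "h \<in> smooth_fun M" and p: "p \<in> points M"
  let ?B = "poisson_bracket M \<pi>"
  have Bs: "?B f g \<in> smooth_fun M" if "f \<in> smooth_fun M" "g \<in> smooth_fun M" for f g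
    by (rule smooth_fun_cong[OF M vector_field_smooth[OF M ham_vector_field[OF that(1)] that(2)]])
      (rule ham_apply[OF _ that(2)])
  have BB: "?B f (?B g h) p = ham f p (\<lambda>q. ham g q h)"
    if f: "f \<in> smooth_fun M" and g: "g \<in> smooth_fun M" and h: "h \<in> smooth_fun M" for f g h
    unfolding ham_apply[OF p Bs[OF g h], symmetric]
    by (rule tangent_cong[OF M p ham_tangent[OF f p]])
      (simp add: ham_apply[OF _ h])
  have "differential M (\<lambda>q. ham f q g) p = differential M (?B f g) p"
  proof
    show "differential M (\<lambda>q. ham f q g) p v = differential M (?B f g) p v" for v
    proof (cases "v \<in> tangent_space M p")
      case True
      have "v (\<lambda>q. ham f q g) = v (?B f g)" by (rule tangent_cong[OF M p True]) (rule ham_apply[OF _ g])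
      then show ?thesis using True by (simp add: differential_def)
    qed (simp add: differential_def)
  qed
  \<comment> \<open>Evaluated on \<open>h\<close>, the bracket relation of Hamiltonian fields is the
    Jacobi identity in Leibniz form; antisymmetry will turn it into the cyclic sum.\<close>
  then have "?B (?B f g) h p = lie_bracket (ham f) (ham g) p h"
    using ham_bracket[OF f g p] ham_sharp[OF p] ham_apply[OF p h] by simp
  also have "\<dots> = ?B f (?B g h) p - ?B g (?B f h) p"
    by (simp add: lie_bracket_def BB f g h)
  finally have 1: "?B (?B f g) h p = ?B f (?B g h) p - ?B g (?B f h) p" .
  \<comment> \<open>Antisymmetry is known at points of the manifold, so the sign of the inner
    bracket is moved under \<open>ham g\<close> by \<open>tangent_cong\<close>.\<close>
  have 2: "?B g (?B h f) p = - ?B g (?B f h) p"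
  proof -
    have "ham g p (\<lambda>q. ham h q f) = ham g p (\<lambda>q. (-1) * ham f q h)"
      by (rule tangent_cong[OF M p ham_tangent[OF g p]])
        (simp add: ham_apply[OF _ h] ham_apply[OF _ f] poisson_bracket_antisym[of _ h f])
    also have "\<dots> = (-1) * ham g p (\<lambda>q. ham f q h)"
      by (rule tangent_scale[OF M p ham_tangent[OF g p]
            vector_field_smooth[OF M ham_vector_field[OF f] h]])
    finally show ?thesis by (simp add: BB f g h)
  qed
  show "?B f (?B g h) p + ?B g (?B h f) p + ?B h (?B f g) p = 0"
    using 1 2 poisson_bracket_antisym[OF p, of "?B f g" h] by simp
qed

end

section \<open>Tangent vectors of products and smooth maps\<close>

lemma push_compose:
  assumes "\<And>h. h \<in> smooth_fun N \<Longrightarrow> (\<lambda>x. h (F x)) \<in> smooth_fun M"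
  shows "push N F (push M G D) = push N (\<lambda>x. F (G x)) D"
  using assms by (auto simp: push_def on_space_def o_def fun_eq_iff)

lemma push_zero: "push N F 0 = 0"
  by (auto simp: push_def on_space_def fun_eq_iff)

lemma smooth_map_pullback:
  assumes "charted M" "smooth_map M N F" "h \<in> smooth_fun N"
  shows "(\<lambda>x. h (F x)) \<in> smooth_fun M"
  using assms smooth_fun_on_self[OF assms(1)] by (auto simp: smooth_map_on_def o_def)

lemma push_tangent:
  assumes "charted M" "charted N" "smooth_map M N F" "v \<in> tangent_space M p"
  shows "push N F v \<in> tangent_space N (F p)"
  using push_derivation[OF assms(2,3)] assms(4) by (simp add: tangent_space_eq[OF assms(1)])

lemma push_curve:
  assumes M: "charted M" and c: "diff_curve M c" and F: "smooth_map M N F"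
  shows "diff_curve N (\<lambda>t. F (c t))"
    and "push N F (velocity M c) = velocity N (\<lambda>t. F (c t))"
  using push_curve_vec[OF M c F diff_curve_point[OF M c]] by (simp_all only: smooth_fun_on_self[OF M])

lemma const_curve:
  assumes "p \<in> points M"
  shows "diff_curve M (\<lambda>t. p)" and "velocity M (\<lambda>t. p) = 0"
  using assms by (auto simp: diff_curve_def curve_vec_def on_space_def fun_eq_iff intro: DERIV_const)

lemma smooth_fun_positive_nbhd:
  assumes M: "charted M" and f: "f \<in> smooth_fun M" and p: "p \<in> points M" "f p > 0"
  obtains V where "openin (mtop M) V" "p \<in> V" "\<And>q. q \<in> V \<Longrightarrow> f q > 0"
proof -
  obtain U \<phi> where U: "(U, \<phi>) \<in> atlas M" "p \<in> U" using chart_exists[OF M p(1)] .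
  define X where "X = \<phi> ` U \<inter> (\<lambda>x. f (inv_into U \<phi> x)) -` {0<..}"
  have X: "open X"
    unfolding X_def
    by (rule continuous_open_preimage[OF smooth_on_continuous[OF smooth_fun_chart[OF M U(1) f]]
          chart_open_range[OF M U(1)] open_greaterThan])
  have iff: "\<phi> q \<in> X \<longleftrightarrow> f q > 0" if "q \<in> U" for q
    using that chart_inv[OF M U(1) that] by (simp add: X_def)
  show ?thesis
    by (rule that[OF chart_openin_preimage[OF M U(1) X]]) (use U(2) p(2) iff in auto)
qed

text \<open>The composite of \<open>f\<close> and \<open>H\<close> has an ambient extension only
  near \<open>F p\<close>, so continuity of \<open>F\<close> is required. As smoothness is defined
  by pullbacks, it is recovered from a cutoff at \<open>F p\<close>: the ambient extension of its
  pullback is positive on a neighbourhood of \<open>p\<close>. The case in view is multiplication,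
  which is smooth on composable pairs.\<close>

lemma smooth_map_on_compose:
  assumes M: "charted M" and N: "charted N" and S: "S \<subseteq> points M"
    and F: "smooth_map_on M S N F" and H: "smooth_map_on N T K H" and FT: "F ` S \<subseteq> T"
  shows "smooth_map_on M S K (\<lambda>x. H (F x))"
  unfolding smooth_map_on_def
proof (intro conjI ballI)
  show "(\<lambda>x. H (F x)) ` S \<subseteq> points K" using H FT by (auto simp: smooth_map_on_def)
  fix f assume f: "f \<in> smooth_fun K"
  show "f \<circ> (\<lambda>x. H (F x)) \<in> smooth_fun_on M S"
    unfolding smooth_fun_on_def
  proof (intro CollectI ballI)
    fix p assume p: "p \<in> S"
    have "f \<circ> H \<in> smooth_fun_on N T" using H f by (simp add: smooth_map_on_def)
    then obtain W g where W: "openin (mtop N) W" "F p \<in> W" "g \<in> smooth_fun N" "\<forall>q\<in>T \<inter> W. (f \<circ> H) q = g q"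
      unfolding smooth_fun_on_def using p FT by blast
    obtain \<theta> where \<theta>: "\<theta> \<in> smooth_fun N" "\<theta> (F p) = 1" "\<And>q. q \<notin> W \<Longrightarrow> \<theta> q = 0"
      by (rule manifold_cutoff[OF N W(1,2)]) blast
    have "\<theta> \<circ> F \<in> smooth_fun_on M S" "g \<circ> F \<in> smooth_fun_on M S"
      using F \<theta>(1) W(3) by (auto simp: smooth_map_on_def)
    then obtain V k V' k' where V: "openin (mtop M) V" "p \<in> V" "k \<in> smooth_fun M" "\<forall>q\<in>S \<inter> V. (\<theta> \<circ> F) q = k q"
      and V': "openin (mtop M) V'" "p \<in> V'" "k' \<in> smooth_fun M" "\<forall>q\<in>S \<inter> V'. (g \<circ> F) q = k' q"
      unfolding smooth_fun_on_def using p by blast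
    have kp: "k p > 0" using V(2,4) p \<theta>(2) by force
    have pM: "p \<in> points M" using S p by blast
    obtain E where E: "openin (mtop M) E" "p \<in> E" "\<And>q. q \<in> E \<Longrightarrow> k q > 0"
      by (rule smooth_fun_positive_nbhd[OF M V(3) pM kp]) blast
    have "(f \<circ> (\<lambda>x. H (F x))) q = k' q" if q: "q \<in> S \<inter> (E \<inter> V \<inter> V')" for q
    proof -
      have "\<theta> (F q) > 0" using q V(4) E(3)[of q] by auto
      then have "F q \<in> T \<inter> W" using \<theta>(3)[of "F q"] FT q by auto
      then show ?thesis using W(4) V'(4) q by auto
    qed
    then show "\<exists>W g. openin (mtop M) W \<and> p \<in> W \<and> g \<in> smooth_fun M \<and> (\<forall>q\<in>S \<inter> W. (f \<circ> (\<lambda>x. H (F x))) q = g q)"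
      using E V V' by (intro exI[of _ "E \<inter> V \<inter> V'"] exI[of _ k']) auto
  qed
qed

context
  fixes M :: "('a, 'e::{real_inner,heine_borel}) manifold" and N :: "('b, 'f::{real_inner,heine_borel}) manifold"
  assumes M: "charted M" and N: "charted N"
begin

lemma smooth_map_slice_fst: "q \<in> points N \<Longrightarrow> smooth_map M (prod_manifold M N) (\<lambda>x. (x, q))"
  using smooth_fun_slice_fst[OF M N] by (auto simp: smooth_map_on_def smooth_fun_on_self[OF M] o_def)

lemma smooth_map_slice_snd: "p \<in> points M \<Longrightarrow> smooth_map N (prod_manifold M N) (\<lambda>y. (p, y))"
  using smooth_fun_slice_snd[OF M N] by (auto simp: smooth_map_on_def smooth_fun_on_self[OF N] o_def)

lemma prod_tangent_exists:
  assumes p: "p \<in> points M" "v \<in> tangent_space M p" and q: "q \<in> points N" "w \<in> tangent_space N q"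
  obtains D where "D \<in> tangent_space (prod_manifold M N) (p, q)" "push M fst D = v" "push N snd D = w"
proof -
  obtain c where c: "diff_curve M c" "c 0 = p" "velocity M c = v" by (rule tangent_curve[OF M p])
  obtain d where d: "diff_curve N d" "d 0 = q" "velocity N d = w" by (rule tangent_curve[OF N q])
  note cd = pair_diff_curve(1)[OF M N c(1) d(1)]
  note P = prod_charted[OF M N]
  show ?thesis
    using that[OF curve_vec_tangent[OF P cd, simplified c(2) d(2)]]
      push_curve(2)[OF P cd smooth_map_fst[OF M N subset_refl]]
      push_curve(2)[OF P cd smooth_map_snd[OF M N subset_refl]] c(3) d(3) by simp
qed

lemma covec_components:
  assumes p: "p \<in> points M" and q: "q \<in> points N" and \<xi>: "\<xi> \<in> cotangent_space (prod_manifold M N) (p, q)"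
  shows "covec_fst M N (p, q) \<xi> \<in> cotangent_space M p" "covec_snd M N (p, q) \<xi> \<in> cotangent_space N q"
proof -
  have push: "push K F (u + v) = push K F u + push K F v" "push K F (k *\<^sub>R u) = k *\<^sub>R push K F u"
    for K :: "('c, 'h::real_normed_vector) manifold" and F :: "'d \<Rightarrow> 'c" and u v k
    by (auto simp: push_def on_space_def fun_eq_iff scaleR_fun_apply)
  note t1 = push_tangent[OF M prod_charted[OF M N] smooth_map_slice_fst[OF q]]
  note t2 = push_tangent[OF N prod_charted[OF M N] smooth_map_slice_snd[OF p]]
  note d = dualD(1,2)[OF \<xi>[unfolded cotangent_space_def]]
  show "covec_fst M N (p, q) \<xi> \<in> cotangent_space M p"
    unfolding covec_fst_def cotangent_space_def prod.case
    by (rule on_space_dual) (simp_all add: tangent_space_add tangent_space_scaleR push t1 d)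
  show "covec_snd M N (p, q) \<xi> \<in> cotangent_space N q"
    unfolding covec_snd_def cotangent_space_def prod.case
    by (rule on_space_dual) (simp_all add: tangent_space_add tangent_space_scaleR push t2 d)
qed

lemma covec_differential:
  assumes p: "p \<in> points M" and q: "q \<in> points N" and f: "f \<in> smooth_fun (prod_manifold M N)"
  shows "covec_fst M N (p, q) (differential (prod_manifold M N) f (p, q)) = differential M (\<lambda>x. f (x, q)) p"
    and "covec_snd M N (p, q) (differential (prod_manifold M N) f (p, q)) = differential N (\<lambda>y. f (p, y)) q"
  using push_tangent[OF M prod_charted[OF M N] smooth_map_slice_fst[OF q]]
    push_tangent[OF N prod_charted[OF M N] smooth_map_slice_snd[OF p]] f
  by (auto simp: covec_fst_def covec_snd_def differential_def on_space_def fun_eq_iff push_def o_def)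

text \<open>The velocity of a pair is the sum of the velocities with one component frozen, and the
  components of a covector are its pullbacks along exactly these slices.\<close>

lemma covec_pair_curve:
  assumes c: "diff_curve M c" and d: "diff_curve N d"
    and \<xi>: "\<xi> \<in> cotangent_space (prod_manifold M N) (c 0, d 0)"
  shows "\<xi> (velocity (prod_manifold M N) (\<lambda>t. (c t, d t))) =
    covec_fst M N (c 0, d 0) \<xi> (velocity M c) +
    covec_snd M N (c 0, d 0) \<xi> (velocity N d)"
proof -
  let ?P = "prod_manifold M N"
  let ?v = "push ?P (\<lambda>x. (x, d 0)) (velocity M c)"
  let ?w = "push ?P (\<lambda>y. (c 0, y)) (velocity N d)"
  have v: "?v \<in> tangent_space ?P (c 0, d 0)"
    by (rule push_tangent[OF M prod_charted[OF M N] smooth_map_slice_fst[OF diff_curve_point[OF N d]] curve_vec_tangent[OF M c]])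
  have w: "?w \<in> tangent_space ?P (c 0, d 0)"
    by (rule push_tangent[OF N prod_charted[OF M N] smooth_map_slice_snd[OF diff_curve_point[OF M c]] curve_vec_tangent[OF N d]])
  have "velocity ?P (\<lambda>t. (c t, d t)) = ?v + ?w"
  proof
    show "velocity ?P (\<lambda>t. (c t, d t)) f = (?v + ?w) f" for f
      by (cases "f \<in> smooth_fun ?P")
        (simp_all add: pair_diff_curve(2)[OF M N c d] push_def o_def, simp add: curve_vec_def)
  qed
  then show ?thesis
    using dualD(1)[OF \<xi>[unfolded cotangent_space_def] v w] curve_vec_tangent[OF M c] curve_vec_tangent[OF N d]
    by (simp add: covec_fst_def covec_snd_def)
qed

end

section \<open>Curves in a Lie groupoid\<close>

locale lie_groupoid_curves =
  fixes G :: "('g, 'm, 'e::{real_inner,heine_borel}, 'f::{real_inner,heine_borel}) lie_groupoid"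
  assumes lie: "is_lie_groupoid G"
begin

abbreviation M where "M \<equiv> arr_mfd G"
abbreviation B where "B \<equiv> obj_mfd G"
abbreviation MM where "MM \<equiv> prod_manifold M M"
abbreviation vel where "vel \<equiv> velocity M"

section \<open>Algebra of arrows\<close>

lemma gpd: "is_groupoid G"
  using lie by (simp add: is_lie_groupoid_def)

lemma src_tgt_obj: "g \<in> arr G \<Longrightarrow> src G g \<in> obj G \<and> tgt G g \<in> obj G"
  using gpd unfolding is_groupoid_def by blast

lemma composable_iff: "(g, h) \<in> composable G \<longleftrightarrow> g \<in> arr G \<and> h \<in> arr G \<and> src G g = tgt G h"
  by (simp add: composable_def)

lemma mul_arr:
  assumes "(g, h) \<in> composable G"
  shows "mul G g h \<in> arr G" "src G (mul G g h) = src G h" "tgt G (mul G g h) = tgt G g"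
  using gpd assms unfolding is_groupoid_def by blast+

lemma mul_assoc:
  "(g, h) \<in> composable G \<Longrightarrow> (h, k) \<in> composable G \<Longrightarrow> mul G (mul G g h) k = mul G g (mul G h k)"
  using gpd unfolding is_groupoid_def by blast

lemma idt_arr:
  assumes "x \<in> obj G" shows "idt G x \<in> arr G" "src G (idt G x) = x" "tgt G (idt G x) = x"
  using gpd assms unfolding is_groupoid_def by blast+

lemma mul_idt:
  assumes "g \<in> arr G" shows "mul G g (idt G (src G g)) = g" "mul G (idt G (tgt G g)) g = g"
  using gpd assms unfolding is_groupoid_def by blast+

lemma ivt_arr:
  assumes "g \<in> arr G"
  shows "ivt G g \<in> arr G" "src G (ivt G g) = tgt G g" "tgt G (ivt G g) = src G g"
    "mul G g (ivt G g) = idt G (tgt G g)" "mul G (ivt G g) g = idt G (src G g)"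
  using gpd assms unfolding is_groupoid_def by blast+

lemma mul_ivt_cancel:
  assumes "(g, h) \<in> composable G" shows "mul G (mul G g h) (ivt G h) = g"
proof -
  have g: "g \<in> arr G" "h \<in> arr G" "src G g = tgt G h" using assms by (auto simp: composable_iff)
  have "mul G (mul G g h) (ivt G h) = mul G g (mul G h (ivt G h))"
    by (rule mul_assoc[OF assms]) (simp add: composable_iff g ivt_arr[OF g(2)])
  then show ?thesis using ivt_arr(4)[OF g(2)] mul_idt(1)[OF g(1)] g(3) by simp
qed

lemma ivt_ivt:
  assumes h: "h \<in> arr G" shows "ivt G (ivt G h) = h"
proof -
  note h' = ivt_arr[OF h] and h'' = ivt_arr[OF ivt_arr(1)[OF h]]
  have c: "(ivt G (ivt G h), ivt G h) \<in> composable G" "(ivt G h, h) \<in> composable G"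
    by (simp_all add: composable_iff h h' h'')
  have "ivt G (ivt G h) = mul G (ivt G (ivt G h)) (mul G (ivt G h) h)"
    using mul_idt(1)[OF h''(1)] by (simp add: h' h'')
  also have "\<dots> = mul G (mul G (ivt G (ivt G h)) (ivt G h)) h"
    by (rule mul_assoc[OF c, symmetric])
  also have "\<dots> = h" using mul_idt(2)[OF h] by (simp add: h' h'')
  finally show ?thesis .
qed

lemma ivt_idt:
  assumes x: "x \<in> obj G" shows "ivt G (idt G x) = idt G x"
proof -
  note e = idt_arr[OF x] and e' = ivt_arr[OF idt_arr(1)[OF x]]
  have "ivt G (idt G x) = mul G (ivt G (idt G x)) (idt G (src G (ivt G (idt G x))))"
    by (rule mul_idt(1)[OF e'(1), symmetric])
  also have "\<dots> = mul G (ivt G (idt G x)) (idt G x)" by (simp only: e'(2) e(3))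
  also have "\<dots> = idt G x" by (simp only: e'(5) e(2))
  finally show ?thesis .
qed

text \<open>Inserting \<open>k^(-1) k\<close> in the middle. As \<open>k\<close> runs through the
  source fibre of \<open>src G g\<close>, the composable pair moves while its product stays
  fixed.\<close>

lemma mul_translate:
  assumes gh: "(g, h) \<in> composable G" and k: "k \<in> arr G" "src G k = src G g"
  shows "(mul G g (ivt G k), mul G k h) \<in> composable G"
    and "mul G (mul G g (ivt G k)) (mul G k h) = mul G g h"
proof -
  have g: "g \<in> arr G" "h \<in> arr G" "src G g = tgt G h" using gh by (auto simp: composable_iff)
  note k' = ivt_arr[OF k(1)]
  have c: "(g, ivt G k) \<in> composable G" "(k, h) \<in> composable G" "(ivt G k, k) \<in> composable G"
    using g k k' by (simp_all add: composable_iff)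
  have c2: "(ivt G k, mul G k h) \<in> composable G"
    using mul_arr[OF c(2)] k' by (simp add: composable_iff)
  show "(mul G g (ivt G k), mul G k h) \<in> composable G"
    using mul_arr[OF c(1)] mul_arr[OF c(2)] k' by (simp add: composable_iff)
  have "mul G (mul G g (ivt G k)) (mul G k h) = mul G g (mul G (ivt G k) (mul G k h))"
    by (rule mul_assoc[OF c(1) c2])
  also have "mul G (ivt G k) (mul G k h) = mul G (mul G (ivt G k) k) h"
    by (rule mul_assoc[OF c(3,2), symmetric])
  also have "\<dots> = h" using mul_idt(2)[OF g(2)] k' k g by simp
  finally show "mul G (mul G g (ivt G k)) (mul G k h) = mul G g h" .
qed

section \<open>Smooth structure maps and multiplication of tangent vectors\<close>

lemma charted_M: "charted M" and charted_B: "charted B"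
  and points_M: "points M = arr G" and points_B: "points B = obj G"
  and submersion_src: "submersion M B (src G)" and submersion_tgt: "submersion M B (tgt G)"
  and ivt_smooth: "smooth_map M M (ivt G)"
  and mul_smooth: "smooth_map_on MM (composable G) M (\<lambda>(g, h). mul G g h)"
  using lie smooth_manifold_imp_charted unfolding is_lie_groupoid_def by blast+

lemma charted_MM: "charted MM"
  by (rule prod_charted[OF charted_M charted_M])

lemma src_smooth: "smooth_map M B (src G)"
  using submersion_src unfolding submersion_def by (elim conjE)

lemma tgt_smooth: "smooth_map M B (tgt G)"
  using submersion_tgt unfolding submersion_def by (elim conjE)

lemma src_submersion: "g \<in> arr G \<Longrightarrow> push B (src G) ` tangent_space M g = tangent_space B (src G g)"
  using submersion_src unfolding submersion_def points_M by blast

lemma tgt_submersion: "g \<in> arr G \<Longrightarrow> push B (tgt G) ` tangent_space M g = tangent_space B (tgt G g)"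
  using submersion_tgt unfolding submersion_def points_M by blast

lemma composable_subset: "composable G \<subseteq> points MM"
proof (rule subsetI)
  fix z assume "z \<in> composable G"
  then show "z \<in> points MM" by (cases z) (simp add: composable_iff points_M)
qed

text \<open>Composable pairs form the coincidence set of \<open>src\<close> on the first factor and
  \<open>tgt\<close> on the second. Regularity comes from the first factor: \<open>src\<close> is a
  submersion, so vectors with zero second component already produce every value.\<close>

lemma composable_curve:
  assumes gh: "(g, h) \<in> composable G" and v: "v \<in> tangent_space M g" and w: "w \<in> tangent_space M h"
    and vw: "Tsrc G v = Ttgt G w"
  obtains a b where "diff_curve M a" "diff_curve M b" "a 0 = g" "b 0 = h" "vel a = v" "vel b = w"
    "\<And>t. (a t, b t) \<in> composable G"
proof -
  have g: "g \<in> points M" "h \<in> points M" "src G g = tgt G h" using gh points_M by (auto simp: composable_iff)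
  have pf: "(\<lambda>x. f (src G x)) \<in> smooth_fun M" "(\<lambda>x. f (tgt G x)) \<in> smooth_fun M" if "f \<in> smooth_fun B" for f
    using smooth_map_pullback[OF charted_M _ that] src_smooth tgt_smooth by blast+
  have F1: "smooth_map MM B (\<lambda>z. src G (fst z))"
    by (rule smooth_map_on_compose[OF charted_MM charted_M subset_refl
          smooth_map_fst[OF charted_M charted_M subset_refl] src_smooth]) auto
  have F2: "smooth_map MM B (\<lambda>z. tgt G (snd z))"
    by (rule smooth_map_on_compose[OF charted_MM charted_M subset_refl
          smooth_map_snd[OF charted_M charted_M subset_refl] tgt_smooth]) auto
  have pD: "push B (\<lambda>z. src G (fst z)) D = Tsrc G (push M fst D)"
    "push B (\<lambda>z. tgt G (snd z)) D = Ttgt G (push M snd D)" for D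
    unfolding Tsrc_def Ttgt_def
    by (rule push_compose[symmetric], rule pf(1), assumption)
      (rule push_compose[symmetric], rule pf(2), assumption)
  obtain D where D: "D \<in> tangent_space MM (g, h)" "push M fst D = v" "push M snd D = w"
    by (rule prod_tangent_exists[OF charted_M charted_M g(1) v g(2) w])
  obtain c where c: "diff_curve MM c" "c 0 = (g, h)" "velocity MM c = D"
    "\<And>t. src G (fst (c t)) = tgt G (snd (c t))"
  proof (rule coincidence_curve[OF charted_MM charted_B F1 F2, of "(g, h)" D])
    show "(g, h) \<in> points MM" using g by simp
    show "src G (fst (g, h)) = tgt G (snd (g, h))" using g by simp
    show "push B (\<lambda>z. src G (fst z)) D = push B (\<lambda>z. tgt G (snd z)) D" unfolding pD D(2,3) by (rule vw)
    show "\<exists>D\<in>tangent_space MM (g, h). push B (\<lambda>z. src G (fst z)) D - push B (\<lambda>z. tgt G (snd z)) D = u"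
      if u: "u \<in> tangent_space B (src G (fst (g, h)))" for u
    proof -
      have "u \<in> push B (src G) ` tangent_space M g"
        using src_submersion[of g] u g(1) points_M by simp
      then obtain v' where v': "v' \<in> tangent_space M g" "push B (src G) v' = u" by blast
      obtain D' where D': "D' \<in> tangent_space MM (g, h)" "push M fst D' = v'" "push M snd D' = 0"
        by (rule prod_tangent_exists[OF charted_M charted_M g(1) v'(1) g(2) tangent_space_zero[OF charted_M]])
      have "push B (\<lambda>z. src G (fst z)) D' - push B (\<lambda>z. tgt G (snd z)) D' = u"
        unfolding pD D'(2,3) using v'(2) by (simp add: Tsrc_def Ttgt_def push_zero)
      then show ?thesis using D'(1) by blast
    qed
  qed (rule D(1), blast)
  note cf = push_curve[OF charted_MM c(1) smooth_map_fst[OF charted_M charted_M subset_refl]]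
  note cs = push_curve[OF charted_MM c(1) smooth_map_snd[OF charted_M charted_M subset_refl]]
  show ?thesis
  proof (rule that[OF cf(1) cs(1)])
    show "vel (\<lambda>t. fst (c t)) = v" "vel (\<lambda>t. snd (c t)) = w" using cf(2) cs(2) c(3) D by simp_all
    show "(fst (c t), snd (c t)) \<in> composable G" for t
      unfolding composable_iff
      using diff_curve_point[OF charted_MM c(1), of t] c(4)[of t] by (simp add: mem_Times_iff points_M)
  qed (simp_all add: c(2))
qed

context
  fixes a b
  assumes a: "diff_curve M a" and b: "diff_curve M b" and ab: "\<And>t. (a t, b t) \<in> composable G"
begin

lemma mul_curve: "diff_curve M (\<lambda>t. mul G (a t) (b t))"
  using push_curve_vec(1)[OF charted_MM pair_diff_curve(1)[OF charted_M charted_M a b] mul_smooth ab] by simp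

lemma Tsrc_Ttgt_curve: "Tsrc G (vel a) = Ttgt G (vel b)"
proof -
  have "src G (a t) = tgt G (b t)" for t using ab[of t] by (simp add: composable_iff)
  then show ?thesis
    unfolding Tsrc_def Ttgt_def push_curve(2)[OF charted_M a src_smooth] push_curve(2)[OF charted_M b tgt_smooth]
    by simp
qed

text \<open>The pair of curves gives a derivation with the prescribed components. It is the only
  one: a derivation on composable pairs is determined by its image in the product manifold, and that
  image by its two projections.\<close>

lemma Tmul_curve: "Tmul G (a 0) (vel a) (b 0) (vel b) = vel (\<lambda>t. mul G (a t) (b t))"
proof -
  let ?C = "smooth_fun_on MM (composable G)" and ?c = "\<lambda>t. (a t, b t)"
  let ?\<delta> = "curve_vec ?C ?c"
  note c = pair_diff_curve(1)[OF charted_M charted_M a b]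
  note fs = smooth_map_fst[OF charted_M charted_M composable_subset]
    smooth_map_snd[OF charted_M charted_M composable_subset]
  have pC: "(\<lambda>x. f (fst x)) \<in> ?C" "(\<lambda>x. f (snd x)) \<in> ?C" if "f \<in> smooth_fun M" for f
    using fs that by (auto simp: smooth_map_on_def o_def)
  have "(THE \<delta>. \<delta> \<in> derivations ?C (a 0, b 0) \<and> push M fst \<delta> = vel a \<and> push M snd \<delta> = vel b) = ?\<delta>"
  proof (rule the_equality)
    show ex: "?\<delta> \<in> derivations ?C (a 0, b 0) \<and> push M fst ?\<delta> = vel a \<and> push M snd ?\<delta> = vel b"
      using curve_vec_derivation[OF charted_MM c composable_subset ab]
        push_curve_vec(2)[OF charted_MM c fs(1) ab] push_curve_vec(2)[OF charted_MM c fs(2) ab] by simp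
    fix \<delta> assume d: "\<delta> \<in> derivations ?C (a 0, b 0) \<and> push M fst \<delta> = vel a \<and> push M snd \<delta> = vel b"
    have pts: "a 0 \<in> points M" "b 0 \<in> points M"
      using diff_curve_point[OF charted_M a] diff_curve_point[OF charted_M b] by blast+
    have expand: "push MM (\<lambda>x. x) \<epsilon> f = vel a (\<lambda>x. f (x, b 0)) + vel b (\<lambda>y. f (a 0, y))"
      if e: "\<epsilon> \<in> derivations ?C (a 0, b 0) \<and> push M fst \<epsilon> = vel a \<and> push M snd \<epsilon> = vel b"
        and f: "f \<in> smooth_fun MM" for \<epsilon> f
    proof -
      have t: "push MM (\<lambda>x. x) \<epsilon> \<in> tangent_space MM (a 0, b 0)"
        using push_derivation[OF charted_MM inclusion_smooth_map[OF composable_subset]] e by blast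
      have "push M fst (push MM (\<lambda>x. x) \<epsilon>) = vel a" "push M snd (push MM (\<lambda>x. x) \<epsilon>) = vel b"
        using e push_compose[of M fst MM "\<lambda>x. x" \<epsilon>] push_compose[of M snd MM "\<lambda>x. x" \<epsilon>]
          smooth_fun_fst[OF charted_M charted_M] smooth_fun_snd[OF charted_M charted_M] by simp_all
      then show ?thesis using prod_tangent_decompose[OF charted_M charted_M pts t f] by simp
    qed
    have "push MM (\<lambda>x. x) \<delta> f = push MM (\<lambda>x. x) ?\<delta> f" for f
      by (cases "f \<in> smooth_fun MM") (simp_all add: expand[OF d] expand[OF ex], simp add: push_def)
    then show "\<delta> = ?\<delta>"
      using derivation_eqI[OF charted_MM composable_subset ab, of \<delta> 0 ?\<delta>] d ex by blast
  qed
  then show ?thesis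
    unfolding Tmul_def using push_curve_vec(2)[OF charted_MM c mul_smooth ab] by simp
qed

end

lemma Tmul_zero:
  assumes gh: "(g, h) \<in> composable G" shows "Tmul G g 0 h 0 = 0"
proof -
  have g: "g \<in> points M" "h \<in> points M" "mul G g h \<in> points M"
    using gh mul_arr(1)[OF gh] points_M by (auto simp: composable_iff)
  show ?thesis
    using Tmul_curve[OF const_curve(1)[OF g(1)] const_curve(1)[OF g(2)] gh]
    by (simp add: const_curve(2) g)
qed

text \<open>Cancellation on the tangent level: \<open>u = (u \<star> y) \<star> Ti y\<close>, with
  \<open>y\<close> at the inverse of \<open>h\<close> and composable with \<open>u\<close>; such a
  \<open>y\<close> exists because \<open>tgt\<close> is a submersion. The identity is obtained on
  curves, where the arrows cancel pointwise.\<close>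

lemma Tmul_surj:
  assumes gh: "(g, h) \<in> composable G" and u: "u \<in> tangent_space M (mul G g h)"
  obtains v w where "v \<in> tangent_space M g" "w \<in> tangent_space M h" "Tsrc G v = Ttgt G w" "Tmul G g v h w = u"
proof -
  let ?k = "mul G g h"
  have g: "g \<in> arr G" "h \<in> arr G" using gh by (auto simp: composable_iff)
  note k = mul_arr[OF gh] and h' = ivt_arr[OF g(2)]
  have c: "(?k, ivt G h) \<in> composable G" using k h' by (simp add: composable_iff)
  have "Tsrc G u \<in> tangent_space B (tgt G (ivt G h))"
    using push_tangent[OF charted_M charted_B src_smooth u] k h' by (simp add: Tsrc_def)
  then obtain y where y: "y \<in> tangent_space M (ivt G h)" "Tsrc G u = Ttgt G y"
    using tgt_submersion[OF h'(1)] unfolding Ttgt_def by blast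
  obtain a b where ab: "diff_curve M a" "diff_curve M b" "a 0 = ?k" "b 0 = ivt G h" "vel a = u" "vel b = y"
    and cab: "\<And>t. (a t, b t) \<in> composable G"
    by (rule composable_curve[OF c u y]) blast
  define a' where "a' t = mul G (a t) (b t)" for t
  define b' where "b' t = ivt G (b t)" for t
  have arrs: "a t \<in> arr G" "b t \<in> arr G" for t using cab[of t] by (auto simp: composable_iff)
  have a': "diff_curve M a'" unfolding a'_def by (rule mul_curve[OF ab(1,2) cab])
  have b': "diff_curve M b'" unfolding b'_def by (rule push_curve(1)[OF charted_M ab(2) ivt_smooth])
  have cab': "(a' t, b' t) \<in> composable G" for t
    using mul_arr[OF cab[of t]] ivt_arr[OF arrs(2)] by (simp add: composable_iff a'_def b'_def)
  have 0: "a' 0 = g" "b' 0 = h"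
    using mul_ivt_cancel[OF gh] ivt_ivt[OF g(2)] ab(3,4) by (simp_all add: a'_def b'_def)
  have "mul G (a' t) (b' t) = a t" for t
    using mul_ivt_cancel[OF cab[of t]] by (simp add: a'_def b'_def)
  then have "Tmul G g (vel a') h (vel b') = u"
    using Tmul_curve[OF a' b' cab'] 0 ab(5) by simp
  then show ?thesis
    using that[OF _ _ Tsrc_Ttgt_curve[OF a' b' cab']] curve_vec_tangent[OF charted_M a']
      curve_vec_tangent[OF charted_M b'] 0 by simp
qed

subsection \<open>Translations\<close>

lemma src_fibre_subset: "src_fibre G x \<subseteq> points M"
  using points_M by (auto simp: src_fibre_def)

text \<open>The source fibre is the coincidence set of \<open>src\<close> with a constant map, whose
  tangent map is 0. Since \<open>src\<close> is a submersion, a vector in the kernel of its tangent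
  map is the velocity of a curve inside the fibre.\<close>

lemma algebroid_curve:
  assumes x: "x \<in> obj G" and a: "a \<in> algebroid G x"
  obtains c where "diff_curve M c" "c 0 = idt G x" "vel c = a" "\<And>t. c t \<in> src_fibre G x"
proof -
  have e: "idt G x \<in> points M" "src G (idt G x) = x" using idt_arr[OF x] points_M by auto
  have at: "a \<in> tangent_space M (idt G x)" "push B (src G) a = 0" using a by (auto simp: algebroid_def Tsrc_def)
  have cs: "smooth_map M B (\<lambda>k. x)"
    using x points_B smooth_fun_const[OF charted_M]
    by (auto simp: smooth_map_on_def smooth_fun_on_self[OF charted_M] o_def)
  have pc: "push B (\<lambda>k. x) v = 0" if "v \<in> tangent_space M (idt G x)" for v
    using tangent_const[OF charted_M e(1) that] by (auto simp: push_def on_space_def o_def fun_eq_iff)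
  obtain c where c: "diff_curve M c" "c 0 = idt G x" "vel c = a" "\<And>t. src G (c t) = x"
  proof (rule coincidence_curve[OF charted_M charted_B src_smooth cs e])
    show "\<exists>v\<in>tangent_space M (idt G x). push B (src G) v - push B (\<lambda>k. x) v = u"
      if u: "u \<in> tangent_space B (src G (idt G x))" for u
    proof -
      have "u \<in> push B (src G) ` tangent_space M (idt G x)"
        using src_submersion[of "idt G x"] u e(1) points_M by simp
      then obtain v where "v \<in> tangent_space M (idt G x)" "push B (src G) v = u" by blast
      then show ?thesis using pc by (intro bexI[of _ v]) auto
    qed
    show "push B (src G) a = push B (\<lambda>k. x) a" using at pc by simp
  qed (rule at(1), blast)
  show ?thesis
    using diff_curve_point[OF charted_M c(1)] points_M c(4)
    by (intro that[OF c(1-3)]) (auto simp: src_fibre_def)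
qed

lemma as_sub_tangent_curve:
  assumes c: "diff_curve M c" and S: "S \<subseteq> points M" and cS: "\<And>t. c t \<in> S"
  shows "as_sub_tangent M S (c 0) (vel c) = curve_vec (smooth_fun_on M S) c"
  unfolding as_sub_tangent_def
proof (rule the_equality)
  note d = curve_vec_derivation[OF charted_M c S cS]
  note p = push_curve_vec(2)[OF charted_M c inclusion_smooth_map[OF S] cS]
  show "curve_vec (smooth_fun_on M S) c \<in> derivations (smooth_fun_on M S) (c 0) \<and>
      push M (\<lambda>x. x) (curve_vec (smooth_fun_on M S) c) = vel c"
    using d p by simp
  show "\<delta> = curve_vec (smooth_fun_on M S) c"
    if "\<delta> \<in> derivations (smooth_fun_on M S) (c 0) \<and> push M (\<lambda>x. x) \<delta> = vel c" for \<delta>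
    using derivation_eqI[OF charted_M S cS, of \<delta> 0] that d p by simp
qed

context
  fixes c x
  assumes x: "x \<in> obj G" and c: "diff_curve M c" and c0: "c 0 = idt G x" and cx: "\<And>t. c t \<in> src_fibre G x"
begin

text \<open>Translation by \<open>h\<close> makes sense on a source fibre only, so its smoothness
  there is deduced from that of multiplication on composable pairs, restricted to the pairs
  \<open>(k, h)\<close>.\<close>

lemma right_vec_curve:
  assumes h: "h \<in> arr G" "tgt G h = x"
  shows "diff_curve M (\<lambda>t. mul G (c t) h)" and "right_vec G h (vel c) = vel (\<lambda>t. mul G (c t) h)"
proof -
  have hM: "h \<in> points M" using h points_M by simp
  have pair: "smooth_map_on M (src_fibre G x) MM (\<lambda>k. (k, h))"
    by (rule smooth_map_on_compose[OF charted_M charted_M src_fibre_subset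
          inclusion_smooth_map[OF src_fibre_subset] smooth_map_slice_fst[OF charted_M charted_M hM]])
      (rule image_subsetI, use src_fibre_subset in blast)
  have "smooth_map_on M (src_fibre G x) M (\<lambda>k. case (k, h) of (g, h) \<Rightarrow> mul G g h)"
    by (rule smooth_map_on_compose[OF charted_M charted_MM src_fibre_subset pair mul_smooth])
      (use h in \<open>auto simp: src_fibre_def composable_iff\<close>)
  then have s: "smooth_map_on M (src_fibre G x) M (\<lambda>k. mul G k h)" by simp
  show "diff_curve M (\<lambda>t. mul G (c t) h)" by (rule push_curve_vec(1)[OF charted_M c s cx])
  show "right_vec G h (vel c) = vel (\<lambda>t. mul G (c t) h)"
    unfolding right_vec_def h(2) c0[symmetric] as_sub_tangent_curve[OF c src_fibre_subset cx]
    by (rule push_curve_vec(2)[OF charted_M c s cx])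
qed

lemma left_vec_curve:
  assumes g: "g \<in> arr G" "src G g = x"
  shows "diff_curve M (\<lambda>t. mul G g (ivt G (c t)))" and "left_vec G g (vel c) = - vel (\<lambda>t. mul G g (ivt G (c t)))"
proof -
  have gM: "g \<in> points M" using g points_M by simp
  have iv: "smooth_map_on M (src_fibre G x) M (ivt G)"
    by (rule smooth_map_on_compose[OF charted_M charted_M src_fibre_subset
          inclusion_smooth_map[OF src_fibre_subset] ivt_smooth])
      (rule image_subsetI, use src_fibre_subset in blast)
  have pair: "smooth_map_on M (src_fibre G x) MM (\<lambda>k. (g, ivt G k))"
    by (rule smooth_map_on_compose[OF charted_M charted_M src_fibre_subset iv
          smooth_map_slice_snd[OF charted_M charted_M gM]])
      (use iv in \<open>auto simp: smooth_map_on_def\<close>)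
  have "smooth_map_on M (src_fibre G x) M (\<lambda>k. case (g, ivt G k) of (g, h) \<Rightarrow> mul G g h)"
    by (rule smooth_map_on_compose[OF charted_M charted_MM src_fibre_subset pair mul_smooth])
      (use g ivt_arr in \<open>auto simp: src_fibre_def composable_iff\<close>)
  then have s: "smooth_map_on M (src_fibre G x) M (\<lambda>k. mul G g (ivt G k))" by simp
  show "diff_curve M (\<lambda>t. mul G g (ivt G (c t)))" by (rule push_curve_vec(1)[OF charted_M c s cx])
  show "left_vec G g (vel c) = - vel (\<lambda>t. mul G g (ivt G (c t)))"
    unfolding left_vec_def g(2) c0[symmetric] as_sub_tangent_curve[OF c src_fibre_subset cx]
    by (subst push_curve_vec(2)[OF charted_M c s cx]) (rule refl)
qed

end

end

section \<open>Covectors annihilating the graph of the multiplication\<close>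

lemma dual_uminus: "\<alpha> \<in> dual V \<Longrightarrow> - \<alpha> \<in> dual V"
  by (auto simp: dual_def linear_on_def)

lemma dual_minus_arg: "\<alpha> \<in> dual V \<Longrightarrow> v \<in> V \<Longrightarrow> \<alpha> (- v) = - \<alpha> v"
  using dualD(2)[of \<alpha> V v "-1"] by simp

context lie_groupoid_curves
begin

abbreviation M3 where "M3 \<equiv> prod_manifold M MM"

lemma charted_M3: "charted M3"
  by (rule prod_charted[OF charted_M charted_MM])

lemma mul_graph_subset: "mul_graph G \<subseteq> points M3"
proof (rule subsetI)
  fix z assume "z \<in> mul_graph G"
  then obtain g h where z: "z = (g, h, mul G g h)" and gh: "(g, h) \<in> composable G"
    unfolding mul_graph_def by blast
  show "z \<in> points M3"
    using composable_subset gh mul_arr(1)[OF gh] by (auto simp: z points_M)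
qed

lemma graph_curve:
  assumes a: "diff_curve M a" and b: "diff_curve M b" and ab: "\<And>t. (a t, b t) \<in> composable G"
  shows "velocity M3 (\<lambda>t. (a t, b t, mul G (a t) (b t)))
    \<in> sub_tangent M3 (mul_graph G) (a 0, b 0, mul G (a 0) (b 0))"
proof -
  note bm = pair_diff_curve(1)[OF charted_M charted_M b mul_curve[OF a b ab]]
  have "(a t, b t, mul G (a t) (b t)) \<in> mul_graph G" for t
    using ab unfolding mul_graph_def by blast
  from curve_vec_sub_tangent[OF charted_M3 pair_diff_curve(1)[OF charted_M charted_MM a bm] mul_graph_subset this]
  show ?thesis .
qed

context
  fixes g h \<xi>
  assumes gh: "(g, h) \<in> composable G"
    and \<xi>: "\<xi> \<in> cotangent_space M3 (g, h, mul G g h)"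
    and ann: "\<And>v. v \<in> sub_tangent M3 (mul_graph G) (g, h, mul G g h) \<Longrightarrow> \<xi> v = 0"
begin

text \<open>Names for the blocks of \<open>\<xi> = (\<alpha>, \<beta>, - \<gamma>)\<close>, with
  \<zeta> comprising the last two. The sign in \<gamma> is chosen so that \<gamma> becomes the
  product of \<alpha> and \<beta>.\<close>

abbreviation (input) "\<alpha> \<equiv> covec_fst M MM (g, h, mul G g h) \<xi>"
abbreviation (input) "\<zeta> \<equiv> covec_snd M MM (g, h, mul G g h) \<xi>"
abbreviation (input) "\<beta> \<equiv> covec_fst M M (h, mul G g h) \<zeta>"
abbreviation (input) "\<gamma> \<equiv> - covec_snd M M (h, mul G g h) \<zeta>"

lemma graph_points: "g \<in> points M" "h \<in> points M" "mul G g h \<in> points M"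
  using gh mul_arr(1)[OF gh] by (simp_all add: composable_iff points_M)

lemma graph_arr: "g \<in> arr G" "h \<in> arr G" "mul G g h \<in> arr G" "src G g = tgt G h"
  using gh mul_arr(1)[OF gh] by (simp_all add: composable_iff)

lemma graph_covectors:
  shows "\<alpha> \<in> cotangent_space M g" and "\<beta> \<in> cotangent_space M h" and "\<gamma> \<in> cotangent_space M (mul G g h)"
    and "\<zeta> \<in> cotangent_space MM (h, mul G g h)"
proof -
  have hk: "(h, mul G g h) \<in> points MM" using graph_points by simp
  note c = covec_components[OF charted_M charted_MM graph_points(1) hk \<xi>]
  note d = covec_components[OF charted_M charted_M graph_points(2,3) c(2)]
  show "\<alpha> \<in> cotangent_space M g" "\<zeta> \<in> cotangent_space MM (h, mul G g h)"
    by (rule c)+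
  show "\<beta> \<in> cotangent_space M h" by (rule d(1))
  show "\<gamma> \<in> cotangent_space M (mul G g h)"
    using d(2) unfolding cotangent_space_def by (rule dual_uminus)
qed

text \<open>A curve of composable pairs lifts to the graph, where its velocity is annihilated by
  \<xi>; splitting \<xi> into blocks, twice, gives the relation.\<close>

lemma graph_covector_relation:
  assumes a: "diff_curve M a" and b: "diff_curve M b" and ab: "\<And>t. (a t, b t) \<in> composable G"
    and 0: "a 0 = g" "b 0 = h"
  shows "\<gamma> (vel (\<lambda>t. mul G (a t) (b t))) = \<alpha> (vel a) + \<beta> (vel b)"
proof -
  note m = mul_curve[OF a b ab]
  note bm = pair_diff_curve(1)[OF charted_M charted_M b m]
  have "\<xi> (velocity M3 (\<lambda>t. (a t, b t, mul G (a t) (b t)))) = 0"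
    using ann graph_curve[OF a b ab] by (simp add: 0)
  moreover have "\<xi> (velocity M3 (\<lambda>t. (a t, b t, mul G (a t) (b t)))) =
    \<alpha> (vel a) + \<zeta> (velocity MM (\<lambda>t. (b t, mul G (a t) (b t))))"
    using covec_pair_curve[OF charted_M charted_MM a bm] \<xi> by (simp add: 0)
  moreover have "\<zeta> (velocity MM (\<lambda>t. (b t, mul G (a t) (b t))))
    = \<beta> (vel b) - \<gamma> (vel (\<lambda>t. mul G (a t) (b t)))"
    using covec_pair_curve[OF charted_M charted_M b m, of "\<zeta>"]
      graph_covectors(4) by (simp add: 0)
  ultimately show ?thesis by simp
qed

text \<open>The defining property of the product holds for \<gamma> because composable vectors are
  velocities of composable curves. Uniqueness holds because, by \<open>Tmul_surj\<close>, products
  of vectors exhaust the tangent space at \<open>mul G g h\<close>.\<close>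

lemma graph_covector_mul: "mul (cotangent_groupoid G) (g, \<alpha>) (h, \<beta>) = (mul G g h, \<gamma>)"
proof -
  let ?P = "\<lambda>\<delta>. \<delta> \<in> cotangent_space M (mul G g h) \<and>
      (\<forall>v\<in>tangent_space M g. \<forall>w\<in>tangent_space M h. Tsrc G v = Ttgt G w \<longrightarrow> \<delta> (Tmul G g v h w) = \<alpha> v + \<beta> w)"
  have "(THE \<delta>. ?P \<delta>) = \<gamma>"
  proof (rule the_equality)
    show P: "?P \<gamma>"
    proof (intro conjI ballI impI graph_covectors(3))
      fix v w assume v: "v \<in> tangent_space M g" and w: "w \<in> tangent_space M h" and vw: "Tsrc G v = Ttgt G w"
      obtain a b where ab: "diff_curve M a" "diff_curve M b" and 0: "a 0 = g" "b 0 = h" "vel a = v" "vel b = w"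
        and c: "\<And>t. (a t, b t) \<in> composable G"
        by (rule composable_curve[OF gh v w vw]) blast
      show "\<gamma> (Tmul G g v h w) = \<alpha> v + \<beta> w"
        using graph_covector_relation[OF ab c 0(1,2)] Tmul_curve[OF ab c] by (simp only: 0)
    qed
    fix \<delta> assume d: "?P \<delta>"
    show "\<delta> = \<gamma>"
    proof (rule dual_eqI)
      show "\<delta> \<in> dual (tangent_space M (mul G g h))" "\<gamma> \<in> dual (tangent_space M (mul G g h))"
        using conjunct1[OF d] graph_covectors(3) by (simp_all only: cotangent_space_def)
      fix u assume u: "u \<in> tangent_space M (mul G g h)"
      obtain v w where vw: "v \<in> tangent_space M g" "w \<in> tangent_space M h" "Tsrc G v = Ttgt G w" "Tmul G g v h w = u"
        by (rule Tmul_surj[OF gh u])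
      have "\<delta> (Tmul G g v h w) = \<alpha> v + \<beta> w" "\<gamma> (Tmul G g v h w) = \<alpha> v + \<beta> w"
        using conjunct2[OF d] conjunct2[OF P] vw(1,2,3) by blast+
      then show "\<delta> u = \<gamma> u" using vw(4) by simp
    qed
  qed
  then show ?thesis unfolding cotangent_groupoid_def by simp
qed

text \<open>For a curve \<open>c\<close> in the source fibre with velocity \<open>a\<close>, the
  curve \<open>(g c(t)^(-1), c(t) h, g h)\<close> in the graph has a constant last component.
  Annihilation by \<xi> therefore equates \<alpha> on \<open>left_vec G g a\<close> with \<beta> on
  \<open>right_vec G h a\<close>, the sign being absorbed by the one in
  \<open>left_vec\<close>.\<close>

lemma graph_covector_composable: "src (cotangent_groupoid G) (g, \<alpha>) = tgt (cotangent_groupoid G) (h, \<beta>)"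
proof -
  let ?x = "src G g"
  have x: "?x \<in> obj G" "tgt G h = ?x" using src_tgt_obj graph_arr by auto
  have "\<alpha> (left_vec G g a) = \<beta> (right_vec G h a)" if a: "a \<in> algebroid G ?x" for a
  proof -
    obtain c where c: "diff_curve M c" "c 0 = idt G ?x" "vel c = a" "\<And>t. c t \<in> src_fibre G ?x"
      by (rule algebroid_curve[OF x(1) a]) blast
    note l = left_vec_curve[OF x(1) c(1,2,4) graph_arr(1) refl]
    note r = right_vec_curve[OF x(1) c(1,2,4) graph_arr(2) x(2)]
    have ct: "c t \<in> arr G" "src G (c t) = ?x" for t using c(4)[of t] by (auto simp: src_fibre_def)
    have 0: "mul G g (ivt G (c 0)) = g" "mul G (c 0) h = h"
      using ivt_idt[OF x(1)] mul_idt(1)[OF graph_arr(1)] mul_idt(2)[OF graph_arr(2)] x(2) by (simp_all add: c(2))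
    note rel = graph_covector_relation[OF l(1) r(1) mul_translate(1)[OF gh ct] 0]
    have "vel (\<lambda>t. mul G (mul G g (ivt G (c t))) (mul G (c t) h)) = 0"
      by (simp only: mul_translate(2)[OF gh ct] const_curve(2)[OF graph_points(3)])
    with rel have "\<alpha> (vel (\<lambda>t. mul G g (ivt G (c t)))) + \<beta> (vel (\<lambda>t. mul G (c t) h)) = 0"
      using dual_zero[OF graph_covectors(3)[unfolded cotangent_space_def]] by simp
    moreover have "\<alpha> (- vel (\<lambda>t. mul G g (ivt G (c t)))) = - \<alpha> (vel (\<lambda>t. mul G g (ivt G (c t))))"
    proof (rule dual_minus_arg[OF graph_covectors(1)[unfolded cotangent_space_def]])
      show "vel (\<lambda>t. mul G g (ivt G (c t))) \<in> tangent_space M g"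
        using curve_vec_tangent[OF charted_M l(1)] by (simp only: 0)
    qed
    ultimately show ?thesis using l(2) r(2) c(3) by simp
  qed
  then show ?thesis
    using x(2) unfolding cotangent_groupoid_def by (auto simp: on_space_def fun_eq_iff)
qed

text \<open>Both sides split into three terms when applied to a test function \<open>f\<close>, one
  for each slice of \<open>f\<close> through the point of the graph, and the terms agree one by
  one.\<close>

lemma graph_sharp:
  assumes bi: "bivector_field M \<pi>"
    and ab: "diff_curve M a" "diff_curve M b" and c: "\<And>t. (a t, b t) \<in> composable G"
    and 0: "a 0 = g" "b 0 = h" and va: "vel a = sharp M \<pi> g \<alpha>" and vb: "vel b = sharp M \<pi> h \<beta>"
    and vm: "vel (\<lambda>t. mul G (a t) (b t)) = sharp M \<pi> (mul G g h) \<gamma>"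
  shows "sharp M3 (prod_bivector M MM \<pi> (prod_bivector M M \<pi> (- \<pi>))) (g, h, mul G g h) \<xi>
    = velocity M3 (\<lambda>t. (a t, b t, mul G (a t) (b t)))"
proof
  let ?k = "mul G g h"
  note m = mul_curve[OF ab c]
  note bm = pair_diff_curve[OF charted_M charted_M ab(2) m]
  fix f
  show "sharp M3 (prod_bivector M MM \<pi> (prod_bivector M M \<pi> (- \<pi>))) (g, h, ?k) \<xi> f
    = velocity M3 (\<lambda>t. (a t, b t, mul G (a t) (b t))) f"
  proof (cases "f \<in> smooth_fun M3")
    case True
    have hk: "(h, ?k) \<in> points MM" using graph_points by simp
    have f1: "(\<lambda>x. f (x, h, ?k)) \<in> smooth_fun M" by (rule smooth_fun_slice_fst[OF charted_M charted_MM True hk])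
    have f23: "(\<lambda>y. f (g, y)) \<in> smooth_fun MM" by (rule smooth_fun_slice_snd[OF charted_M charted_MM True graph_points(1)])
    have f2: "(\<lambda>x. f (g, x, ?k)) \<in> smooth_fun M" by (rule smooth_fun_slice_fst[OF charted_M charted_M f23 graph_points(3)])
    have f3: "(\<lambda>y. f (g, h, y)) \<in> smooth_fun M" by (rule smooth_fun_slice_snd[OF charted_M charted_M f23 graph_points(2)])
    have alt: "alternating_on (cotangent_space M ?k) (\<pi> ?k)"
      using bi graph_points(3) unfolding bivector_field_def by blast
    \<comment> \<open>In the third block the sign of \<open>- \<pi>\<close> cancels the sign with
      which \<gamma> enters \<xi>.\<close>
    have neg: "- \<pi> ?k (- \<gamma>) \<eta> = \<pi> ?k \<gamma> \<eta>" if \<eta>: "\<eta> \<in> cotangent_space M ?k" for \<eta>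
    proof -
      note \<gamma> = graph_covectors(3)
      have n\<gamma>: "- \<gamma> \<in> cotangent_space M ?k" using \<gamma> unfolding cotangent_space_def by (rule dual_uminus)
      have "\<pi> ?k \<eta> ((-1) *\<^sub>R \<gamma>) = (-1) *\<^sub>R \<pi> ?k \<eta> \<gamma>"
        using alt \<eta> \<gamma> unfolding alternating_on_def linear_on_def by blast
      moreover have "\<pi> ?k (- \<gamma>) \<eta> = - \<pi> ?k \<eta> (- \<gamma>)" "\<pi> ?k \<gamma> \<eta> = - \<pi> ?k \<eta> \<gamma>"
        using alt \<eta> \<gamma> n\<gamma> unfolding alternating_on_def by blast+
      ultimately show ?thesis by simp
    qed
    have "sharp M3 (prod_bivector M MM \<pi> (prod_bivector M M \<pi> (- \<pi>))) (g, h, ?k) \<xi> f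
      = \<pi> g \<alpha> (differential M (\<lambda>x. f (x, h, ?k)) g) + \<pi> h \<beta> (differential M (\<lambda>x. f (g, x, ?k)) h)
        + \<pi> ?k \<gamma> (differential M (\<lambda>y. f (g, h, y)) ?k)"
      using True neg[OF differential_cotangent[OF charted_M]]
      by (simp add: sharp_def prod_bivector_def
          covec_differential[OF charted_M charted_MM graph_points(1) hk True]
          covec_differential[OF charted_M charted_M graph_points(2,3) f23])
    also have "\<dots> = vel a (\<lambda>x. f (x, h, ?k)) + vel b (\<lambda>x. f (g, x, ?k))
        + vel (\<lambda>t. mul G (a t) (b t)) (\<lambda>y. f (g, h, y))"
      by (simp add: va vb vm sharp_def f1 f2 f3)
    also have "\<dots> = velocity M3 (\<lambda>t. (a t, b t, mul G (a t) (b t))) f"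
      using pair_diff_curve(2)[OF charted_M charted_MM ab(1) bm(1) True] bm(2)[OF f23] by (simp add: 0)
    finally show ?thesis .
  qed (simp add: sharp_def curve_vec_def)
qed

end

end

section \<open>From multiplicativity of \<open>J\<close> to coisotropy of the graph\<close>

theorem proposition3p2:
  fixes G :: "('g, 'm, 'e::{real_inner,heine_borel}, 'f::{real_inner,heine_borel}) lie_groupoid"
    and J :: "'g \<Rightarrow> 'g gvec \<Rightarrow> 'g gvec"
    and N :: "'g \<Rightarrow> 'g tvec \<Rightarrow> 'g tvec"
    and \<pi> :: "'g \<Rightarrow> 'g covec \<Rightarrow> 'g covec \<Rightarrow> real"
    and \<omega> :: "'g \<Rightarrow> 'g tvec \<Rightarrow> 'g tvec \<Rightarrow> real"
  assumes "glanon_groupoid G J"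
    and "tensor11_field (arr_mfd G) N"
    and "bivector_field (arr_mfd G) \<pi>"
    and "two_form (arr_mfd G) \<omega>"
    and "block_form (arr_mfd G) J N \<pi> \<omega>"
  shows "poisson_groupoid G \<pi>"
proof -
  let ?M = "arr_mfd G" and ?P = "P_groupoid G"
  have lie: "is_lie_groupoid G" and gcs: "generalized_complex_structure ?M J"
    using assms(1) by (simp_all add: glanon_groupoid_def)
  interpret L: lie_groupoid_curves G by unfold_locales (rule lie)
  interpret K: block_generalized_complex ?M J N \<pi> \<omega>
    by unfold_locales (rule L.charted_M gcs assms)+
  obtain j where j: "groupoid_morphism ?P ?P (\<lambda>(g, u). (g, J g u)) j"
    using assms(1) by (auto simp: glanon_groupoid_def)
  have arrP: "arr ?P = (SIGMA g:arr G. P_space ?M g)"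
    by (simp add: P_groupoid_def Let_def)
  have mulP: "mul ?P (g, v, \<alpha>) (h, w, \<beta>)
      = (mul G g h, Tmul G g v h w, snd (mul (cotangent_groupoid G) (g, \<alpha>) (h, \<beta>)))" for g v \<alpha> h w \<beta>
    by (simp add: P_groupoid_def Let_def fibre_pair_def tangent_groupoid_def)
  have srcP: "src ?P (g, v, \<alpha>) = (src G g, Tsrc G v, snd (src (cotangent_groupoid G) (g, \<alpha>)))" for g v \<alpha>
    by (simp add: P_groupoid_def Let_def fibre_pair_def tangent_groupoid_def)
  have tgtP: "tgt ?P (g, v, \<alpha>) = (tgt G g, Ttgt G v, snd (tgt (cotangent_groupoid G) (g, \<alpha>)))" for g v \<alpha>
    by (simp add: P_groupoid_def Let_def fibre_pair_def tangent_groupoid_def)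
  have "coisotropic L.M3 (prod_bivector ?M L.MM \<pi> (prod_bivector ?M ?M \<pi> (- \<pi>))) (mul_graph G)"
    unfolding coisotropic_def
  proof (intro conjI ballI impI L.mul_graph_subset)
    fix r \<xi>
    assume r: "r \<in> mul_graph G" and \<xi>: "\<xi> \<in> cotangent_space L.M3 r"
      and ann: "\<forall>v\<in>sub_tangent L.M3 (mul_graph G) r. \<xi> v = 0"
    obtain g h where r: "r = (g, h, mul G g h)" and gh: "(g, h) \<in> composable G"
      using r unfolding mul_graph_def by blast
    note \<xi>' = \<xi>[unfolded r] and ann' = bspec[OF ann, unfolded r]
    let ?k = "mul G g h"
    let ?\<alpha> = "covec_fst ?M L.MM (g, h, ?k) \<xi>"
    let ?\<beta> = "covec_fst ?M ?M (h, ?k) (covec_snd ?M L.MM (g, h, ?k) \<xi>)"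
    let ?\<gamma> = "- covec_snd ?M ?M (h, ?k) (covec_snd ?M L.MM (g, h, ?k) \<xi>)"
    note pts = L.graph_points[OF gh \<xi>' ann'] and arrs = L.graph_arr[OF gh \<xi>' ann']
    note cov = L.graph_covectors[OF gh \<xi>' ann']
    note fJ = K.fst_J_covector[OF pts(1) cov(1)] K.fst_J_covector[OF pts(2) cov(2)]
      K.fst_J_covector[OF pts(3) cov(3)]
    note cP = K.covector_in_P_space[OF cov(1)] K.covector_in_P_space[OF cov(2)] K.covector_in_P_space[OF cov(3)]
    note JP = K.J_space[OF pts(1) cP(1)] K.J_space[OF pts(2) cP(2)]
    let ?X = "(g, 0, ?\<alpha>)" and ?Y = "(h, 0, ?\<beta>)"
    have XY: "?X \<in> arr ?P" "?Y \<in> arr ?P" using cP arrs by (simp_all add: arrP)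
    \<comment> \<open>The tangent parts are zero, so composability in \<open>P_groupoid G\<close>
      comes down to that of the covectors.\<close>
    have st: "src ?P ?X = tgt ?P ?Y"
      using L.graph_covector_composable[OF gh \<xi>' ann'] arrs(4)
      by (simp add: srcP tgtP Tsrc_def Ttgt_def push_zero)
    have comp: "(?X, ?Y) \<in> composable ?P" using XY st by (simp add: composable_def)
    \<comment> \<open>Source and target are intertwined with the same base map \<open>j\<close>, so
      \<open>J\<close> carries composable elements to composable elements.\<close>
    have hom: "src ?P (g, J g u) = j (src ?P (g, u)) \<and> tgt ?P (g, J g u) = j (tgt ?P (g, u))"
      if "(g, u) \<in> arr ?P" for g u
      using j that unfolding groupoid_morphism_def by auto
    have "src ?P (g, J g (0, ?\<alpha>)) = tgt ?P (h, J h (0, ?\<beta>))"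
      using hom[OF XY(1)] hom[OF XY(2)] st by simp
    then have "Tsrc G (fst (J g (0, ?\<alpha>))) = Ttgt G (fst (J h (0, ?\<beta>)))"
      by (cases "J g (0, ?\<alpha>)"; cases "J h (0, ?\<beta>)") (simp add: srcP tgtP)
    then have vw: "Tsrc G (sharp ?M \<pi> g ?\<alpha>) = Ttgt G (sharp ?M \<pi> h ?\<beta>)"
      by (simp only: fJ)
    have tv: "sharp ?M \<pi> g ?\<alpha> \<in> tangent_space ?M g" "sharp ?M \<pi> h ?\<beta> \<in> tangent_space ?M h"
      using JP fJ
      by (simp_all add: P_space_def mem_Times_iff)
    \<comment> \<open>Zero vectors multiply to zero, so the product is again a pure covector and its
      image under \<open>J\<close> has tangent part
      \<open>sharp ?M \<pi> ?k ?\<gamma>\<close>.\<close>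
    have "mul ?P ?X ?Y = (?k, 0, ?\<gamma>)"
      by (simp add: mulP L.Tmul_zero[OF gh] L.graph_covector_mul[OF gh \<xi>' ann'])
    moreover have "(\<lambda>(g, u). (g, J g u)) (mul ?P ?X ?Y) = mul ?P (g, J g (0, ?\<alpha>)) (h, J h (0, ?\<beta>))"
      using j comp unfolding groupoid_morphism_def by fastforce
    ultimately have "(?k, J ?k (0, ?\<gamma>)) = mul ?P (g, J g (0, ?\<alpha>)) (h, J h (0, ?\<beta>))" by simp
    then have "fst (J ?k (0, ?\<gamma>)) = Tmul G g (fst (J g (0, ?\<alpha>))) h (fst (J h (0, ?\<beta>)))"
      by (cases "J g (0, ?\<alpha>)"; cases "J h (0, ?\<beta>)") (simp add: mulP)
    then have mult: "sharp ?M \<pi> ?k ?\<gamma> = Tmul G g (sharp ?M \<pi> g ?\<alpha>) h (sharp ?M \<pi> h ?\<beta>)"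
      by (simp only: fJ)
    \<comment> \<open>Once the two sharps are velocities of composable curves, their product is the
      velocity of the product curve, and the resulting triple of velocities is tangent to the
      graph.\<close>
    obtain a b where ab: "diff_curve ?M a" "diff_curve ?M b" and 0: "a 0 = g" "b 0 = h"
      and vel: "L.vel a = sharp ?M \<pi> g ?\<alpha>" "L.vel b = sharp ?M \<pi> h ?\<beta>"
      and c: "\<And>t. (a t, b t) \<in> composable G"
      by (rule L.composable_curve[OF gh tv vw]) blast
    have "L.vel (\<lambda>t. mul G (a t) (b t)) = sharp ?M \<pi> ?k ?\<gamma>"
      using L.Tmul_curve[OF ab c] by (simp only: mult vel 0)
    from L.graph_sharp[OF gh \<xi>' ann' assms(3) ab c 0 vel this]
    show "sharp L.M3 (prod_bivector ?M L.MM \<pi> (prod_bivector ?M ?M \<pi> (- \<pi>))) r \<xi>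
        \<in> sub_tangent L.M3 (mul_graph G) r"
      using L.graph_curve[OF ab c] by (simp only: r 0)
  qed
  then show ?thesis
    using lie K.poisson by (simp add: poisson_groupoid_def Let_def)
qed

end
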